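(* Fix $k\in \mathbb{N}_{\geq 1}\cup \{\infty\}$. Let $\Phi$ be a $C^k$ flow on a compact $C^k$ manifold $X$. Then $(X,\Phi)$ is linearizable by a $C^k$ embedding if and only if $\Phi$ is a $1$-parameter subgroup of a $C^k$ torus action on $X$.
   Context: Manifolds are, as usual, finite-dimensional, Hausdorff, second countable and without boundary. A flow on $X$ is a group action $\Phi\colon \mathbb{R}\times X\to X$, $(t,x)\mapsto \Phi^t(x)$, of $(\mathbb{R},+)$ on $X$; it is $C^k$ if $\Phi$ is a $C^k$ map. A map $F\colon X\to\mathbb{R}^n$ is linearizing (for $\Phi$) if there is a matrix $B\in\mathbb{R}^{n\times n}$ such that $F\circ\Phi^t=e^{Bt}\circ F$ for all $t\in\mathbb{R}$. For $k\geq 1$, a $C^k$ embedding is a $C^k$ map that is both an immersion and a homeomorphism onto its image (with the subspace topology). $(X,\Phi)$ is linearizable by a $C^k$ embedding if for some $n\in\mathbb{N}$ there is a linearizing $C^k$ embedding $F\colon X\to\mathbb{R}^n$. A torus action on $X$ is a group action $\Theta\colon H\times X\to X$, $(h,x)\mapsto\Theta^h(x)$, of a torus $H=T^\ell=\mathbb{R}^\ell/\mathbb{Z}^\ell$ (for some $\ell\in\mathbb{N}$); it is $C^k$ if $\Theta$ is a $C^k$ map. $\Phi$ is a $1$-parameter subgroup of $\Theta$ if there is $\boldsymbol\omega\in\mathbb{R}^\ell$ such that $\Phi^t=\Theta^{(\boldsymbol\omega t \bmod 1)}$ for all $t\in\mathbb{R}$, where "$\bmod\ 1$" is applied entrywise.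 *)

theory Defs
  imports
    "HOL-Analysis.Analysis"
    "HOL-Algebra.Elementary_Groups"
    "HOL-Algebra.Group_Action"
    "HOL-Library.Extended_Nat"
    "Jordan_Normal_Form.Matrix"
begin

text \<open>
  Since dimensions are quantified inside formulas, \<open>\<real>\<^sup>n\<close> is \<^const>\<open>Euclidean_space\<close> \<open>n\<close>:
  the functions \<^typ>\<open>nat \<Rightarrow> real\<close> vanishing at all indices \<open>\<ge> n\<close>, with the product topology.
\<close>

section \<open>\<open>C\<^sup>k\<close> maps between open subsets of Euclidean spaces\<close>

definition partial_deriv :: "nat \<Rightarrow> ((nat \<Rightarrow> real) \<Rightarrow> real) \<Rightarrow> (nat \<Rightarrow> real) \<Rightarrow> real" where
  "partial_deriv i f x = deriv (\<lambda>t. f (x(i := t))) (x i)"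

text \<open>
  All iterated partial derivatives of order at most \<open>k\<close> exist and are continuous on \<open>U\<close>, which is
  meant to be an open subset of \<open>\<real>\<^sup>n\<close> (so that the values of \<open>f\<close> outside \<open>U\<close> are irrelevant).
\<close>
primrec Ck_fun_nat :: "nat \<Rightarrow> nat \<Rightarrow> (nat \<Rightarrow> real) set \<Rightarrow> ((nat \<Rightarrow> real) \<Rightarrow> real) \<Rightarrow> bool" where
  "Ck_fun_nat 0 n U f \<longleftrightarrow>
     continuous_map (subtopology (Euclidean_space n) U) euclideanreal f"
| "Ck_fun_nat (Suc k) n U f \<longleftrightarrow>
     continuous_map (subtopology (Euclidean_space n) U) euclideanreal f \<and>
     (\<forall>i<n. (\<forall>x\<in>U. (\<lambda>t. f (x(i := t))) differentiable (at (x i))) \<and>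
            Ck_fun_nat k n U (partial_deriv i f))"

definition Ck_on :: "enat \<Rightarrow> nat \<Rightarrow> nat \<Rightarrow> (nat \<Rightarrow> real) set
    \<Rightarrow> ((nat \<Rightarrow> real) \<Rightarrow> nat \<Rightarrow> real) \<Rightarrow> bool" where
  "Ck_on k n m U g \<longleftrightarrow>
     (\<forall>j<m. \<forall>r::nat. enat r \<le> k \<longrightarrow> Ck_fun_nat r n U (\<lambda>x. g x j))"

definition differential_at :: "nat \<Rightarrow> nat \<Rightarrow> ((nat \<Rightarrow> real) \<Rightarrow> nat \<Rightarrow> real)
    \<Rightarrow> (nat \<Rightarrow> real) \<Rightarrow> (nat \<Rightarrow> real) \<Rightarrow> (nat \<Rightarrow> real)" where
  "differential_at n m g p v =
     (\<lambda>j. if j < m then (\<Sum>i<n. partial_deriv i (\<lambda>x. g x j) p * v i) else 0)"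

section \<open>\<open>C\<^sup>k\<close> manifolds and maps\<close>

record 'a chart =
  chart_dim :: nat
  chart_dom :: "'a set"
  chart_map :: "'a \<Rightarrow> nat \<Rightarrow> real"

record 'a mfd =
  mfd_top :: "'a topology"
  mfd_atlas :: "'a chart set"

abbreviation points :: "'a mfd \<Rightarrow> 'a set" where
  "points M \<equiv> topspace (mfd_top M)"

definition chart_of :: "'a topology \<Rightarrow> 'a chart \<Rightarrow> bool" where
  "chart_of X c \<longleftrightarrow>
     openin X (chart_dom c) \<and>
     openin (Euclidean_space (chart_dim c)) (chart_map c ` chart_dom c) \<and>
     homeomorphic_map (subtopology X (chart_dom c))
       (subtopology (Euclidean_space (chart_dim c)) (chart_map c ` chart_dom c)) (chart_map c)"

definition local_rep :: "'a chart \<Rightarrow> 'b chart \<Rightarrow> ('a \<Rightarrow> 'b) \<Rightarrow> (nat \<Rightarrow> real) \<Rightarrow> nat \<Rightarrow> real" where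
  "local_rep c d f = chart_map d \<circ> f \<circ> inv_into (chart_dom c) (chart_map c)"

definition local_Ck :: "enat \<Rightarrow> 'a chart \<Rightarrow> 'b chart \<Rightarrow> ('a \<Rightarrow> 'b) \<Rightarrow> bool" where
  "local_Ck k c d f \<longleftrightarrow>
     Ck_on k (chart_dim c) (chart_dim d)
       (chart_map c ` (chart_dom c \<inter> f -` chart_dom d)) (local_rep c d f)"

text \<open>
  The dimension is attached to the charts, hence locally constant; it may differ between
  connected components. The atlas need not be maximal.
\<close>
definition Ck_manifold :: "enat \<Rightarrow> 'a mfd \<Rightarrow> bool" where
  "Ck_manifold k M \<longleftrightarrow>
     Hausdorff_space (mfd_top M) \<and> second_countable (mfd_top M) \<and>
     (\<forall>c\<in>mfd_atlas M. chart_of (mfd_top M) c) \<and>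
     \<Union> (chart_dom ` mfd_atlas M) = points M \<and>
     (\<forall>c\<in>mfd_atlas M. \<forall>d\<in>mfd_atlas M. local_Ck k c d id)"

definition Ck_map :: "enat \<Rightarrow> 'a mfd \<Rightarrow> 'b mfd \<Rightarrow> ('a \<Rightarrow> 'b) \<Rightarrow> bool" where
  "Ck_map k M N f \<longleftrightarrow>
     continuous_map (mfd_top M) (mfd_top N) f \<and>
     (\<forall>c\<in>mfd_atlas M. \<forall>d\<in>mfd_atlas N. local_Ck k c d f)"

definition immersion :: "'a mfd \<Rightarrow> 'b mfd \<Rightarrow> ('a \<Rightarrow> 'b) \<Rightarrow> bool" where
  "immersion M N f \<longleftrightarrow>
     (\<forall>x\<in>points M. \<forall>c\<in>mfd_atlas M. \<forall>d\<in>mfd_atlas N.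
        x \<in> chart_dom c \<longrightarrow> f x \<in> chart_dom d \<longrightarrow>
        inj_on (differential_at (chart_dim c) (chart_dim d) (local_rep c d f) (chart_map c x))
          (topspace (Euclidean_space (chart_dim c))))"

definition Ck_embedding :: "enat \<Rightarrow> 'a mfd \<Rightarrow> 'b mfd \<Rightarrow> ('a \<Rightarrow> 'b) \<Rightarrow> bool" where
  "Ck_embedding k M N f \<longleftrightarrow>
     Ck_map k M N f \<and> immersion M N f \<and> embedding_map (mfd_top M) (mfd_top N) f"

definition prod_chart :: "'a chart \<Rightarrow> 'b chart \<Rightarrow> ('a \<times> 'b) chart" where
  "prod_chart c d =
     \<lparr>chart_dim = chart_dim c + chart_dim d,
      chart_dom = chart_dom c \<times> chart_dom d,
      chart_map = (\<lambda>(x, y) i. if i < chart_dim c then chart_map c x i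
                               else chart_map d y (i - chart_dim c))\<rparr>"

definition prod_mfd :: "'a mfd \<Rightarrow> 'b mfd \<Rightarrow> ('a \<times> 'b) mfd" where
  "prod_mfd M N =
     \<lparr>mfd_top = prod_topology (mfd_top M) (mfd_top N),
      mfd_atlas = {prod_chart c d | c d. c \<in> mfd_atlas M \<and> d \<in> mfd_atlas N}\<rparr>"

definition Euclidean_mfd :: "nat \<Rightarrow> (nat \<Rightarrow> real) mfd" where
  "Euclidean_mfd n =
     \<lparr>mfd_top = Euclidean_space n,
      mfd_atlas = {\<lparr>chart_dim = n, chart_dom = topspace (Euclidean_space n), chart_map = id\<rparr>}\<rparr>"

definition real_mfd :: "real mfd" where
  "real_mfd =
     \<lparr>mfd_top = euclideanreal,
      mfd_atlas = {\<lparr>chart_dim = 1, chart_dom = UNIV, chart_map = (\<lambda>t i. if i = 0 then t else 0)\<rparr>}\<rparr>"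

section \<open>Flows and linearization\<close>

definition real_group :: "real monoid" where
  "real_group = \<lparr>carrier = UNIV, monoid.mult = (+), one = 0\<rparr>"

text \<open>
  As usual for \<^const>\<open>group_action\<close>, the bijections \<open>\<Phi> t\<close> of \<open>X\<close> are represented by
  extensional functions.
\<close>
definition Ck_flow :: "enat \<Rightarrow> 'a mfd \<Rightarrow> (real \<Rightarrow> 'a \<Rightarrow> 'a) \<Rightarrow> bool" where
  "Ck_flow k X \<Phi> \<longleftrightarrow>
     group_action real_group (points X) \<Phi> \<and>
     Ck_map k (prod_mfd real_mfd X) X (\<lambda>(t, x). \<Phi> t x)"

definition mat_exp :: "real mat \<Rightarrow> real mat" where
  "mat_exp A = Matrix.mat (dim_row A) (dim_row A) (\<lambda>(i, j). \<Sum>r. (A ^\<^sub>m r) $$ (i, j) / fact r)"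

definition linearizing :: "'a mfd \<Rightarrow> (real \<Rightarrow> 'a \<Rightarrow> 'a) \<Rightarrow> nat \<Rightarrow> ('a \<Rightarrow> nat \<Rightarrow> real) \<Rightarrow> bool" where
  "linearizing X \<Phi> n F \<longleftrightarrow>
     F \<in> points X \<rightarrow> topspace (Euclidean_space n) \<and>
     (\<exists>B\<in>carrier_mat n n. \<forall>t. \<forall>x\<in>points X.
        Matrix.vec n (F (\<Phi> t x)) = mat_exp (t \<cdot>\<^sub>m B) *\<^sub>v Matrix.vec n (F x))"

definition linearizable_by_Ck_embedding :: "enat \<Rightarrow> 'a mfd \<Rightarrow> (real \<Rightarrow> 'a \<Rightarrow> 'a) \<Rightarrow> bool" where
  "linearizable_by_Ck_embedding k X \<Phi> \<longleftrightarrow>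
     (\<exists>n F. Ck_embedding k X (Euclidean_mfd n) F \<and> linearizing X \<Phi> n F)"

section \<open>Tori and torus actions\<close>

definition Euclidean_group :: "nat \<Rightarrow> (nat \<Rightarrow> real) monoid" where
  "Euclidean_group l =
     \<lparr>carrier = topspace (Euclidean_space l), monoid.mult = (\<lambda>x y i. x i + y i), one = (\<lambda>_. 0)\<rparr>"

definition integer_lattice :: "nat \<Rightarrow> (nat \<Rightarrow> real) set" where
  "integer_lattice l = {x \<in> topspace (Euclidean_space l). \<forall>i. x i \<in> \<int>}"

definition torus_group :: "nat \<Rightarrow> (nat \<Rightarrow> real) set monoid" where
  "torus_group l = Euclidean_group l Mod integer_lattice l"

definition torus_proj :: "nat \<Rightarrow> (nat \<Rightarrow> real) \<Rightarrow> (nat \<Rightarrow> real) set" where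
  "torus_proj l x = integer_lattice l #>\<^bsub>Euclidean_group l\<^esub> x"

definition torus_top :: "nat \<Rightarrow> (nat \<Rightarrow> real) set topology" where
  "torus_top l = topology (\<lambda>U. U \<subseteq> carrier (torus_group l) \<and>
     openin (Euclidean_space l) {x \<in> topspace (Euclidean_space l). torus_proj l x \<in> U})"

lemma openin_torus_top:
  "openin (torus_top l) U \<longleftrightarrow> U \<subseteq> carrier (torus_group l) \<and>
     openin (Euclidean_space l) {x \<in> topspace (Euclidean_space l). torus_proj l x \<in> U}"
proof -
  let ?E = "Euclidean_space l"
  let ?P = "\<lambda>U. {x \<in> topspace ?E. torus_proj l x \<in> U}"
  have "istopology (\<lambda>U. U \<subseteq> carrier (torus_group l) \<and> openin ?E (?P U))"
    unfolding istopology_def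
  proof (intro conjI allI impI)
    fix S T assume "S \<subseteq> carrier (torus_group l) \<and> openin ?E (?P S)"
      and "T \<subseteq> carrier (torus_group l) \<and> openin ?E (?P T)"
    moreover have "?P (S \<inter> T) = ?P S \<inter> ?P T" by blast
    ultimately show "S \<inter> T \<subseteq> carrier (torus_group l)" "openin ?E (?P (S \<inter> T))"
      by auto
  next
    fix K assume K: "\<forall>S\<in>K. S \<subseteq> carrier (torus_group l) \<and> openin ?E (?P S)"
    then show "\<Union>K \<subseteq> carrier (torus_group l)" by blast
    have "?P (\<Union>K) = \<Union> (?P ` K)" by blast
    with K show "openin ?E (?P (\<Union>K))" by auto
  qed
  then show ?thesis
    by (simp add: torus_top_def)
qed

text \<open>The charts are the inverses of the injective restrictions of the projection to open sets.\<close>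
definition torus_mfd :: "nat \<Rightarrow> (nat \<Rightarrow> real) set mfd" where
  "torus_mfd l =
     \<lparr>mfd_top = torus_top l,
      mfd_atlas = {\<lparr>chart_dim = l, chart_dom = torus_proj l ` V, chart_map = inv_into V (torus_proj l)\<rparr> | V.
        openin (Euclidean_space l) V \<and> inj_on (torus_proj l) V}\<rparr>"

definition Ck_torus_action ::
    "enat \<Rightarrow> nat \<Rightarrow> 'a mfd \<Rightarrow> ((nat \<Rightarrow> real) set \<Rightarrow> 'a \<Rightarrow> 'a) \<Rightarrow> bool" where
  "Ck_torus_action k l X \<Theta> \<longleftrightarrow>
     group_action (torus_group l) (points X) \<Theta> \<and>
     Ck_map k (prod_mfd (torus_mfd l) X) X (\<lambda>(h, x). \<Theta> h x)"

definition one_parameter_subgroup ::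
    "(real \<Rightarrow> 'a \<Rightarrow> 'a) \<Rightarrow> nat \<Rightarrow> ((nat \<Rightarrow> real) set \<Rightarrow> 'a \<Rightarrow> 'a) \<Rightarrow> bool" where
  "one_parameter_subgroup \<Phi> l \<Theta> \<longleftrightarrow>
     (\<exists>\<omega>\<in>topspace (Euclidean_space l). \<forall>t. \<Phi> t = \<Theta> (torus_proj l (\<lambda>i. \<omega> i * t)))"

end

theory Submission
  imports Defs "Jordan_Normal_Form.Schur_Decomposition"
begin

text \<open>
  If \<open>F\<close> is a linearizing embedding, its components along an orbit are bounded solutions of a linear
  differential equation, hence sums of exponentials \<open>e\<^bsup>i\<mu>t\<^esup>\<close> with finitely many real frequencies \<open>\<mu>\<close>, and
  \<open>F\<close> decomposes into eigencomponents. In terms of a basis \<open>\<omega>\<close> of the group generated by the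
  frequencies, the torus acts on the eigencomponents by characters. By Kronecker's theorem every torus
  element is a limit of flow times, so the compact image of \<open>F\<close> is invariant, and the action pulls back
  to \<open>X\<close>; it is \<open>C\<^sup>k\<close> because \<open>F\<close> is an immersion.

  Conversely, averaging against characters, one circle of the torus after the other, turns \<open>C\<^sup>k\<close>
  functions into joint eigenfunctions. They separate points and tangent vectors because a continuous
  function on the circle is determined by its Fourier coefficients, and by compactness finitely many
  of them do. Their real and imaginary parts are the components of an embedding on which the
  flow acts by rotations.
\<close>

section \<open>Calculus in the coordinate spaces\<close>

text \<open>Points of R^n are functions \<open>nat \<Rightarrow> real\<close>, a type without a
  norm, so the calculus rests on partial derivatives: the mean value theorem is applied one
  coordinate at a time, and Gaussian elimination over convergent functions or germs gives both the
  regularity of the torus action and local injectivity. The frequencies are rewritten in an integer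
  independent family because a flow line with such a direction is dense in the whole torus, so that
  no closed subgroup has to be identified. The eigencomponents are linear combinations of the
  components of \<open>F\<close> and inherit their regularity. In the converse, treating one circle
  at a time needs only one-dimensional integrals; weights already obtained survive because the
  circles commute. Separation of points and of tangent vectors are treated alike: each amounts to
  certain linear functionals on functions, and such a functional is zero once it vanishes on all
  eigenfunctions. Transition maps are only C^k, so the auxiliary functions are smooth in one chart
  and extended by zero.\<close>

definition Euc :: "nat \<Rightarrow> (nat \<Rightarrow> real) set" where
  "Euc n = {x. \<forall>i\<ge>n. x i = 0}"

lemma topspace_Euc [simp]: "topspace (Euclidean_space n) = Euc n"
  by (simp add: Euc_def topspace_Euclidean_space)

lemma Euclidean_space_top_of_set: "Euclidean_space n = top_of_set (Euc n)"
  by (simp add: Euc_def Euclidean_space_def euclidean_product_topology)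

lemma in_Euc: "x \<in> Euc n \<longleftrightarrow> (\<forall>i\<ge>n. x i = 0)"
  by (simp add: Euc_def)

lemma Euc_upd: "x \<in> Euc n \<Longrightarrow> i < n \<Longrightarrow> x(i := t) \<in> Euc n"
  by (auto simp: in_Euc)

lemma openin_Euc_subset: "openin (Euclidean_space n) U \<Longrightarrow> U \<subseteq> Euc n"
  using openin_subset by fastforce

section \<open>Limits and open sets in coordinates\<close>

lemma tendsto_coordinatewise:
  fixes f :: "'c \<Rightarrow> 'i \<Rightarrow> 'b::topological_space"
  assumes "\<And>i. ((\<lambda>s. f s i) \<longlongrightarrow> l i) F"
  shows "(f \<longlongrightarrow> l) F"
proof -
  have "limitin (product_topology (\<lambda>_. euclidean) UNIV) f l F"
    unfolding limitin_componentwise using assms by simp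
  then show ?thesis by (simp add: euclidean_product_topology)
qed

lemma tendsto_coordinate:
  fixes f :: "'c \<Rightarrow> 'i \<Rightarrow> 'b::topological_space"
  assumes "(f \<longlongrightarrow> l) F"
  shows "((\<lambda>s. f s i) \<longlongrightarrow> l i) F"
proof -
  have "limitin (product_topology (\<lambda>_. euclidean) UNIV) f l F"
    by (simp add: euclidean_product_topology assms)
  then show ?thesis unfolding limitin_componentwise by simp
qed

lemma openin_Euc_box:
  "openin (Euclidean_space n) {y \<in> Euc n. \<forall>i<n. \<bar>y i - x i\<bar> < e}"
proof -
  have "open (\<Inter>i<n. {y::nat\<Rightarrow>real. \<bar>y i - x i\<bar> < e})"
    by (intro open_INT ballI open_Collect_less continuous_intros continuous_on_product_coordinates) auto
  moreover have "{y \<in> Euc n. \<forall>i<n. \<bar>y i - x i\<bar> < e} = Euc n \<inter> (\<Inter>i<n. {y. \<bar>y i - x i\<bar> < e})"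
    by auto
  ultimately show ?thesis
    by (simp add: Euclidean_space_top_of_set openin_open_Int)
qed

text \<open>Membership in \<open>Euc n\<close> fixes all coordinates from \<open>n\<close> on, so of
  the radii supplied by the product topology only the first \<open>n\<close> count, and these have a
  positive minimum.\<close>

lemma openin_Euc_contains_box:
  assumes "openin (Euclidean_space n) U" "x \<in> U"
  obtains e where "e > 0" "{y \<in> Euc n. \<forall>i<n. \<bar>y i - x i\<bar> < e} \<subseteq> U"
proof -
  obtain T where T: "open T" "U = Euc n \<inter> T"
    using assms(1) by (auto simp: Euclidean_space_top_of_set openin_open)
  have "openin (product_topology (\<lambda>i. euclidean) UNIV) T" using T open_fun_def by auto
  from product_topology_open_contains_basis[OF this] assms(2) T(2)
  obtain X where X: "x \<in> Pi\<^sub>E UNIV X" "\<And>i. openin euclidean (X i)"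
      "Pi\<^sub>E UNIV X \<subseteq> T" by blast
  have "\<forall>i. \<exists>e>0. \<forall>t. \<bar>t - x i\<bar> < e \<longrightarrow> t \<in> X i"
    using X(1,2) by (metis PiE_iff UNIV_I dist_real_def open_dist open_openin)
  then obtain d where d: "\<And>i. d i > 0" "\<And>i t. \<bar>t - x i\<bar> < d i \<Longrightarrow> t \<in> X i" by metis
  \<comment> \<open>The extra 1 covers \<open>n = 0\<close>, where there is no radius to minimise
    over.\<close>
  define e where "e = Min (insert 1 (d ` {..<n}))"
  have "e > 0" using d(1) by (auto simp: e_def)
  moreover have le: "e \<le> d i" if "i < n" for i using that by (auto simp: e_def)
  have "{y \<in> Euc n. \<forall>i<n. \<bar>y i - x i\<bar> < e} \<subseteq> U"
  proof
    fix y assume y: "y \<in> {y \<in> Euc n. \<forall>i<n. \<bar>y i - x i\<bar> < e}"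
    have "x \<in> Euc n" using assms openin_Euc_subset by blast
    have "y i \<in> X i" for i
    proof (cases "i < n")
      case True then show ?thesis using y le[OF True] d(2)[of "y i" i] by auto
    next
      case False
      then have "y i = x i" using y \<open>x \<in> Euc n\<close> by (auto simp: in_Euc)
      then show ?thesis using X(1) by auto
    qed
    then show "y \<in> U" using T X(3) y by auto
  qed
  ultimately show ?thesis using that by blast
qed

lemma eventually_in_openin_Euc:
  assumes "openin (Euclidean_space n) U" "p \<in> U" "\<And>s. g s \<in> Euc n"
    and "\<And>i. i < n \<Longrightarrow> ((\<lambda>s. g s i) \<longlongrightarrow> p i) F"
  shows "\<forall>\<^sub>F s in F. g s \<in> U"
proof -
  obtain e where e: "e > 0" "{y \<in> Euc n. \<forall>i<n. \<bar>y i - p i\<bar> < e} \<subseteq> U"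
    using openin_Euc_contains_box assms(1,2) by blast
  have "\<forall>\<^sub>F s in F. \<forall>i\<in>{..<n}. \<bar>g s i - p i\<bar> < e"
    by (intro eventually_ball_finite) (use tendstoD[OF assms(4) e(1)] in \<open>auto simp: dist_real_def\<close>)
  then show ?thesis by eventually_elim (use e assms(3) in auto)
qed

lemma eventually_upd_in:
  assumes "openin (Euclidean_space n) U" "x \<in> U" "i < n"
  shows "\<forall>\<^sub>F t in nhds (x i). x(i := t) \<in> U"
proof (rule eventually_in_openin_Euc[OF assms(1,2)])
  show "\<And>s. x(i := s) \<in> Euc n" using assms openin_Euc_subset Euc_upd by blast
  show "((\<lambda>s. (x(i := s)) j) \<longlongrightarrow> x j) (nhds (x i))" for j
    by (cases "j = i") (auto simp: filterlim_ident)
qed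

section \<open>Functions of class C^k on open sets: locality and introduction rules\<close>

lemma Ck_fun_nat_0_iff:
  "openin (Euclidean_space n) U \<Longrightarrow> Ck_fun_nat 0 n U f \<longleftrightarrow> continuous_on U f"
  by (simp add: Euclidean_space_top_of_set subtopology_subtopology Int_absorb1
      openin_Euc_subset inf.absorb2 openin_imp_subset)

lemma Ck_fun_nat_imp_continuous:
  "openin (Euclidean_space n) U \<Longrightarrow> Ck_fun_nat r n U f \<Longrightarrow> continuous_on U f"
  by (metis Ck_fun_nat.simps Ck_fun_nat_0_iff not0_implies_Suc)

lemma partial_deriv_cong:
  assumes "openin (Euclidean_space n) U" "\<And>x. x \<in> U \<Longrightarrow> f x = g x" "x \<in> U" "i < n"
  shows "partial_deriv i f x = partial_deriv i g x"
  unfolding partial_deriv_def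
  by (rule deriv_cong_ev) (use eventually_upd_in[OF assms(1,3,4)] assms(2) in \<open>auto elim: eventually_mono\<close>)

lemma has_partial_cong:
  assumes "openin (Euclidean_space n) U" "\<And>x. x \<in> U \<Longrightarrow> f x = g x" "x \<in> U" "i < n"
  shows "((\<lambda>t. f (x(i := t))) has_real_derivative D) (at (x i)) \<longleftrightarrow>
         ((\<lambda>t. g (x(i := t))) has_real_derivative D) (at (x i))"
  by (rule DERIV_cong_ev) (use eventually_upd_in[OF assms(1,3,4)] assms(2) in \<open>auto elim: eventually_mono\<close>)

lemma Ck_fun_nat_Suc_D:
  assumes "openin (Euclidean_space n) U" "Ck_fun_nat (Suc r) n U f" "i < n"
  shows "x \<in> U \<Longrightarrow> ((\<lambda>t. f (x(i := t))) has_real_derivative partial_deriv i f x) (at (x i))"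
    and "Ck_fun_nat r n U (partial_deriv i f)"
  using assms by (auto simp: partial_deriv_def DERIV_deriv_iff_real_differentiable)

text \<open>Derivatives at points of an open set see only values inside it. This is why the
  arbitrary values of \<open>inv_into\<close> outside chart images do no harm.\<close>

lemma Ck_fun_nat_cong:
  assumes "openin (Euclidean_space n) U" "\<And>x. x \<in> U \<Longrightarrow> f x = g x" "Ck_fun_nat r n U f"
  shows "Ck_fun_nat r n U g"
  using assms(2,3)
proof (induction r arbitrary: f g)
  case 0 then show ?case using assms(1)
    by (metis Ck_fun_nat_0_iff continuous_on_cong)
next
  case (Suc r)
  have "continuous_on U g"
    using Ck_fun_nat_imp_continuous[OF assms(1) Suc.prems(2)] Suc.prems(1) continuous_on_cong by metis
  moreover have "(\<lambda>t. g (x(i := t))) differentiable at (x i)" if "x \<in> U" "i < n" for x i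
    using Ck_fun_nat_Suc_D(1)[OF assms(1) Suc.prems(2) that(2,1)] has_partial_cong[where f=f and g=g, OF assms(1) Suc.prems(1)] that
    unfolding real_differentiable_def by blast
  moreover have "Ck_fun_nat r n U (partial_deriv i g)" if "i < n" for i
    using Suc.IH[OF _ Ck_fun_nat_Suc_D(2)[OF assms(1) Suc.prems(2) that]]
      partial_deriv_cong[where f=f and g=g, OF assms(1) Suc.prems(1)] that by blast
  ultimately show ?case
    using Ck_fun_nat_0_iff[OF assms(1)] by simp
qed

text \<open>Lets inductions on the order work with derivatives given by explicit formulas
  \<open>g i\<close>; that these agree with \<open>partial_deriv\<close> on \<open>U\<close> is
  settled here once and for all.\<close>

lemma Ck_fun_nat_SucI:
  assumes U: "openin (Euclidean_space n) U" and "continuous_on U f"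
    and D: "\<And>i x. i < n \<Longrightarrow> x \<in> U \<Longrightarrow> ((\<lambda>t. f (x(i := t))) has_real_derivative g i x) (at (x i))"
    and g: "\<And>i. i < n \<Longrightarrow> Ck_fun_nat r n U (g i)"
  shows "Ck_fun_nat (Suc r) n U f"
proof -
  have "Ck_fun_nat r n U (partial_deriv i f)" if "i < n" for i
    by (rule Ck_fun_nat_cong[OF U _ g[OF that]])
      (metis D[OF that] DERIV_imp_deriv partial_deriv_def)
  then show ?thesis
    using assms(2) D Ck_fun_nat_0_iff[OF U] by (auto simp: real_differentiable_def)
qed

lemma Ck_fun_nat_subset:
  assumes "Ck_fun_nat r n U f" "V \<subseteq> U"
  shows "Ck_fun_nat r n V f"
  using assms(1)
proof (induction r arbitrary: f)
  case 0 then show ?case using assms(2)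
    by (metis Ck_fun_nat.simps(1) continuous_map_from_subtopology_mono)
next
  case (Suc r) then show ?case using assms(2)
    by simp (meson continuous_map_from_subtopology_mono subsetD)
qed

lemma Ck_fun_nat_SucD: "Ck_fun_nat (Suc r) n U f \<Longrightarrow> Ck_fun_nat r n U f"
  by (induction r arbitrary: f) auto

lemma Ck_fun_nat_mono: "Ck_fun_nat r n U f \<Longrightarrow> q \<le> r \<Longrightarrow> Ck_fun_nat q n U f"
  by (induction r) (auto simp: le_Suc_eq dest: Ck_fun_nat_SucD simp del: Ck_fun_nat.simps(2))

lemma Ck_fun_nat_local:
  assumes U: "openin (Euclidean_space n) U"
    and "\<And>x. x \<in> U \<Longrightarrow> \<exists>V. openin (Euclidean_space n) V \<and> x \<in> V \<and> Ck_fun_nat r n V f"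
  shows "Ck_fun_nat r n U f"
  using assms(2)
proof (induction r arbitrary: f)
  case 0
  have "continuous (at x within U) f" if x: "x \<in> U" for x
  proof -
    obtain V where V: "openin (Euclidean_space n) V" "x \<in> V" "continuous_on V f"
      using 0 x Ck_fun_nat_0_iff by blast
    obtain S T where S: "open S" "U = Euc n \<inter> S" and T: "open T" "V = Euc n \<inter> T"
      using V U by (auto simp: Euclidean_space_top_of_set openin_open)
    have "at x within U = at x within V"
      by (rule at_within_nhd[of _ "S \<inter> T"]) (use S T V x in auto)
    then show ?thesis using V by (metis continuous_on_eq_continuous_within)
  qed
  then show ?case using Ck_fun_nat_0_iff[OF U] by (simp add: continuous_on_eq_continuous_within)
next
  case (Suc r)
  have "continuous_on U f"
    using Suc.IH[of f] Suc.prems Ck_fun_nat_imp_continuous[OF U] Ck_fun_nat_SucD by metis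
  moreover have "(\<lambda>t. f (x(i := t))) differentiable at (x i)" if "x \<in> U" "i < n" for x i
    using Suc.prems[OF that(1)] that(2) by auto
  moreover have "Ck_fun_nat r n U (partial_deriv i f)" if "i < n" for i
    using Suc.IH[of "partial_deriv i f"] Suc.prems that by (metis Ck_fun_nat.simps(2))
  ultimately show ?case
    using Ck_fun_nat_0_iff[OF U] by simp
qed

subsection \<open>Closure properties\<close>

lemma Ck_fun_nat_const: "Ck_fun_nat r n U (\<lambda>_. c)"
proof (induction r arbitrary: c)
  case (Suc r)
  have "partial_deriv i (\<lambda>_. c) = (\<lambda>_. 0)" for i by (simp add: partial_deriv_def fun_eq_iff)
  then show ?case using Suc by simp
qed simp

lemma Ck_fun_nat_coordinate:
  assumes U: "openin (Euclidean_space n) U"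
  shows "Ck_fun_nat r n U (\<lambda>x. x j)"
proof (cases r)
  case 0 then show ?thesis using Ck_fun_nat_0_iff[OF U]
    by (metis continuous_on_product_coordinates continuous_on_subset subset_UNIV)
next
  case (Suc q)
  show ?thesis unfolding Suc
  proof (rule Ck_fun_nat_SucI[OF U])
    show "continuous_on U (\<lambda>x. x j)" by (metis continuous_on_product_coordinates continuous_on_subset subset_UNIV)
    show "((\<lambda>t. (x(i := t)) j) has_real_derivative (if i = j then 1 else 0)) (at (x i))" for i x
      by (cases "i = j") auto
  qed (rule Ck_fun_nat_const)
qed

lemma Ck_fun_nat_add:
  assumes U: "openin (Euclidean_space n) U" and "Ck_fun_nat r n U f" "Ck_fun_nat r n U g"
  shows "Ck_fun_nat r n U (\<lambda>x. f x + g x)"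
  using assms(2,3)
proof (induction r arbitrary: f g)
  case 0 then show ?case by (simp add: Ck_fun_nat_0_iff[OF U] continuous_on_add del: Ck_fun_nat.simps)
next
  case (Suc r)
  show ?case
  proof (rule Ck_fun_nat_SucI[OF U])
    show "continuous_on U (\<lambda>x. f x + g x)"
      using Suc.prems by (intro continuous_on_add Ck_fun_nat_imp_continuous[OF U]) 
    fix i assume i: "i < n"
    show "x \<in> U \<Longrightarrow> ((\<lambda>t. f (x(i := t)) + g (x(i := t))) has_real_derivative
        partial_deriv i f x + partial_deriv i g x) (at (x i))" for x
      using Suc.prems by (intro DERIV_add Ck_fun_nat_Suc_D(1)[OF U _ i])
    show "Ck_fun_nat r n U (\<lambda>x. partial_deriv i f x + partial_deriv i g x)"
      using Suc.prems i by (intro Suc.IH) auto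
  qed
qed

lemma Ck_fun_nat_mult:
  assumes U: "openin (Euclidean_space n) U" and "Ck_fun_nat r n U f" "Ck_fun_nat r n U g"
  shows "Ck_fun_nat r n U (\<lambda>x. f x * g x)"
  using assms(2,3)
proof (induction r arbitrary: f g)
  case 0 then show ?case by (simp add: Ck_fun_nat_0_iff[OF U] continuous_on_mult del: Ck_fun_nat.simps)
next
  case (Suc r)
  show ?case
  proof (rule Ck_fun_nat_SucI[OF U])
    show "continuous_on U (\<lambda>x. f x * g x)"
      using Suc.prems by (intro continuous_on_mult Ck_fun_nat_imp_continuous[OF U])
    fix i assume i: "i < n"
    show "x \<in> U \<Longrightarrow> ((\<lambda>t. f (x(i := t)) * g (x(i := t))) has_real_derivative
        partial_deriv i f x * g x + partial_deriv i g x * f x) (at (x i))" for x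
      using DERIV_mult[OF Ck_fun_nat_Suc_D(1)[OF U Suc.prems(1) i, of x] Ck_fun_nat_Suc_D(1)[OF U Suc.prems(2) i, of x]]
      by (simp del: fun_upd_apply)
    show "Ck_fun_nat r n U (\<lambda>x. partial_deriv i f x * g x + partial_deriv i g x * f x)"
      using Ck_fun_nat_Suc_D(2)[OF U _ i] Suc.prems Suc.prems[THEN Ck_fun_nat_SucD]
      by (intro Ck_fun_nat_add[OF U] Suc.IH)
  qed
qed

lemma Ck_fun_nat_sum:
  assumes U: "openin (Euclidean_space n) U" and "\<And>i. i \<in> I \<Longrightarrow> Ck_fun_nat r n U (f i)"
  shows "Ck_fun_nat r n U (\<lambda>x. \<Sum>i\<in>I. f i x)"
  using assms(2)
  by (induction I rule: infinite_finite_induct) (auto intro: Ck_fun_nat_const Ck_fun_nat_add[OF U])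

declare Ck_fun_nat.simps [simp del]

text \<open>A smooth function of one variable together with all its derivatives: \<open>D 0\<close>
  is the function and \<open>D i\<close> its \<open>i\<close>-th derivative. Closed forms for every
  \<open>i\<close> turn composition with such a function into a plain induction.\<close>

definition derivative_tower :: "real set \<Rightarrow> (nat \<Rightarrow> real \<Rightarrow> real) \<Rightarrow> bool" where
  "derivative_tower S D \<longleftrightarrow> (\<forall>i. \<forall>x\<in>S. (D i has_real_derivative D (Suc i) x) (at x))"

lemma Ck_fun_nat_compose_real:
  assumes U: "openin (Euclidean_space n) U" and D: "derivative_tower S D"
    and "Ck_fun_nat r n U f" "f ` U \<subseteq> S"
  shows "Ck_fun_nat r n U (\<lambda>x. D i (f x))"
proof -
  have cont: "continuous_on U (\<lambda>x. D i (f x))" if "continuous_on U f" for i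
  proof -
    have "continuous_on S (D i)"
      using D by (meson DERIV_isCont continuous_at_imp_continuous_on derivative_tower_def)
    then show ?thesis using that assms(4) continuous_on_compose2 by blast
  qed
  show ?thesis
    using assms(3)
  proof (induction r arbitrary: i)
    case 0 then show ?case using Ck_fun_nat_0_iff[OF U] cont by blast
  next
    case (Suc r)
    show ?case
    proof (rule Ck_fun_nat_SucI[OF U])
      show "continuous_on U (\<lambda>x. D i (f x))"
        using Suc.prems by (intro cont Ck_fun_nat_imp_continuous[OF U])
      fix j assume j: "j < n"
      show "((\<lambda>t. D i (f (x(j := t)))) has_real_derivative
          D (Suc i) (f x) * partial_deriv j f x) (at (x j))" if "x \<in> U" for x
      proof (rule DERIV_chain2[where f="D i" and g="\<lambda>t. f (x(j := t))"])
        show "(D i has_real_derivative D (Suc i) (f x)) (at (f (x(j := x j))))"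
          using D that assms(4) by (auto simp: derivative_tower_def)
      qed (rule Ck_fun_nat_Suc_D(1)[OF U Suc.prems j that])
      show "Ck_fun_nat r n U (\<lambda>x. D (Suc i) (f x) * partial_deriv j f x)"
        by (intro Ck_fun_nat_mult[OF U] Suc.IH Ck_fun_nat_Suc_D(2)[OF U _ j] Suc.prems
            Suc.prems[THEN Ck_fun_nat_SucD])
    qed
  qed
qed

lemma derivative_tower_inverse:
  "derivative_tower (- {0}) (\<lambda>i x. (- 1) ^ i * fact i * inverse x ^ Suc i)"
  unfolding derivative_tower_def
proof (intro allI ballI)
  fix i and x :: real assume "x \<in> - {0}"
  then have "x \<noteq> 0" by simp
  have "((\<lambda>x. (- 1) ^ i * fact i * inverse x ^ Suc i) has_real_derivative
      (- 1) ^ i * fact i * (of_nat (Suc i) * (- (inverse x * 1 * inverse x) * inverse x ^ i))) (at x)"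
    using DERIV_power[OF DERIV_inverse'[OF DERIV_ident \<open>x \<noteq> 0\<close>], of "Suc i"]
    by (intro DERIV_cmult) simp
  then show "((\<lambda>x. (- 1) ^ i * fact i * inverse x ^ Suc i) has_real_derivative
      (- 1) ^ Suc i * fact (Suc i) * inverse x ^ Suc (Suc i)) (at x)"
    by (rule DERIV_cong) (simp add: algebra_simps)
qed

lemma Ck_fun_nat_inverse:
  assumes U: "openin (Euclidean_space n) U" and "Ck_fun_nat r n U f" "\<And>x. x \<in> U \<Longrightarrow> f x \<noteq> 0"
  shows "Ck_fun_nat r n U (\<lambda>x. inverse (f x))"
proof -
  have "f ` U \<subseteq> - {0}" using assms(3) by auto
  from Ck_fun_nat_compose_real[OF U derivative_tower_inverse assms(2) this, of 0]
  show ?thesis by simp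
qed

text \<open>Each differentiation of the cosine is a shift by pi/2, which gives one formula for all
  orders. The sine is then obtained as a shifted cosine.\<close>

lemma derivative_tower_cos: "derivative_tower UNIV (\<lambda>i x. cos (x + real i * (pi / 2)))"
proof -
  have "((\<lambda>x. cos (x + real i * (pi / 2))) has_real_derivative cos (x + real (Suc i) * (pi / 2))) (at x)" for i x
  proof -
    have "cos (x + real (Suc i) * (pi / 2)) = - sin (x + real i * (pi / 2))"
      by (simp add: algebra_simps cos_add sin_add add_divide_distrib)
    then show ?thesis by (auto intro!: derivative_eq_intros)
  qed
  then show ?thesis by (simp add: derivative_tower_def)
qed

lemma Ck_fun_nat_cos:
  assumes U: "openin (Euclidean_space n) U" and "Ck_fun_nat r n U f"
  shows "Ck_fun_nat r n U (\<lambda>x. cos (f x))"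
  using Ck_fun_nat_compose_real[OF U derivative_tower_cos assms(2), of 0] by simp

lemma Ck_fun_nat_sin:
  assumes U: "openin (Euclidean_space n) U" and "Ck_fun_nat r n U f"
  shows "Ck_fun_nat r n U (\<lambda>x. sin (f x))"
proof -
  have "Ck_fun_nat r n U (\<lambda>x. cos (f x + - (pi / 2)))"
    by (intro Ck_fun_nat_cos Ck_fun_nat_add Ck_fun_nat_const assms)
  then show ?thesis by (simp add: cos_diff)
qed

subsection \<open>Mean value theorem and chain rule\<close>

text \<open>Walk from \<open>x\<close> to \<open>y\<close> by changing one coordinate at a time and
  apply the one-variable mean value theorem on each edge. Every edge has its own intermediate point
  \<open>\<xi> i\<close>; all of them stay in the coordinate box spanned by \<open>x\<close> and
  \<open>y\<close>.\<close>

lemma partial_mean_value: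
  fixes f :: "(nat \<Rightarrow> real) \<Rightarrow> real"
  assumes x: "x \<in> Euc n" and y: "y \<in> Euc n"
    and D: "\<And>i z. i < n \<Longrightarrow> z \<in> Euc n \<Longrightarrow> (\<And>j. z j \<in> closed_segment (x j) (y j)) \<Longrightarrow>
       ((\<lambda>t. f (z(i := t))) has_real_derivative g i z) (at (z i))"
  obtains \<xi> where "\<And>i. i < n \<Longrightarrow> \<xi> i \<in> Euc n"
    "\<And>i j. i < n \<Longrightarrow> \<xi> i j \<in> closed_segment (x j) (y j)"
    "f y - f x = (\<Sum>i<n. g i (\<xi> i) * (y i - x i))"
proof -
  \<comment> \<open>The corner reached after \<open>i\<close> coordinates have been changed.\<close>
  define z where "z i = (\<lambda>j. if j < i then y j else x j)" for i :: nat
  have z0: "z 0 = x" and zn: "z n = y"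
    using x y by (auto simp: z_def fun_eq_iff in_Euc not_less)
  have zs: "z (Suc i) = (z i)(i := y i)" and zi: "(z i)(i := x i) = z i" for i
    by (auto simp: z_def fun_eq_iff)
  have "\<exists>c. c \<in> Euc n \<and> (\<forall>j. c j \<in> closed_segment (x j) (y j)) \<and>
      f (z (Suc i)) - f (z i) = g i c * (y i - x i)" if i: "i < n" for i
  proof -
    have mem: "(z i)(i := t) \<in> Euc n \<and> (\<forall>j. ((z i)(i := t)) j \<in> closed_segment (x j) (y j))"
      if "t \<in> closed_segment (x i) (y i)" for t
      using that i x y by (auto simp: z_def in_Euc)
    have D': "((\<lambda>t. f ((z i)(i := t))) has_real_derivative g i ((z i)(i := t))) (at t)"
      if "t \<in> closed_segment (x i) (y i)" for t
      using D[of i "(z i)(i := t)"] mem[OF that] i by (simp del: fun_upd_apply add: fun_upd_same)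
    have "\<exists>t\<in>closed_segment (x i) (y i).
        f ((z i)(i := y i)) - f ((z i)(i := x i)) = g i ((z i)(i := t)) * (y i - x i)"
    proof (cases "x i" "y i" rule: linorder_cases)
      case less
      have *: "((\<lambda>t. f ((z i)(i := t))) has_real_derivative g i ((z i)(i := t))) (at t)"
        if "x i \<le> t" "t \<le> y i" for t
        using D'[of t] that less by (simp add: closed_segment_eq_real_ivl)
      obtain t where "x i < t" "t < y i"
        "f ((z i)(i := y i)) - f ((z i)(i := x i)) = (y i - x i) * g i ((z i)(i := t))"
        using MVT2[OF less *] by blast
      then show ?thesis
        by (intro bexI[of _ t]) (auto simp: closed_segment_eq_real_ivl mult.commute)
    next
      case greater
      have *: "((\<lambda>t. f ((z i)(i := t))) has_real_derivative g i ((z i)(i := t))) (at t)"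
        if "y i \<le> t" "t \<le> x i" for t
        using D'[of t] that greater by (simp add: closed_segment_eq_real_ivl)
      obtain t where "y i < t" "t < x i"
        "f ((z i)(i := x i)) - f ((z i)(i := y i)) = (x i - y i) * g i ((z i)(i := t))"
        using MVT2[OF greater *] by blast
      then show ?thesis
        by (intro bexI[of _ t]) (auto simp: closed_segment_eq_real_ivl algebra_simps)
    qed auto
    then obtain t where "t \<in> closed_segment (x i) (y i)"
      "f (z (Suc i)) - f (z i) = g i ((z i)(i := t)) * (y i - x i)"
      by (auto simp: zs zi)
    then show ?thesis using mem by blast
  qed
  then obtain c where c: "\<And>i. i < n \<Longrightarrow> c i \<in> Euc n"
    "\<And>i j. i < n \<Longrightarrow> c i j \<in> closed_segment (x j) (y j)"
    "\<And>i. i < n \<Longrightarrow> f (z (Suc i)) - f (z i) = g i (c i) * (y i - x i)"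
    by metis
  have "f y - f x = (\<Sum>i<n. f (z (Suc i)) - f (z i))"
    using sum_lessThan_telescope[of "\<lambda>i. f (z i)" n] by (simp add: z0 zn)
  also have "\<dots> = (\<Sum>i<n. g i (c i) * (y i - x i))"
    using c(3) by (intro sum.cong) auto
  finally show ?thesis using that[OF c(1,2)] by simp
qed

text \<open>Differences factor through functions \<open>Q i\<close> that converge to the partial
  derivatives. Both points may move along the filter, so this is strict differentiability: with one
  point fixed it yields the chain rule, with two moving points local injectivity.\<close>

lemma mean_value_germ:
  fixes a b :: "'s \<Rightarrow> nat \<Rightarrow> real"
  assumes U: "openin (Euclidean_space n) U" and f: "Ck_fun_nat (Suc 0) n U f" and p: "p \<in> U"
    and ab: "\<forall>\<^sub>F s in F. a s \<in> Euc n" "\<forall>\<^sub>F s in F. b s \<in> Euc n"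
    and a: "\<And>i. i < n \<Longrightarrow> ((\<lambda>s. a s i) \<longlongrightarrow> p i) F"
    and b: "\<And>i. i < n \<Longrightarrow> ((\<lambda>s. b s i) \<longlongrightarrow> p i) F"
  obtains Q where "\<And>i. i < n \<Longrightarrow> (Q i \<longlongrightarrow> partial_deriv i f p) F"
    "\<forall>\<^sub>F s in F. f (b s) - f (a s) = (\<Sum>i<n. Q i s * (b s i - a s i))"
proof -
  obtain e where e: "e > 0" "{y \<in> Euc n. \<forall>i<n. \<bar>y i - p i\<bar> < e} \<subseteq> U"
    using openin_Euc_contains_box U p by blast
  have pE: "p \<in> Euc n" using openin_Euc_subset U p by blast
  define E where "E s \<longleftrightarrow> a s \<in> Euc n \<and> b s \<in> Euc n \<and>
      (\<forall>i\<in>{..<n}. \<bar>a s i - p i\<bar> < e \<and> \<bar>b s i - p i\<bar> < e)" for s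
  have "\<forall>\<^sub>F s in F. \<forall>i\<in>{..<n}. \<bar>a s i - p i\<bar> < e \<and> \<bar>b s i - p i\<bar> < e"
    by (intro eventually_ball_finite eventually_conj ballI)
      (use tendstoD[OF a e(1)] tendstoD[OF b e(1)] in \<open>auto simp: dist_real_def\<close>)
  with ab have evE: "\<forall>\<^sub>F s in F. E s"
    unfolding E_def by eventually_elim auto
  have "\<exists>\<xi>. \<forall>i<n. \<xi> i \<in> U \<and> (E s \<longrightarrow> (\<forall>j. \<xi> i j \<in> closed_segment (a s j) (b s j)) \<and>
      f (b s) - f (a s) = (\<Sum>i<n. partial_deriv i f (\<xi> i) * (b s i - a s i)))" for s
  proof (cases "E s")
    case True
    have seg: "z \<in> U" if "z \<in> Euc n" "\<And>j. z j \<in> closed_segment (a s j) (b s j)" for z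
    proof -
      have "\<bar>z i - p i\<bar> < e" if "i < n" "z i \<in> closed_segment (a s i) (b s i)" for i
      proof -
        have "\<bar>a s i - p i\<bar> < e" "\<bar>b s i - p i\<bar> < e" using True \<open>i < n\<close> by (auto simp: E_def)
        then show ?thesis using that(2) by (auto simp: closed_segment_eq_real_ivl split: if_splits)
      qed
      then show ?thesis using e that by auto
    qed
    obtain \<xi> where \<xi>: "\<And>i. i < n \<Longrightarrow> \<xi> i \<in> Euc n"
      "\<And>i j. i < n \<Longrightarrow> \<xi> i j \<in> closed_segment (a s j) (b s j)"
      "f (b s) - f (a s) = (\<Sum>i<n. partial_deriv i f (\<xi> i) * (b s i - a s i))"
    proof (rule partial_mean_value[of "a s" n "b s" f "\<lambda>i. partial_deriv i f"])
      show "((\<lambda>t. f (z(i := t))) has_real_derivative partial_deriv i f z) (at (z i))"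
        if "i < n" "z \<in> Euc n" "\<And>j. z j \<in> closed_segment (a s j) (b s j)" for i z
        using Ck_fun_nat_Suc_D(1)[OF U f that(1) seg] that by blast
    qed (use True in \<open>auto simp: E_def\<close>)
    then show ?thesis using seg by blast
  next
    \<comment> \<open>Off the good event the default \<open>p\<close> keeps the intermediate points
      inside \<open>U\<close>, where the partial derivatives are continuous.\<close>
    case False then show ?thesis using p by (intro exI[of _ "\<lambda>_. p"]) auto
  qed
  then have "\<forall>s. \<exists>\<xi>. \<forall>i<n. \<xi> i \<in> U \<and> (E s \<longrightarrow> (\<forall>j. \<xi> i j \<in> closed_segment (a s j) (b s j)) \<and>
      f (b s) - f (a s) = (\<Sum>i<n. partial_deriv i f (\<xi> i) * (b s i - a s i)))" by blast
  from choice[OF this] obtain \<xi> where \<xi>0: "\<forall>s. \<forall>i<n. \<xi> s i \<in> U \<and>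
      (E s \<longrightarrow> (\<forall>j. \<xi> s i j \<in> closed_segment (a s j) (b s j)) \<and>
      f (b s) - f (a s) = (\<Sum>i<n. partial_deriv i f (\<xi> s i) * (b s i - a s i)))" by blast
  then have \<xi>U: "\<And>s i. i < n \<Longrightarrow> \<xi> s i \<in> U"
    and \<xi>: "\<And>s i j. i < n \<Longrightarrow> E s \<Longrightarrow> \<xi> s i j \<in> closed_segment (a s j) (b s j)"
    and eq: "\<And>s i. i < n \<Longrightarrow> E s \<Longrightarrow> f (b s) - f (a s) = (\<Sum>i<n. partial_deriv i f (\<xi> s i) * (b s i - a s i))"
    by blast+
  show ?thesis
  proof (rule that)
    fix i assume i: "i < n"
    have "((\<lambda>s. \<xi> s i) \<longlongrightarrow> p) F"
    proof (rule tendsto_coordinatewise)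
      fix j
      show "((\<lambda>s. \<xi> s i j) \<longlongrightarrow> p j) F"
      proof (cases "j < n")
        case True
        have "((\<lambda>s. \<bar>a s j - p j\<bar> + \<bar>b s j - p j\<bar>) \<longlongrightarrow> \<bar>p j - p j\<bar> + \<bar>p j - p j\<bar>) F"
          by (intro tendsto_intros a b True)
        then have "((\<lambda>s. \<bar>a s j - p j\<bar> + \<bar>b s j - p j\<bar>) \<longlongrightarrow> 0) F" by simp
        moreover have "\<forall>\<^sub>F s in F. norm (\<xi> s i j - p j) \<le> \<bar>a s j - p j\<bar> + \<bar>b s j - p j\<bar>"
          using evE
        proof eventually_elim
          case (elim s)
          show ?case using \<xi>[OF i elim, of j] by (auto simp: closed_segment_eq_real_ivl split: if_splits)
        qed
        ultimately have "((\<lambda>s. \<xi> s i j - p j) \<longlongrightarrow> 0) F"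
          by (rule Lim_null_comparison[rotated])
        then show ?thesis using Lim_null by blast
      next
        case False
        have "\<xi> s i j = p j" for s
          using False pE \<xi>U[OF i] openin_Euc_subset[OF U] by (metis in_Euc not_less subsetD)
        then show ?thesis by simp
      qed
    qed
    then show "((\<lambda>s. partial_deriv i f (\<xi> s i)) \<longlongrightarrow> partial_deriv i f p) F"
      by (rule continuous_on_tendsto_compose[OF
            Ck_fun_nat_imp_continuous[OF U Ck_fun_nat_Suc_D(2)[OF U f i]] _ p])
        (use \<xi>U i in auto)
  next
    show "\<forall>\<^sub>F s in F. f (b s) - f (a s) = (\<Sum>i<n. partial_deriv i f (\<xi> s i) * (b s i - a s i))"
      using evE
    proof eventually_elim
      case (elim s)
      show ?case
      proof (cases n)
        \<comment> \<open>Without coordinates the intermediate points come with no equation, but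
          then both points are zero.\<close>
        case 0
        then have "a s = b s" using elim by (auto simp: E_def in_Euc fun_eq_iff)
        then show ?thesis using 0 by simp
      qed (use eq[OF _ elim] in auto)
    qed
  qed
qed

lemma partial_chain_rule:
  assumes U: "openin (Euclidean_space n) U" and f: "Ck_fun_nat (Suc 0) n U f"
    and g: "\<forall>\<^sub>F t in at t0. g t \<in> Euc n" "g t0 \<in> U"
    and g': "\<And>i. i < n \<Longrightarrow> ((\<lambda>t. g t i) has_real_derivative g' i) (at t0)"
  shows "((\<lambda>t. f (g t)) has_real_derivative (\<Sum>i<n. partial_deriv i f (g t0) * g' i)) (at t0)"
proof -
  have lim: "((\<lambda>t. g t i) \<longlongrightarrow> g t0 i) (at t0)" if "i < n" for i
    using DERIV_isCont[OF g'[OF that]] by (simp add: isCont_def)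
  have gE: "g t0 \<in> Euc n" using g(2) U openin_Euc_subset by blast
  obtain Q where Q: "\<And>i. i < n \<Longrightarrow> (Q i \<longlongrightarrow> partial_deriv i f (g t0)) (at t0)"
    "\<forall>\<^sub>F s in at t0. f (g s) - f (g t0) = (\<Sum>i<n. Q i s * (g s i - g t0 i))"
    by (rule mean_value_germ[OF U f g(2) _ g(1), of "\<lambda>_. g t0"]) (use lim gE in auto)
  have "((\<lambda>s. \<Sum>i<n. Q i s * ((g s i - g t0 i) / (s - t0))) \<longlongrightarrow>
      (\<Sum>i<n. partial_deriv i f (g t0) * g' i)) (at t0)"
    using g' by (intro tendsto_sum tendsto_mult Q) (auto simp: has_field_derivative_iff)
  moreover have "\<forall>\<^sub>F s in at t0. (f (g s) - f (g t0)) / (s - t0) =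
      (\<Sum>i<n. Q i s * ((g s i - g t0 i) / (s - t0)))"
    using Q(2) by eventually_elim (simp add: sum_divide_distrib)
  ultimately show ?thesis
    unfolding has_field_derivative_iff using tendsto_cong by fastforce
qed

lemma continuous_on_Euc_valued:
  assumes "\<And>i. i < n \<Longrightarrow> continuous_on V (\<lambda>x. g x i)" "g ` V \<subseteq> Euc n"
  shows "continuous_on V g"
proof (rule continuous_on_coordinatewise_then_product)
  fix i show "continuous_on V (\<lambda>x. g x i)"
  proof (cases "i < n")
    case False
    then have "continuous_on V (\<lambda>x. g x i) \<longleftrightarrow> continuous_on V (\<lambda>x. 0::real)"
      using assms(2) by (intro continuous_on_cong) (auto simp: in_Euc)
    then show ?thesis by simp
  qed (rule assms(1))
qed

lemma eventually_at_upd_in: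
  assumes "openin (Euclidean_space n) U" "x \<in> U" "i < n"
  shows "\<forall>\<^sub>F t in at (x i). x(i := t) \<in> U"
  using eventually_upd_in[OF assms] by (simp add: eventually_at_filter eventually_mono)

lemma partial_compose:
  assumes V: "openin (Euclidean_space m) V" and U: "openin (Euclidean_space n) U"
    and f: "Ck_fun_nat (Suc 0) n U f" and g: "\<And>i. i < n \<Longrightarrow> Ck_fun_nat (Suc 0) m V (\<lambda>x. g x i)"
    and gV: "g ` V \<subseteq> U" and "x \<in> V" "j < m"
  shows "((\<lambda>t. f (g (x(j := t)))) has_real_derivative
     (\<Sum>i<n. partial_deriv i f (g x) * partial_deriv j (\<lambda>x. g x i) x)) (at (x j))"
proof -
  have "((\<lambda>t. f (g (x(j := t)))) has_real_derivative
     (\<Sum>i<n. partial_deriv i f (g (x(j := x j))) * partial_deriv j (\<lambda>x. g x i) x)) (at (x j))"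
  proof (rule partial_chain_rule[OF U f])
    show "\<forall>\<^sub>F t in at (x j). g (x(j := t)) \<in> Euc n"
      using eventually_at_upd_in[OF V assms(6,7)] by eventually_elim (use gV openin_Euc_subset[OF U] in auto)
    show "g (x(j := x j)) \<in> U" using gV assms by auto
    show "((\<lambda>t. g (x(j := t)) i) has_real_derivative partial_deriv j (\<lambda>x. g x i) x) (at (x j))"
      if "i < n" for i
      using Ck_fun_nat_Suc_D(1)[OF V g[OF that] assms(7,6)] .
  qed
  then show ?thesis by simp
qed

text \<open>Induction on the order with \<open>f\<close> generalised: the chain rule puts partial
  derivatives of \<open>f\<close> in the place of \<open>f\<close>, while \<open>g\<close> stays the
  same.\<close>

lemma Ck_fun_nat_compose:
  assumes V: "openin (Euclidean_space m) V" and U: "openin (Euclidean_space n) U"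
    and "Ck_fun_nat r n U f" "\<And>i. i < n \<Longrightarrow> Ck_fun_nat r m V (\<lambda>x. g x i)"
    and gV: "g ` V \<subseteq> U"
  shows "Ck_fun_nat r m V (\<lambda>x. f (g x))"
  using assms(3,4)
proof (induction r arbitrary: f)
  have cont: "continuous_on V (\<lambda>x. f (g x))"
    if "Ck_fun_nat q n U f" "\<And>i. i < n \<Longrightarrow> Ck_fun_nat q m V (\<lambda>x. g x i)" for f q
  proof -
    have "continuous_on V g"
      by (rule continuous_on_Euc_valued[of n])
        (use Ck_fun_nat_imp_continuous[OF V that(2)] gV openin_Euc_subset[OF U] in auto)
    then show ?thesis
      using Ck_fun_nat_imp_continuous[OF U that(1)] gV continuous_on_compose2 by blast
  qed
  case 0 then show ?case using cont[of 0 f] Ck_fun_nat_0_iff[OF V] by blast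
next
  case (Suc r)
  have g1: "Ck_fun_nat (Suc 0) m V (\<lambda>x. g x i)" if "i < n" for i
    using Ck_fun_nat_mono[OF Suc.prems(2)[OF that]] by simp
  have f1: "Ck_fun_nat (Suc 0) n U f"
    using Ck_fun_nat_mono[OF Suc.prems(1)] by simp
  have g0: "Ck_fun_nat r m V (\<lambda>x. g x i)" if "i < n" for i
    using Ck_fun_nat_SucD[OF Suc.prems(2)[OF that]] .
  show ?case
  proof (rule Ck_fun_nat_SucI[OF V])
    have "Ck_fun_nat r m V (\<lambda>x. f (g x))"
      by (rule Suc.IH[OF Ck_fun_nat_SucD[OF Suc.prems(1)] g0])
    then show "continuous_on V (\<lambda>x. f (g x))"
      by (rule Ck_fun_nat_imp_continuous[OF V])
    show "((\<lambda>t. f (g (x(j := t)))) has_real_derivative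
     (\<Sum>i<n. partial_deriv i f (g x) * partial_deriv j (\<lambda>x. g x i) x)) (at (x j))"
      if "j < m" "x \<in> V" for j x
      by (rule partial_compose[OF V U f1 g1 gV that(2,1)])
    fix j assume j: "j < m"
    show "Ck_fun_nat r m V (\<lambda>x. \<Sum>i<n. partial_deriv i f (g x) * partial_deriv j (\<lambda>x. g x i) x)"
    proof (intro Ck_fun_nat_sum[OF V] Ck_fun_nat_mult[OF V])
      fix i assume i: "i \<in> {..<n}"
      then show "Ck_fun_nat r m V (\<lambda>x. partial_deriv i f (g x))"
        using Suc.IH[OF Ck_fun_nat_Suc_D(2)[OF U Suc.prems(1), of i] g0] by blast
      show "Ck_fun_nat r m V (partial_deriv j (\<lambda>x. g x i))"
        using Ck_fun_nat_Suc_D(2)[OF V Suc.prems(2) j] i by blast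
    qed
  qed
qed

subsection \<open>Left inverses of matrices of functions\<close>

text \<open>
  Gaussian elimination over a ring \<open>P\<close> of functions in which every function with nonzero value under
  the evaluation \<open>v\<close> is invertible. It is used for functions with a limit and for germs of
  \<open>C\<^sup>k\<close> functions.
\<close>
lemma left_inverse_of_injective:
  fixes P :: "('b \<Rightarrow> real) \<Rightarrow> bool" and v :: "('b \<Rightarrow> real) \<Rightarrow> real" and n d :: nat
  assumes const: "\<And>c. P (\<lambda>_. c)" "\<And>c. v (\<lambda>_. c) = c"
    and add: "\<And>f g. P f \<Longrightarrow> P g \<Longrightarrow> P (\<lambda>x. f x + g x)"
             "\<And>f g. P f \<Longrightarrow> P g \<Longrightarrow> v (\<lambda>x. f x + g x) = v f + v g"
    and mult: "\<And>f g. P f \<Longrightarrow> P g \<Longrightarrow> P (\<lambda>x. f x * g x)"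
             "\<And>f g. P f \<Longrightarrow> P g \<Longrightarrow> v (\<lambda>x. f x * g x) = v f * v g"
    and inv: "\<And>f. P f \<Longrightarrow> v f \<noteq> 0 \<Longrightarrow> P (\<lambda>x. inverse (f x))"
             "\<And>f. P f \<Longrightarrow> v f \<noteq> 0 \<Longrightarrow> \<forall>\<^sub>F x in F. f x \<noteq> 0"
    and "\<And>a i. a < n \<Longrightarrow> i < d \<Longrightarrow> P (A a i)"
    and "\<And>w. (\<forall>a<n. (\<Sum>i<d. v (A a i) * w i) = 0) \<Longrightarrow> \<forall>i<d. w i = 0"
  shows "\<exists>L. (\<forall>i<d. \<forall>a<n. P (L i a)) \<and>
    (\<forall>\<^sub>F x in F. \<forall>z. \<forall>i<d. z i = (\<Sum>a<n. L i a x * (\<Sum>j<d. A a j x * z j)))"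
  using assms(9,10)
proof (induction d arbitrary: A)
  case 0 then show ?case by auto
next
  case (Suc d)
  have sum: "P (\<lambda>x. \<Sum>i\<in>I. f i x)" if "\<And>i. i \<in> I \<Longrightarrow> P (f i)" for f and I :: "nat set"
    using that by (induction I rule: infinite_finite_induct) (auto intro: const add)
  have neg: "P (\<lambda>x. f x - g x)" "v (\<lambda>x. f x - g x) = v f - v g" if "P f" "P g" for f g
  proof -
    have "P (\<lambda>x. - 1 * g x)" "v (\<lambda>x. - 1 * g x) = - v g"
      using mult[OF const(1)[of "- 1"] that(2)] const(2) by auto
    from add[OF that(1) this(1)] this(2) show "P (\<lambda>x. f x - g x)" "v (\<lambda>x. f x - g x) = v f - v g" by auto
  qed
  \<comment> \<open>The pivot. If the last column vanished under \<open>v\<close>, the last unit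
    vector would lie in the kernel.\<close>
  obtain a0 where a0: "a0 < n" "v (A a0 d) \<noteq> 0"
  proof (rule ccontr)
    assume "\<not> thesis"
    with that have "\<And>a. a < n \<Longrightarrow> v (A a d) = 0" by blast
    then have "\<forall>i<Suc d. (if i = d then 1 else 0 :: real) = 0"
      by (intro Suc.prems(2)) simp
    then show False by auto
  qed
  define R where "R x = inverse (A a0 d x)" for x
  have R: "P R" and PA0: "P (A a0 d)" using inv(1)[OF Suc.prems(1)] a0 Suc.prems(1)[of a0 d] unfolding R_def by auto
  \<comment> \<open>The row operation that clears column \<open>d\<close> with the pivot row
    \<open>a0\<close>.\<close>
  define A' where "A' a i = (\<lambda>x. A a i x - (A a d x * R x) * A a0 i x)" for a i
  have PA': "P (A' a i)" and vA': "v (A' a i) = v (A a i) - v (A a d) * v R * v (A a0 i)"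
    if "a < n" "i < d" for a i
  proof -
    have PP: "P (A a i)" "P (A a d)" "P (A a0 i)" using Suc.prems(1) that a0 by auto
    have m: "P (\<lambda>x. A a d x * R x)" "P (\<lambda>x. (A a d x * R x) * A a0 i x)" using mult(1) PP R by auto
    show "P (A' a i)" unfolding A'_def using neg(1)[OF PP(1) m(2)] .
    show "v (A' a i) = v (A a i) - v (A a d) * v R * v (A a0 i)"
      unfolding A'_def using neg(2)[OF PP(1) m(2)] mult(2)[OF m(1) PP(3)] mult(2)[OF PP(2) R] by simp
  qed
  have "\<exists>L. (\<forall>i<d. \<forall>a<n. P (L i a)) \<and>
    (\<forall>\<^sub>F x in F. \<forall>z. \<forall>i<d. z i = (\<Sum>a<n. L i a x * (\<Sum>j<d. A' a j x * z j)))"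
  proof (rule Suc.IH[OF PA'])
    fix w assume w: "\<forall>a<n. (\<Sum>i<d. v (A' a i) * w i) = 0"
    \<comment> \<open>The last entry is chosen so that the pivot row annihilates the extended
      vector.\<close>
    define w' where "w' = w(d := - v R * (\<Sum>i<d. v (A a0 i) * w i))"
    have "(\<Sum>i<Suc d. v (A a i) * w' i) = 0" if "a < n" for a
    proof -
      have "(\<Sum>i<Suc d. v (A a i) * w' i) =
          (\<Sum>i<d. v (A a i) * w i) - v (A a d) * v R * (\<Sum>i<d. v (A a0 i) * w i)"
        by (simp add: w'_def)
      also have "\<dots> = (\<Sum>i<d. v (A' a i) * w i)"
        using that by (simp add: vA' sum_distrib_left sum_subtractf left_diff_distrib mult.assoc)
      finally show ?thesis using w that by simp
    qed
    then have "\<forall>i<Suc d. w' i = 0" using Suc.prems(2) by blast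
    then show "\<forall>i<d. w i = 0" by (simp add: w'_def) (metis less_SucI less_irrefl)
  qed auto
  then obtain L where PL: "\<And>i a. i < d \<Longrightarrow> a < n \<Longrightarrow> P (L i a)"
    and L: "\<forall>\<^sub>F x in F. \<forall>z. \<forall>i<d. z i = (\<Sum>a<n. L i a x * (\<Sum>j<d. A' a j x * z j))" by blast
  \<comment> \<open>The reduced right-hand side is \<open>b a - A a d x * R x * b a0\<close>;
    collecting the multiples of \<open>b a0\<close> gives the correction at \<open>a = a0\<close>.
    The coordinate \<open>d\<close> is then read off the pivot row, which explains the second case
    of \<open>K\<close>.\<close>
  define M where "M i a = (\<lambda>x. L i a x - (if a = a0 then 1 else 0) * (\<Sum>c<n. L i c x * (A c d x * R x)))" for i a
  define K where "K i a = (if i < d then M i a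
      else (\<lambda>x. R x * ((if a = a0 then 1 else 0) - (\<Sum>i<d. A a0 i x * M i a x))))" for i a
  have PM: "P (M i a)" if "i < d" "a < n" for i a
    unfolding M_def using that a0 R by (intro neg mult const sum PL) (auto intro!: Suc.prems(1))
  have PK: "P (K i a)" if "i < Suc d" "a < n" for i a
  proof (cases "i < d")
    case True then show ?thesis using PM that by (simp add: K_def)
  next
    case False
    have "P (\<lambda>x. R x * ((if a = a0 then 1 else 0) - (\<Sum>i<d. A a0 i x * M i a x)))"
      using that a0 R by (intro neg mult const sum PM) (auto intro!: Suc.prems(1))
    then show ?thesis using False by (simp add: K_def)
  qed
  have "\<forall>\<^sub>F x in F. \<forall>z. \<forall>i<Suc d. z i = (\<Sum>a<n. K i a x * (\<Sum>j<Suc d. A a j x * z j))"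
    using L inv(2)[OF PA0 a0(2)]
  proof eventually_elim
    case (elim x)
    show ?case
    proof (intro allI impI)
      fix z :: "nat \<Rightarrow> real" and i assume i: "i < Suc d"
      define b where "b a = (\<Sum>j<Suc d. A a j x * z j)" for a
      have b': "(\<Sum>j<d. A' a j x * z j) = b a - A a d x * R x * b a0" for a
      proof -
        have "(\<Sum>j<d. A' a j x * z j) = (\<Sum>j<d. A a j x * z j) - A a d x * R x * (\<Sum>j<d. A a0 j x * z j)"
          by (simp add: A'_def left_diff_distrib sum_subtractf sum_distrib_left mult.assoc)
        also have "\<dots> = b a - A a d x * R x * b a0"
          using elim(2) by (simp add: b_def R_def field_simps)
        finally show ?thesis .
      qed
      have delta: "(\<Sum>a<n. (if a = a0 then 1 else 0) * c a) = c a0" for c :: "nat \<Rightarrow> real"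
        using a0(1) by (simp add: if_distrib[of "\<lambda>t. t * _"] sum.delta cong: if_cong)
      have zM: "z k = (\<Sum>a<n. M k a x * b a)" if "k < d" for k
      proof -
        have "z k = (\<Sum>a<n. L k a x * (\<Sum>j<d. A' a j x * z j))"
          using elim(1) that by blast
        also have "\<dots> = (\<Sum>a<n. L k a x * (b a - A a d x * R x * b a0))"
          by (simp only: b')
        also have "\<dots> = (\<Sum>a<n. L k a x * b a) - (\<Sum>c<n. L k c x * (A c d x * R x)) * b a0"
          by (simp add: right_diff_distrib sum_subtractf sum_distrib_right mult.assoc)
        also have "(\<Sum>c<n. L k c x * (A c d x * R x)) * b a0 =
            (\<Sum>a<n. (if a = a0 then 1 else 0) * ((\<Sum>c<n. L k c x * (A c d x * R x)) * b a))"
          by (simp add: delta)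
        also have "(\<Sum>a<n. L k a x * b a) - \<dots> = (\<Sum>a<n. M k a x * b a)"
          unfolding M_def by (simp only: sum_subtractf left_diff_distrib mult.assoc)
        finally show ?thesis .
      qed
      show "z i = (\<Sum>a<n. K i a x * (\<Sum>j<Suc d. A a j x * z j))"
      proof (cases "i < d")
        case True then show ?thesis using zM[OF True] by (simp only: K_def b_def if_True)
      next
        case False
        then have "i = d" using i by simp
        have "z d = R x * (b a0 - (\<Sum>i<d. A a0 i x * z i))"
          using elim(2) by (simp add: b_def R_def field_simps)
        also have "(\<Sum>i<d. A a0 i x * z i) = (\<Sum>i<d. A a0 i x * (\<Sum>a<n. M i a x * b a))"
          using zM by simp
        also have "\<dots> = (\<Sum>a<n. (\<Sum>i<d. A a0 i x * M i a x) * b a)"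
          by (simp add: sum_distrib_left sum_distrib_right mult.assoc) (rule sum.swap)
        also have "b a0 = (\<Sum>a<n. (if a = a0 then 1 else 0) * b a)" by (simp add: delta)
        also have "R x * ((\<Sum>a<n. (if a = a0 then 1 else 0) * b a) - (\<Sum>a<n. (\<Sum>i<d. A a0 i x * M i a x) * b a))
            = (\<Sum>a<n. K d a x * b a)"
          unfolding K_def by (simp only: less_irrefl if_False sum_subtractf[symmetric] left_diff_distrib[symmetric]
              sum_distrib_left mult.assoc)
        finally show ?thesis by (simp only: b_def \<open>i = d\<close>)
      qed
    qed
  qed
  then show ?case using PK by blast
qed

lemma left_inverse_limit:
  fixes A :: "nat \<Rightarrow> nat \<Rightarrow> 'b \<Rightarrow> real"
  assumes "F \<noteq> bot" "\<And>a i. a < n \<Longrightarrow> i < d \<Longrightarrow> (A a i \<longlongrightarrow> A0 a i) F"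
    and "\<And>w. (\<forall>a<n. (\<Sum>i<d. A0 a i * w i) = 0) \<Longrightarrow> \<forall>i<d. w i = 0"
  obtains L L0 where "\<And>i a. i < d \<Longrightarrow> a < n \<Longrightarrow> (L i a \<longlongrightarrow> L0 i a) F"
    "\<forall>\<^sub>F x in F. \<forall>z. \<forall>i<d. z i = (\<Sum>a<n. L i a x * (\<Sum>j<d. A a j x * z j))"
proof -
  let ?P = "\<lambda>f. \<exists>l::real. (f \<longlongrightarrow> l) F"
  have L: "Lim F f = l" if "(f \<longlongrightarrow> l) F" for f :: "'b \<Rightarrow> real" and l
    using that assms(1) tendsto_Lim by blast
  have "\<exists>L. (\<forall>i<d. \<forall>a<n. ?P (L i a)) \<and>
    (\<forall>\<^sub>F x in F. \<forall>z. \<forall>i<d. z i = (\<Sum>a<n. L i a x * (\<Sum>j<d. A a j x * z j)))"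
  proof (rule left_inverse_of_injective[where P = ?P and v = "Lim F"])
    show "\<exists>l. ((\<lambda>x. inverse (f x)) \<longlongrightarrow> l) F" if "?P f" "Lim F f \<noteq> 0" for f
      using that L tendsto_inverse by metis
    show "\<forall>\<^sub>F x in F. f x \<noteq> 0" if "?P f" "Lim F f \<noteq> 0" for f
      using that L tendsto_imp_eventually_ne by metis
    show "\<forall>i<d. w i = 0" if "\<forall>a<n. (\<Sum>i<d. Lim F (A a i) * w i) = 0" for w
    proof (rule assms(3), intro allI impI)
      fix a assume "a < n"
      then have "Lim F (A a i) = A0 a i" if "i < d" for i using assms(2) L that by blast
      then have "(\<Sum>i<d. A0 a i * w i) = (\<Sum>i<d. Lim F (A a i) * w i)"
        by (intro sum.cong) auto
      then show "(\<Sum>i<d. A0 a i * w i) = 0" using \<open>a < n\<close> that by simp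
    qed
    show "?P (\<lambda>x. f x + g x)" "Lim F (\<lambda>x. f x + g x) = Lim F f + Lim F g"
      "?P (\<lambda>x. f x * g x)" "Lim F (\<lambda>x. f x * g x) = Lim F f * Lim F g" if "?P f" "?P g" for f g
      using that L tendsto_add tendsto_mult by metis+
  qed (use assms(2) L in \<open>auto intro: tendsto_const\<close>)
  then obtain L where "\<forall>i<d. \<forall>a<n. ?P (L i a)"
    "\<forall>\<^sub>F x in F. \<forall>z. \<forall>i<d. z i = (\<Sum>a<n. L i a x * (\<Sum>j<d. A a j x * z j))" by blast
  then show ?thesis using that[of L "\<lambda>i a. Lim F (L i a)"] L by blast
qed

text \<open>As a subset of \<open>nat \<Rightarrow> real\<close> the space \<open>Euc n\<close> is
  not open, so germs at \<open>x\<close> are taken along \<open>nhds x\<close> restricted to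
  \<open>V\<close>.\<close>

lemma eventually_within_open_Euc:
  assumes V: "openin (Euclidean_space n) V" and x: "x \<in> V"
  shows "eventually Q (inf (nhds x) (principal V)) \<longleftrightarrow>
    (\<exists>W. openin (Euclidean_space n) W \<and> x \<in> W \<and> W \<subseteq> V \<and> (\<forall>y\<in>W. Q y))"
proof
  assume "eventually Q (inf (nhds x) (principal V))"
  then obtain S where "open S" "x \<in> S" "\<And>y. y \<in> S \<Longrightarrow> y \<in> V \<Longrightarrow> Q y"
    by (auto simp: eventually_inf_principal eventually_nhds)
  moreover then have "openin (Euclidean_space n) (V \<inter> S)"
    using V by (metis Euclidean_space_top_of_set openin_Int_open)
  ultimately show "\<exists>W. openin (Euclidean_space n) W \<and> x \<in> W \<and> W \<subseteq> V \<and> (\<forall>y\<in>W. Q y)"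
    using x by (intro exI[of _ "V \<inter> S"]) auto
next
  assume "\<exists>W. openin (Euclidean_space n) W \<and> x \<in> W \<and> W \<subseteq> V \<and> (\<forall>y\<in>W. Q y)"
  then obtain W where W: "openin (Euclidean_space n) W" "x \<in> W" "W \<subseteq> V" "\<And>y. y \<in> W \<Longrightarrow> Q y" by blast
  obtain S where "open S" "W = Euc n \<inter> S"
    using W(1) by (auto simp: Euclidean_space_top_of_set openin_open)
  moreover have "V \<subseteq> Euc n" using V openin_Euc_subset by blast
  ultimately have "open S" "x \<in> S" "\<forall>y\<in>S. y \<in> V \<longrightarrow> Q y"
    using W by auto
  then show "eventually Q (inf (nhds x) (principal V))"
    unfolding eventually_inf_principal eventually_nhds by blast
qed

lemma left_inverse_Ck:
  fixes A :: "nat \<Rightarrow> nat \<Rightarrow> (nat \<Rightarrow> real) \<Rightarrow> real"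
  assumes V: "openin (Euclidean_space m) V" and x: "x \<in> V"
    and A: "\<And>a i. a < n \<Longrightarrow> i < d \<Longrightarrow> Ck_fun_nat q m V (A a i)"
    and inj: "\<And>w. (\<forall>a<n. (\<Sum>i<d. A a i x * w i) = 0) \<Longrightarrow> \<forall>i<d. w i = 0"
  obtains L W where "openin (Euclidean_space m) W" "x \<in> W" "W \<subseteq> V"
    "\<And>i a. i < d \<Longrightarrow> a < n \<Longrightarrow> Ck_fun_nat q m W (L i a)"
    "\<And>y z i. y \<in> W \<Longrightarrow> i < d \<Longrightarrow> z i = (\<Sum>a<n. L i a y * (\<Sum>j<d. A a j y * z j))"
proof -
  let ?F = "inf (nhds x) (principal V)"
  let ?P = "\<lambda>f. \<exists>W. openin (Euclidean_space m) W \<and> x \<in> W \<and> W \<subseteq> V \<and> Ck_fun_nat q m W f"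
  \<comment> \<open>A function that is nonzero at \<open>x\<close> is invertible on a smaller
    neighbourhood; this is the invertibility that the elimination requires of germs.\<close>
  have nz: "\<exists>W. openin (Euclidean_space m) W \<and> x \<in> W \<and> W \<subseteq> V \<and> Ck_fun_nat q m W f \<and> (\<forall>y\<in>W. f y \<noteq> 0)"
    if Pf: "?P f" and fx: "f x \<noteq> 0" for f
  proof -
    obtain W where W: "openin (Euclidean_space m) W" "x \<in> W" "W \<subseteq> V" "Ck_fun_nat q m W f"
      using Pf by blast
    let ?W = "{y \<in> W. f y \<noteq> 0}"
    have "continuous_on W f" using Ck_fun_nat_imp_continuous W by blast
    then have "openin (top_of_set W) ?W"
      using continuous_openin_preimage_gen[of W f "- {0}"] by (simp add: vimage_def Int_def open_Compl)
    then have "openin (Euclidean_space m) ?W"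
      using W(1) unfolding Euclidean_space_top_of_set by (rule openin_trans)
    moreover have "Ck_fun_nat q m ?W f" by (rule Ck_fun_nat_subset[OF W(4)]) auto
    ultimately show ?thesis using W fx by (intro exI[of _ ?W]) auto
  qed
  have "\<exists>L. (\<forall>i<d. \<forall>a<n. ?P (L i a)) \<and>
    (\<forall>\<^sub>F x in ?F. \<forall>z. \<forall>i<d. z i = (\<Sum>a<n. L i a x * (\<Sum>j<d. A a j x * z j)))"
  proof (rule left_inverse_of_injective[where P = ?P and v = "\<lambda>f. f x"])
    fix f g assume "?P f" "?P g"
    then obtain W W' where W: "openin (Euclidean_space m) W" "x \<in> W" "W \<subseteq> V" "Ck_fun_nat q m W f"
      "openin (Euclidean_space m) W'" "x \<in> W'" "W' \<subseteq> V" "Ck_fun_nat q m W' g"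
      by (elim exE conjE)
    then have WW: "openin (Euclidean_space m) (W \<inter> W')" "x \<in> W \<inter> W'" "W \<inter> W' \<subseteq> V" by auto
    have fg: "Ck_fun_nat q m (W \<inter> W') f" "Ck_fun_nat q m (W \<inter> W') g"
      using Ck_fun_nat_subset[OF W(4)] Ck_fun_nat_subset[OF W(8)] by auto
    show "?P (\<lambda>x. f x + g x)" "?P (\<lambda>x. f x * g x)"
      by (intro exI[of _ "W \<inter> W'"] conjI WW Ck_fun_nat_add[OF WW(1) fg] Ck_fun_nat_mult[OF WW(1) fg])+
  next
    fix f assume "?P f" "f x \<noteq> 0"
    from nz[OF this] obtain W where W: "openin (Euclidean_space m) W" "x \<in> W" "W \<subseteq> V"
      "Ck_fun_nat q m W f" "\<forall>y\<in>W. f y \<noteq> 0" by (elim exE conjE)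
    then show "\<forall>\<^sub>F x in ?F. f x \<noteq> 0"
      unfolding eventually_within_open_Euc[OF V x] by blast
    show "?P (\<lambda>x. inverse (f x))"
      by (intro exI[of _ W] conjI W Ck_fun_nat_inverse) (use W in auto)
  next
    show "?P (\<lambda>_. c)" for c
      by (intro exI[of _ V] conjI V x order_refl Ck_fun_nat_const)
    show "?P (A a i)" if "a < n" "i < d" for a i
      by (intro exI[of _ V] conjI V x order_refl A that)
    show "\<forall>i<d. w i = 0" if "\<forall>a<n. (\<Sum>i<d. A a i x * w i) = 0" for w
      by (rule inj[OF that])
  qed auto
  then obtain L where L: "\<forall>i<d. \<forall>a<n. ?P (L i a)"
    and ev: "\<forall>\<^sub>F x in ?F. \<forall>z. \<forall>i<d. z i = (\<Sum>a<n. L i a x * (\<Sum>j<d. A a j x * z j))" by blast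
  obtain W0 where W0: "openin (Euclidean_space m) W0" "x \<in> W0" "W0 \<subseteq> V"
    "\<And>y z i. y \<in> W0 \<Longrightarrow> i < d \<Longrightarrow> z i = (\<Sum>a<n. L i a y * (\<Sum>j<d. A a j y * z j))"
    using ev unfolding eventually_within_open_Euc[OF V x] by blast
  \<comment> \<open>Each entry of \<open>L\<close> comes with its own neighbourhood; the finitely
    many of them are intersected.\<close>
  have "\<forall>i a. \<exists>W. openin (Euclidean_space m) W \<and> x \<in> W \<and> (i < d \<longrightarrow> a < n \<longrightarrow> Ck_fun_nat q m W (L i a))"
    using L V x by blast
  then obtain W where W: "\<And>i a. openin (Euclidean_space m) (W i a)" "\<And>i a. x \<in> W i a"
    "\<And>i a. i < d \<Longrightarrow> a < n \<Longrightarrow> Ck_fun_nat q m (W i a) (L i a)" by metis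
  define W1 where "W1 = W0 \<inter> (\<Inter>(i, a)\<in>{..<d} \<times> {..<n}. W i a)"
  have "openin (Euclidean_space m) W1"
  proof (cases "{..<d} \<times> {..<n} = {}")
    case False
    then show ?thesis unfolding W1_def using W(1) W0(1)
      by (intro openin_Int openin_INT2) auto
  qed (use W0(1) in \<open>simp only: W1_def INT_empty Int_UNIV_right\<close>)
  moreover have "Ck_fun_nat q m W1 (L i a)" if "i < d" "a < n" for i a
    by (rule Ck_fun_nat_subset[OF W(3)[OF that]]) (use that in \<open>auto simp: W1_def\<close>)
  moreover have "x \<in> W1" "W1 \<subseteq> W0" using W(2) W0(2) by (auto simp: W1_def)
  ultimately show ?thesis using that[of W1 L] W0(3,4) by blast
qed

subsection \<open>Regularity of continuous solutions of immersive equations\<close>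

text \<open>
  The hypothesis that \<open>y\<close> is continuous replaces the inverse function theorem:
  the difference quotients of \<open>y\<close> solve linear systems whose matrices converge to the injective
  matrix of partial derivatives of \<open>H\<close>.
\<close>
lemma partial_of_implicit:
  fixes y :: "(nat \<Rightarrow> real) \<Rightarrow> nat \<Rightarrow> real" and H :: "nat \<Rightarrow> (nat \<Rightarrow> real) \<Rightarrow> real"
  assumes V: "openin (Euclidean_space m) V" and U: "openin (Euclidean_space d) U"
    and y: "\<And>i. i < d \<Longrightarrow> continuous_on V (\<lambda>x. y x i)" and yV: "y ` V \<subseteq> U"
    and H: "\<And>a. a < N \<Longrightarrow> Ck_fun_nat (Suc 0) d U (H a)"
    and G: "\<And>a. a < N \<Longrightarrow> Ck_fun_nat (Suc 0) m V (G a)"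
    and eq: "\<And>a x. a < N \<Longrightarrow> x \<in> V \<Longrightarrow> H a (y x) = G a x"
    and x: "x \<in> V" and j: "j < m"
    and inj: "\<And>w. (\<forall>a<N. (\<Sum>i<d. partial_deriv i (H a) (y x) * w i) = 0) \<Longrightarrow> \<forall>i<d. w i = 0"
  shows "i < d \<Longrightarrow> ((\<lambda>t. y (x(j := t)) i) has_real_derivative partial_deriv j (\<lambda>x. y x i) x) (at (x j))"
    and "a < N \<Longrightarrow> (\<Sum>i<d. partial_deriv i (H a) (y x) * partial_deriv j (\<lambda>x. y x i) x) = partial_deriv j (G a) x"
proof -
  let ?F = "at (x j)"
  let ?X = "\<lambda>s. x(j := s)"
  have evV: "\<forall>\<^sub>F s in ?F. ?X s \<in> V"
    by (rule eventually_at_upd_in[OF V x j])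
  have evE: "\<forall>\<^sub>F s in ?F. y (?X s) \<in> Euc d"
    using evV by eventually_elim (use yV U openin_Euc_subset in blast)
  have X: "(?X \<longlongrightarrow> x) ?F"
  proof (rule tendsto_coordinatewise)
    show "((\<lambda>s. (x(j := s)) i) \<longlongrightarrow> x i) ?F" for i by (cases "i = j") auto
  qed
  have lim: "((\<lambda>s. y (?X s) i) \<longlongrightarrow> y x i) ?F" if "i < d" for i
    by (rule continuous_on_tendsto_compose[OF y[OF that] X x evV])
  \<comment> \<open>Continuity of \<open>y\<close> is all that enters here: the increments of
    \<open>H a\<close> are linear in those of \<open>y\<close>, with coefficients tending to the
    partial derivatives.\<close>
  have "\<exists>Q. (\<forall>i<d. (Q i \<longlongrightarrow> partial_deriv i (H a) (y x)) ?F) \<and>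
      (\<forall>\<^sub>F s in ?F. H a (y (?X s)) - H a (y x) = (\<Sum>i<d. Q i s * (y (?X s) i - y x i)))" if a: "a < N" for a
  proof -
    have yU: "y x \<in> U" and yE: "y x \<in> Euc d" using x yV U openin_Euc_subset by blast+
    obtain Q where "\<And>i. i < d \<Longrightarrow> (Q i \<longlongrightarrow> partial_deriv i (H a) (y x)) ?F"
      "\<forall>\<^sub>F s in ?F. H a (y (?X s)) - H a (y x) = (\<Sum>i<d. Q i s * (y (?X s) i - y x i))"
      by (rule mean_value_germ[OF U H[OF a] yU _ evE, of "\<lambda>_. y x"]) (use yE lim in auto)
    then show ?thesis by blast
  qed
  then have "\<forall>a\<in>{..<N}. \<exists>Q. (\<forall>i<d. (Q i \<longlongrightarrow> partial_deriv i (H a) (y x)) ?F) \<and>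
      (\<forall>\<^sub>F s in ?F. H a (y (?X s)) - H a (y x) = (\<Sum>i<d. Q i s * (y (?X s) i - y x i)))" by simp
  from bchoice[OF this] obtain Q where
    QQ: "\<forall>a\<in>{..<N}. (\<forall>i<d. (Q a i \<longlongrightarrow> partial_deriv i (H a) (y x)) ?F) \<and>
      (\<forall>\<^sub>F s in ?F. H a (y (?X s)) - H a (y x) = (\<Sum>i<d. Q a i s * (y (?X s) i - y x i)))" by blast
  then have Q: "\<And>a i. a < N \<Longrightarrow> i < d \<Longrightarrow> (Q a i \<longlongrightarrow> partial_deriv i (H a) (y x)) ?F"
    and Qeq: "\<And>a. a < N \<Longrightarrow>
      \<forall>\<^sub>F s in ?F. H a (y (?X s)) - H a (y x) = (\<Sum>i<d. Q a i s * (y (?X s) i - y x i))"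
    by auto
  \<comment> \<open>Matrices that converge to an injective one have convergent left inverses; these
    solve for the increments of \<open>y\<close>.\<close>
  obtain L L0 where L: "\<And>i a. i < d \<Longrightarrow> a < N \<Longrightarrow> (L i a \<longlongrightarrow> L0 i a) ?F"
    and Lev: "\<forall>\<^sub>F s in ?F. \<forall>z. \<forall>i<d. z i = (\<Sum>a<N. L i a s * (\<Sum>j<d. Q a j s * z j))"
    by (rule left_inverse_limit[OF trivial_limit_at Q inj]) (assumption | blast)+
  have "\<forall>\<^sub>F s in ?F. \<forall>a\<in>{..<N}. H a (y (?X s)) - H a (y x) = (\<Sum>i<d. Q a i s * (y (?X s) i - y x i))"
    using Qeq by (intro eventually_ball_finite) auto
  with Lev evV have ev: "\<forall>\<^sub>F s in ?F. \<forall>i<d. (y (?X s) i - y x i) / (s - x j) =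
      (\<Sum>a<N. L i a s * ((G a (?X s) - G a x) / (s - x j)))"
  proof eventually_elim
    case (elim s)
    show ?case
    proof (intro allI impI)
      fix i assume i: "i < d"
      have "y (?X s) i - y x i = (\<Sum>a<N. L i a s * (\<Sum>j<d. Q a j s * (y (?X s) j - y x j)))"
        using elim(1)[rule_format, of i "\<lambda>i. y (?X s) i - y x i"] i by blast
      also have "\<dots> = (\<Sum>a<N. L i a s * (G a (?X s) - G a x))"
      proof (rule sum.cong)
        fix a assume a: "a \<in> {..<N}"
        then have "(\<Sum>j<d. Q a j s * (y (?X s) j - y x j)) = H a (y (?X s)) - H a (y x)"
          using elim(3) by simp
        also have "\<dots> = G a (?X s) - G a x" using eq a x elim(2) by simp
        finally show "L i a s * (\<Sum>j<d. Q a j s * (y (?X s) j - y x j)) = L i a s * (G a (?X s) - G a x)"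
          by simp
      qed simp
      finally show "(y (?X s) i - y x i) / (s - x j) =
          (\<Sum>a<N. L i a s * ((G a (?X s) - G a x) / (s - x j)))"
        by (simp add: sum_divide_distrib)
    qed
  qed
  have D: "((\<lambda>t. y (x(j := t)) i) has_real_derivative partial_deriv j (\<lambda>x. y x i) x) ?F" if i: "i < d" for i
  proof -
    have "((\<lambda>s. \<Sum>a<N. L i a s * ((G a (?X s) - G a x) / (s - x j))) \<longlongrightarrow>
        (\<Sum>a<N. L0 i a * partial_deriv j (G a) x)) ?F"
      using Ck_fun_nat_Suc_D(1)[OF V G j x] i
      by (intro tendsto_sum tendsto_mult L) (auto simp: has_field_derivative_iff simp del: fun_upd_apply)
    moreover have "\<forall>\<^sub>F s in ?F. (y (?X s) i - y x i) / (s - x j) =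
        (\<Sum>a<N. L i a s * ((G a (?X s) - G a x) / (s - x j)))"
      using ev by eventually_elim (use i in blast)
    ultimately have "((\<lambda>s. (y (?X s) i - y x i) / (s - x j)) \<longlongrightarrow>
        (\<Sum>a<N. L0 i a * partial_deriv j (G a) x)) ?F"
      using tendsto_cong by fast
    then have "((\<lambda>t. y (x(j := t)) i) has_real_derivative (\<Sum>a<N. L0 i a * partial_deriv j (G a) x)) ?F"
      by (simp add: has_field_derivative_iff del: fun_upd_apply)
    moreover from this have "partial_deriv j (\<lambda>x. y x i) x = (\<Sum>a<N. L0 i a * partial_deriv j (G a) x)"
      unfolding partial_deriv_def by (rule DERIV_imp_deriv)
    ultimately show ?thesis by (simp only:)
  qed
  then show "i < d \<Longrightarrow> ((\<lambda>t. y (x(j := t)) i) has_real_derivative partial_deriv j (\<lambda>x. y x i) x) ?F" .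
  \<comment> \<open>Now that \<open>y\<close> is known to have partial derivatives, the chain rule
    applies to the equation \<open>H a (y x) = G a x\<close>.\<close>
  show "(\<Sum>i<d. partial_deriv i (H a) (y x) * partial_deriv j (\<lambda>x. y x i) x) = partial_deriv j (G a) x"
    if a: "a < N"
  proof (rule DERIV_unique)
    have "((\<lambda>t. H a (y (x(j := t)))) has_real_derivative
      (\<Sum>i<d. partial_deriv i (H a) (y (x(j := x j))) * partial_deriv j (\<lambda>x. y x i) x)) ?F"
      by (rule partial_chain_rule[OF U H[OF a] evE _ D]) (use x yV in auto)
    then show "((\<lambda>t. H a (y (x(j := t)))) has_real_derivative
      (\<Sum>i<d. partial_deriv i (H a) (y x) * partial_deriv j (\<lambda>x. y x i) x)) ?F" by simp
    have "\<forall>\<^sub>F t in nhds (x j). H a (y (x(j := t))) = G a (x(j := t))"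
      using eventually_upd_in[OF V x j] by eventually_elim (use eq a in blast)
    from iffD2[OF DERIV_cong_ev[OF refl this refl] Ck_fun_nat_Suc_D(1)[OF V G[OF a] j x]]
    show "((\<lambda>t. H a (y (x(j := t)))) has_real_derivative partial_deriv j (G a) x) ?F" .
  qed
qed

text \<open>Bootstrapping: the partial derivatives of \<open>y\<close> are \<open>L\<close> applied
  to those of \<open>G\<close>, where \<open>L\<close> inverts the matrix of partial derivatives of
  \<open>H\<close> along \<open>y\<close>. If \<open>y\<close> is of class C^q, then so is
  \<open>L\<close>, hence \<open>y\<close> is of class C^(q+1), as long as the data have that
  order.\<close>

lemma Ck_fun_nat_implicit:
  fixes y :: "(nat \<Rightarrow> real) \<Rightarrow> nat \<Rightarrow> real" and H :: "nat \<Rightarrow> (nat \<Rightarrow> real) \<Rightarrow> real"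
  assumes V: "openin (Euclidean_space m) V" and U: "openin (Euclidean_space d) U"
    and y: "\<And>i. i < d \<Longrightarrow> continuous_on V (\<lambda>x. y x i)" and yV: "y ` V \<subseteq> U"
    and r: "1 \<le> r"
    and H: "\<And>a. a < N \<Longrightarrow> Ck_fun_nat r d U (H a)"
    and G: "\<And>a. a < N \<Longrightarrow> Ck_fun_nat r m V (G a)"
    and eq: "\<And>a x. a < N \<Longrightarrow> x \<in> V \<Longrightarrow> H a (y x) = G a x"
    and inj: "\<And>x w. x \<in> V \<Longrightarrow> (\<forall>a<N. (\<Sum>i<d. partial_deriv i (H a) (y x) * w i) = 0) \<Longrightarrow> \<forall>i<d. w i = 0"
    and "i < d"
  shows "Ck_fun_nat r m V (\<lambda>x. y x i)"
proof -
  have H1: "Ck_fun_nat (Suc 0) d U (H a)" and G1: "Ck_fun_nat (Suc 0) m V (G a)" if "a < N" for a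
    using Ck_fun_nat_mono[OF H[OF that]] Ck_fun_nat_mono[OF G[OF that]] r by auto
  have part: "i < d \<Longrightarrow> ((\<lambda>t. y (x(j := t)) i) has_real_derivative partial_deriv j (\<lambda>x. y x i) x) (at (x j))"
    "a < N \<Longrightarrow> (\<Sum>i<d. partial_deriv i (H a) (y x) * partial_deriv j (\<lambda>x. y x i) x) = partial_deriv j (G a) x"
    if x: "x \<in> V" and j: "j < m" for x j i a
    by (rule partial_of_implicit[where H = H and G = G and N = N, OF V U y yV H1 G1 eq x j inj[OF x]];
        assumption)+
  have "q \<le> r \<Longrightarrow> \<forall>i<d. Ck_fun_nat q m V (\<lambda>x. y x i)" for q
  proof (induction q)
    case 0 show ?case using Ck_fun_nat_0_iff[OF V] y by blast
  next
    case (Suc q)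
    then have IH: "\<And>i. i < d \<Longrightarrow> Ck_fun_nat q m V (\<lambda>x. y x i)" by simp
    have Hq: "Ck_fun_nat (Suc q) d U (H a)" and Gq: "Ck_fun_nat (Suc q) m V (G a)" if "a < N" for a
      using Ck_fun_nat_mono[OF H[OF that]] Ck_fun_nat_mono[OF G[OF that]] Suc.prems by auto
    have A: "Ck_fun_nat q m V (\<lambda>x. partial_deriv i (H a) (y x))" if "a < N" "i < d" for a i
      by (rule Ck_fun_nat_compose[OF V U Ck_fun_nat_Suc_D(2)[OF U Hq[OF that(1)] that(2)] IH yV])
    have "Ck_fun_nat (Suc q) m V (\<lambda>x. y x i)" if i: "i < d" for i
    proof (rule Ck_fun_nat_SucI[OF V y[OF i]])
      fix j assume j: "j < m"
      show "((\<lambda>t. y (x(j := t)) i) has_real_derivative partial_deriv j (\<lambda>x. y x i) x) (at (x j))"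
        if "x \<in> V" for x
        by (rule part(1)[OF that j i])
      show "Ck_fun_nat q m V (partial_deriv j (\<lambda>x. y x i))"
      proof (rule Ck_fun_nat_local[OF V])
        fix x assume x: "x \<in> V"
        obtain L W where W: "openin (Euclidean_space m) W" "x \<in> W" "W \<subseteq> V"
          and L: "\<And>i a. i < d \<Longrightarrow> a < N \<Longrightarrow> Ck_fun_nat q m W (L i a)"
          and Leq: "\<And>u z i. u \<in> W \<Longrightarrow> i < d \<Longrightarrow>
            z i = (\<Sum>a<N. L i a u * (\<Sum>j<d. partial_deriv j (H a) (y u) * z j))"
          by (rule left_inverse_Ck[where A = "\<lambda>a i x. partial_deriv i (H a) (y x)" and n = N, OF V x A inj[OF x]])
            (assumption | blast)+
        have "Ck_fun_nat q m W (\<lambda>u. \<Sum>a<N. L i a u * partial_deriv j (G a) u)"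
          using i Ck_fun_nat_subset[OF Ck_fun_nat_Suc_D(2)[OF V Gq j] W(3)]
          by (intro Ck_fun_nat_sum[OF W(1)] Ck_fun_nat_mult[OF W(1)] L) auto
        moreover have "(\<Sum>a<N. L i a u * partial_deriv j (G a) u) = partial_deriv j (\<lambda>x. y x i) u"
          if "u \<in> W" for u
        proof -
          have u: "u \<in> V" using that W by blast
          have "partial_deriv j (\<lambda>x. y x i) u =
            (\<Sum>a<N. L i a u * (\<Sum>k<d. partial_deriv k (H a) (y u) * partial_deriv j (\<lambda>x. y x k) u))"
            using Leq[OF that i, of "\<lambda>i. partial_deriv j (\<lambda>x. y x i) u"] .
          also have "\<dots> = (\<Sum>a<N. L i a u * partial_deriv j (G a) u)"
            using part(2)[OF u j] by (intro sum.cong) auto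
          finally show ?thesis by simp
        qed
        ultimately have "Ck_fun_nat q m W (partial_deriv j (\<lambda>x. y x i))"
          by (rule Ck_fun_nat_cong[OF W(1), rotated])
        then show "\<exists>W. openin (Euclidean_space m) W \<and> x \<in> W \<and> Ck_fun_nat q m W (partial_deriv j (\<lambda>x. y x i))"
          using W by blast
      qed
    qed
    then show ?case by blast
  qed
  then show ?thesis using assms(10) by blast
qed

subsection \<open>Differentiation under the integral sign\<close>

text \<open>The first \<open>l\<close> coordinates follow a curve \<open>c t\<close> and the
  remaining ones are free: the shape of an average over a circle of the torus, seen in a chart. The
  claims share one continuity argument on \<open>U\<close> times the unit interval, and the order is
  raised by applying Leibniz' rule in the direction \<open>l + i\<close>.\<close>

lemma
  fixes c :: "real \<Rightarrow> nat \<Rightarrow> real" and l n :: nat and w :: "real \<Rightarrow> real"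
  defines "ins \<equiv> \<lambda>t u i. if i < l then c t i else u (i - l)"
  assumes U: "openin (Euclidean_space n) U" and W: "openin (Euclidean_space (l + n)) W"
    and c: "\<And>i. continuous_on {0..1} (\<lambda>t. c t i)"
    and UW: "\<And>t u. t \<in> {0..1} \<Longrightarrow> u \<in> U \<Longrightarrow> ins t u \<in> W"
    and w: "continuous_on {0..1} w"
  shows has_partial_integral: "\<And>G. Ck_fun_nat (Suc 0) (l + n) W G \<Longrightarrow> u \<in> U \<Longrightarrow> i < n \<Longrightarrow>
      ((\<lambda>s. integral {0..1} (\<lambda>t. w t * G (ins t (u(i := s))))) has_real_derivative
        integral {0..1} (\<lambda>t. w t * partial_deriv (l + i) G (ins t u))) (at (u i))"
    and Ck_fun_nat_integral: "Ck_fun_nat r (l + n) W G \<Longrightarrow>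
      Ck_fun_nat r n U (\<lambda>u. integral {0..1} (\<lambda>t. w t * G (ins t u)))"
    and continuous_on_integrand: "\<And>G. continuous_on W G \<Longrightarrow>
      continuous_on (U \<times> {0..1}) (\<lambda>(u, t). w t * G (ins t u))"
proof -
  show cont: "continuous_on (U \<times> {0..1}) (\<lambda>(u, t). w t * G (ins t u))" if G: "continuous_on W G" for G
  proof -
    have "continuous_on (U \<times> {0..1}) (\<lambda>p. ins (snd p) (fst p))"
    proof (rule continuous_on_coordinatewise_then_product)
      fix i
      show "continuous_on (U \<times> {0..1}) (\<lambda>p. ins (snd p) (fst p) i)"
      proof (cases "i < l")
        case True
        have "continuous_on (U \<times> {0..1}) (\<lambda>p. c (snd p) i)"
          by (rule continuous_on_compose2[OF c]) (auto intro: continuous_intros)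
        then show ?thesis using True by (simp add: ins_def)
      next
        case False
        have "continuous_on (U \<times> {0..1::real}) (\<lambda>p. fst p (i - l))"
          by (rule continuous_on_product_then_coordinatewise) (intro continuous_intros)
        then show ?thesis using False by (simp add: ins_def)
      qed
    qed
    then have "continuous_on (U \<times> {0..1}) (\<lambda>p. G (ins (snd p) (fst p)))"
      by (rule continuous_on_compose2[OF G]) (use UW in auto)
    moreover have "continuous_on (U \<times> {0..1}) (\<lambda>p. w (snd p))"
      by (rule continuous_on_compose2[OF w]) (auto intro: continuous_intros)
    ultimately show ?thesis unfolding split_def by (intro continuous_on_mult)
  qed
  have ins_upd: "ins t (u(i := s)) = (ins t u)(l + i := s)" for t u i s
    by (auto simp: ins_def fun_eq_iff)
  show deriv: "((\<lambda>s. integral {0..1} (\<lambda>t. w t * G (ins t (u(i := s))))) has_real_derivative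
        integral {0..1} (\<lambda>t. w t * partial_deriv (l + i) G (ins t u))) (at (u i))"
    if G: "Ck_fun_nat (Suc 0) (l + n) W G" and u: "u \<in> U" and i: "i < n" for G u i
  proof -
    have uE: "u \<in> Euc n" using U u openin_Euc_subset by blast
    obtain e where e: "e > 0" "{y \<in> Euc n. \<forall>i<n. \<bar>y i - u i\<bar> < e} \<subseteq> U"
      using openin_Euc_contains_box U u by blast
    \<comment> \<open>Leibniz' rule asks for a convex parameter set: an interval on which the
      updated point stays in \<open>U\<close>.\<close>
    let ?S = "{u i - e <..< u i + e}"
    have S: "u(i := s) \<in> U" if "s \<in> ?S" for s
      using e uE i that by (intro subsetD[OF e(2)]) (auto simp: in_Euc)
    have cS: "continuous_on (?S \<times> {0..1}) (\<lambda>(s, t). w t * g (ins t (u(i := s))))" if "continuous_on W g" for g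
    proof -
      have "continuous_on (?S \<times> {0..1::real}) (\<lambda>p. (u(i := fst p), snd p))"
      proof (intro continuous_on_Pair continuous_on_coordinatewise_then_product)
        show "continuous_on (?S \<times> {0..1}) (\<lambda>p. (u(i := fst p)) k)" for k
          by (cases "k = i") (auto intro: continuous_intros)
      qed (intro continuous_intros)
      moreover have "(\<lambda>p. (u(i := fst p), snd p)) ` (?S \<times> {0..1::real}) \<subseteq> U \<times> {0..1}"
        using S by auto
      ultimately show ?thesis
        using continuous_on_compose2[OF cont[OF that]] by (fastforce simp: split_def)
    qed
    have cont_G: "continuous_on W G" "continuous_on W (partial_deriv (l + i) G)"
      using Ck_fun_nat_imp_continuous[OF W G]
        Ck_fun_nat_imp_continuous[OF W Ck_fun_nat_Suc_D(2)[OF W G, of "l + i"]] i by auto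
    have "((\<lambda>s. integral (cbox 0 1) (\<lambda>t. w t * G (ins t (u(i := s))))) has_real_derivative
        integral (cbox 0 1) (\<lambda>t. w t * partial_deriv (l + i) G (ins t (u(i := u i))))) (at (u i) within ?S)"
    proof (rule leibniz_rule_field_derivative)
      fix s and t :: real assume s: "s \<in> ?S" and t: "t \<in> cbox 0 1"
      have "((\<lambda>s'. G ((ins t (u(i := s)))(l + i := s'))) has_real_derivative
          partial_deriv (l + i) G (ins t (u(i := s)))) (at (ins t (u(i := s)) (l + i)))"
        by (rule Ck_fun_nat_Suc_D(1)[OF W G]) (use i UW S s t in auto)
      then have "((\<lambda>s'. G (ins t (u(i := s')))) has_real_derivative
          partial_deriv (l + i) G (ins t (u(i := s)))) (at s)"
        by (simp add: ins_upd del: fun_upd_apply) (simp add: fun_upd_same)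
      then show "((\<lambda>s. w t * G (ins t (u(i := s)))) has_real_derivative
          w t * partial_deriv (l + i) G (ins t (u(i := s)))) (at s within ?S)"
        by (rule DERIV_subset[OF DERIV_cmult subset_UNIV])
    next
      fix s assume "s \<in> ?S"
      have "continuous_on {0..1} (Pair (u(i := s)))" "Pair (u(i := s)) ` {0..1} \<subseteq> U \<times> {0..1}"
        using S[OF \<open>s \<in> ?S\<close>] by (auto intro!: continuous_intros)
      from continuous_on_compose2[OF cont[OF cont_G(1)] this]
      have "continuous_on {0..1} (\<lambda>t. w t * G (ins t (u(i := s))))" by simp
      then show "(\<lambda>t. w t * G (ins t (u(i := s)))) integrable_on cbox 0 1"
        by (simp add: integrable_continuous_interval)
    next
      show "continuous_on (?S \<times> cbox 0 1) (\<lambda>(s, t). w t * partial_deriv (l + i) G (ins t (u(i := s))))"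
        using cS[OF cont_G(2)] by simp
    qed (use e in auto)
    moreover have "at (u i) within ?S = at (u i)"
      by (rule at_within_open) (use e in auto)
    ultimately show ?thesis by simp
  qed
  show "Ck_fun_nat r n U (\<lambda>u. integral {0..1} (\<lambda>t. w t * G (ins t u)))"
    if "Ck_fun_nat r (l + n) W G"
  proof -
    have cI: "continuous_on U (\<lambda>u. integral {0..1} (\<lambda>t. w t * G (ins t u)))" if "continuous_on W G" for G
      using integral_continuous_on_param[of U 0 1 "\<lambda>u t. w t * G (ins t u)"] cont[OF that] by simp
    show ?thesis using that
    proof (induction r arbitrary: G)
      case 0
      then show ?case using cI Ck_fun_nat_0_iff[OF U] Ck_fun_nat_0_iff[OF W] by blast
    next
      case (Suc r)
      show ?case
      proof (rule Ck_fun_nat_SucI[OF U])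
        show "continuous_on U (\<lambda>u. integral {0..1} (\<lambda>t. w t * G (ins t u)))"
          by (rule cI[OF Ck_fun_nat_imp_continuous[OF W Suc.prems]])
        fix i assume i: "i < n"
        show "((\<lambda>s. integral {0..1} (\<lambda>t. w t * G (ins t (u(i := s))))) has_real_derivative
          integral {0..1} (\<lambda>t. w t * partial_deriv (l + i) G (ins t u))) (at (u i))" if "u \<in> U" for u
          using deriv[OF Ck_fun_nat_mono[OF Suc.prems] that i] by simp
        show "Ck_fun_nat r n U (\<lambda>u. integral {0..1} (\<lambda>t. w t * partial_deriv (l + i) G (ins t u)))"
          using Suc.IH[OF Ck_fun_nat_Suc_D(2)[OF W Suc.prems]] i by simp
      qed
    qed
  qed
qed

subsection \<open>A smooth bump\<close>

text \<open>The \<open>i\<close>-th derivative of the function that is exp(-1/t) for t > 0 and 0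
  otherwise. With s = 1/t, differentiating q(s) exp(-s) with respect to t replaces q by s^2 (q -
  q'), whence the iterated polynomial.\<close>

definition flat_exp :: "nat \<Rightarrow> real \<Rightarrow> real" where
  "flat_exp i t = (if t > 0 then poly (((\<lambda>q. [:0, 0, 1:] * (q - pderiv q)) ^^ i) 1) (1 / t) * exp (- (1 / t)) else 0)"

lemma tendsto_poly_exp_at_right: "((\<lambda>t::real. poly q (1 / t) * exp (- (1 / t))) \<longlongrightarrow> 0) (at_right 0)"
proof -
  have "((\<lambda>x. \<Sum>i\<le>degree q. coeff q i * (x ^ i / exp x)) \<longlongrightarrow> (\<Sum>i\<le>degree q. coeff q i * 0)) at_top"
    by (intro tendsto_sum tendsto_mult tendsto_const tendsto_power_div_exp_0)
  then have "((\<lambda>x. poly q x * exp (- x)) \<longlongrightarrow> 0) at_top"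
    by (simp add: poly_altdef sum_distrib_right exp_minus divide_inverse mult.assoc)
  moreover have "filterlim (\<lambda>t::real. 1 / t) at_top (at_right 0)"
    using filterlim_inverse_at_top_right by (simp add: inverse_eq_divide)
  ultimately show ?thesis by (rule filterlim_compose)
qed

lemma derivative_tower_flat_exp: "derivative_tower UNIV flat_exp"
  unfolding derivative_tower_def
proof (intro allI ballI)
  fix i :: nat and t :: real
  define q where "q = ((\<lambda>q. [:0, 0, 1:] * (q - pderiv q)) ^^ i) (1 :: real poly)"
  have f: "flat_exp i t = (if t > 0 then poly q (1 / t) * exp (- (1 / t)) else 0)" for t
    by (simp add: flat_exp_def q_def)
  have f': "flat_exp (Suc i) t = (if t > 0 then (poly q (1 / t) - poly (pderiv q) (1 / t)) / t ^ 2 * exp (- (1 / t)) else 0)" for t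
    by (simp add: flat_exp_def q_def power2_eq_square)
  consider "t > 0" | "t < 0" | "t = 0" by linarith
  then show "(flat_exp i has_real_derivative flat_exp (Suc i) t) (at t)"
  proof cases
    case 1
    have ev: "\<forall>\<^sub>F s in nhds t. flat_exp i s = poly q (1 / s) * exp (- (1 / s))"
      using eventually_nhds_in_open[of "{0<..}" t] 1 by (auto simp: f elim!: eventually_mono)
    have "((\<lambda>s. poly q (1 / s) * exp (- (1 / s))) has_real_derivative flat_exp (Suc i) t) (at t)"
      using 1 by (auto intro!: derivative_eq_intros DERIV_chain2[OF poly_DERIV] simp: f' power2_eq_square field_simps)
    then show ?thesis using DERIV_cong_ev[OF refl ev refl] by blast
  next
    case 2
    have ev: "\<forall>\<^sub>F s in nhds t. flat_exp i s = 0"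
      using eventually_nhds_in_open[of "{..<0}" t] 2 by (auto simp: f elim!: eventually_mono)
    have "((\<lambda>s. 0) has_real_derivative flat_exp (Suc i) t) (at t)" using 2 by (simp add: f')
    then show ?thesis using DERIV_cong_ev[OF refl ev refl] by blast
  next
    case 3
    have "((\<lambda>h. flat_exp i h / h) \<longlongrightarrow> 0) (at_right 0)"
    \<comment> \<open>\<open>pCons 0 q\<close> is \<open>q\<close> times its variable; the
      additional factor is the \<open>1 / h\<close> of the difference quotient.\<close>
    proof (rule Lim_transform_eventually[OF tendsto_poly_exp_at_right[of "pCons 0 q"]])
      show "\<forall>\<^sub>F h in at_right 0. poly (pCons 0 q) (1 / h) * exp (- (1 / h)) = flat_exp i h / h"
        using eventually_at_right_less[of 0] by eventually_elim (simp add: f)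
    qed
    moreover have "((\<lambda>h. flat_exp i h / h) \<longlongrightarrow> 0) (at_left 0)"
    proof (rule Lim_transform_eventually[OF tendsto_const])
      show "\<forall>\<^sub>F h in at_left 0. 0 = flat_exp i h / h"
        using eventually_at_left_real[of "-1" 0] by (auto simp: f elim!: eventually_mono)
    qed
    ultimately have "((\<lambda>h. flat_exp i h / h) \<longlongrightarrow> 0) (at 0)" by (simp add: filterlim_at_split)
    then show ?thesis using 3 by (simp add: has_field_derivative_iff f f')
  qed
qed

lemma Ck_fun_nat_flat_exp:
  assumes "openin (Euclidean_space n) U" "Ck_fun_nat r n U f"
  shows "Ck_fun_nat r n U (\<lambda>x. flat_exp 0 (f x))"
  using Ck_fun_nat_compose_real[OF assms(1) derivative_tower_flat_exp assms(2)] by simp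

lemma flat_exp_pos: "0 < t \<Longrightarrow> 0 < flat_exp 0 t"
  and flat_exp_nonpos: "t \<le> 0 \<Longrightarrow> flat_exp 0 t = 0"
  by (simp_all add: flat_exp_def)

section \<open>Real functions of class \<open>C\<^sup>k\<close> on manifolds\<close>

abbreviation chart_img :: "'a chart \<Rightarrow> (nat \<Rightarrow> real) set" where
  "chart_img c \<equiv> chart_map c ` chart_dom c"

abbreviation chart_inv :: "'a chart \<Rightarrow> (nat \<Rightarrow> real) \<Rightarrow> 'a" where
  "chart_inv c \<equiv> inv_into (chart_dom c) (chart_map c)"

lemma chart_of_facts:
  assumes "chart_of X c"
  shows chart_of_openin_dom: "openin X (chart_dom c)"
    and chart_of_openin_img: "openin (Euclidean_space (chart_dim c)) (chart_img c)"
    and chart_of_inj: "inj_on (chart_map c) (chart_dom c)"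
    and chart_of_dom_subset: "chart_dom c \<subseteq> topspace X"
    and chart_of_img_subset: "chart_img c \<subseteq> Euc (chart_dim c)"
    and chart_of_continuous: "continuous_map (subtopology X (chart_dom c)) (Euclidean_space (chart_dim c)) (chart_map c)"
    and chart_of_inv_continuous: "continuous_map (subtopology (Euclidean_space (chart_dim c)) (chart_img c)) X (chart_inv c)"
    and chart_of_open_image: "\<And>S. openin X S \<Longrightarrow> S \<subseteq> chart_dom c \<Longrightarrow>
      openin (Euclidean_space (chart_dim c)) (chart_map c ` S)"
proof -
  let ?E = "Euclidean_space (chart_dim c)"
  show dom: "openin X (chart_dom c)" and img: "openin ?E (chart_img c)"
    using assms by (auto simp: chart_of_def)
  have h: "homeomorphic_map (subtopology X (chart_dom c)) (subtopology ?E (chart_img c)) (chart_map c)"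
    using assms by (auto simp: chart_of_def)
  show sub: "chart_dom c \<subseteq> topspace X" using dom openin_subset by blast
  show imgsub: "chart_img c \<subseteq> Euc (chart_dim c)" using img openin_Euc_subset by blast
  show inj: "inj_on (chart_map c) (chart_dom c)"
    using homeomorphic_imp_injective_map[OF h] sub by (simp add: Int_absorb1)
  show "continuous_map (subtopology X (chart_dom c)) ?E (chart_map c)"
    using homeomorphic_imp_continuous_map[OF h] by (simp add: continuous_map_in_subtopology)
  obtain g where g: "homeomorphic_maps (subtopology X (chart_dom c)) (subtopology ?E (chart_img c)) (chart_map c) g"
    using h homeomorphic_map_maps by blast
  have gc: "continuous_map (subtopology ?E (chart_img c)) (subtopology X (chart_dom c)) g"
    and gi: "\<And>x. x \<in> chart_dom c \<Longrightarrow> g (chart_map c x) = x"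
    using g sub by (auto simp: homeomorphic_maps_def)
  have "continuous_map (subtopology ?E (chart_img c)) X g"
    using gc by (simp add: continuous_map_in_subtopology)
  then show "continuous_map (subtopology ?E (chart_img c)) X (chart_inv c)"
    by (rule continuous_map_eq) (use gi inj in \<open>auto simp: inv_into_f_f\<close>)
  show "openin ?E (chart_map c ` S)" if "openin X S" "S \<subseteq> chart_dom c" for S
  proof -
    have "openin (subtopology X (chart_dom c)) S"
      using that dom by (simp add: openin_open_subtopology)
    then have "openin (subtopology ?E (chart_img c)) (chart_map c ` S)"
      using homeomorphic_imp_open_map[OF h] by (simp add: open_map_def)
    then show ?thesis using img by (simp add: openin_open_subtopology)
  qed
qed

lemma chart_inv_in_dom: "u \<in> chart_img c \<Longrightarrow> chart_inv c u \<in> chart_dom c"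
  by (rule inv_into_into)

lemma chart_inv_in_points: "chart_of X c \<Longrightarrow> u \<in> chart_img c \<Longrightarrow> chart_inv c u \<in> topspace X"
  using chart_inv_in_dom[of u c] chart_of_dom_subset[of X c] by auto

lemma chart_map_inv: "u \<in> chart_img c \<Longrightarrow> chart_map c (chart_inv c u) = u"
  by (rule f_inv_into_f)

lemma chart_inv_map: "chart_of X c \<Longrightarrow> x \<in> chart_dom c \<Longrightarrow> chart_inv c (chart_map c x) = x"
  by (simp add: chart_of_inj)

lemma chart_ofI:
  assumes dom: "openin X (chart_dom c)" and img: "openin (Euclidean_space (chart_dim c)) (chart_img c)"
    and f: "continuous_map (subtopology X (chart_dom c)) (Euclidean_space (chart_dim c)) (chart_map c)"
    and g: "continuous_map (subtopology (Euclidean_space (chart_dim c)) (chart_img c)) X g"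
    and gf: "\<And>x. x \<in> chart_dom c \<Longrightarrow> g (chart_map c x) = x"
  shows "chart_of X c"
proof -
  have "homeomorphic_maps (subtopology X (chart_dom c))
      (subtopology (Euclidean_space (chart_dim c)) (chart_img c)) (chart_map c) g"
    using f g gf openin_subset[OF dom] unfolding homeomorphic_maps_def
    by (auto simp: continuous_map_in_subtopology)
  then show ?thesis unfolding chart_of_def using dom img homeomorphic_map_maps by blast
qed

text \<open>The topological half of \<open>Ck_manifold\<close>, shared by \<open>X\<close>, the
  torus and their product.\<close>

definition charted :: "'a mfd \<Rightarrow> bool" where
  "charted M \<longleftrightarrow> (\<forall>c\<in>mfd_atlas M. chart_of (mfd_top M) c) \<and> \<Union> (chart_dom ` mfd_atlas M) = points M"

lemma chartedD: "charted M \<Longrightarrow> c \<in> mfd_atlas M \<Longrightarrow> chart_of (mfd_top M) c"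
  by (simp add: charted_def)

lemma charted_obtain:
  assumes "charted M" "x \<in> points M"
  obtains c where "c \<in> mfd_atlas M" "chart_of (mfd_top M) c" "x \<in> chart_dom c"
  using assms by (auto simp: charted_def)

lemma Ck_manifold_charted: "Ck_manifold k M \<Longrightarrow> charted M"
  by (auto simp: Ck_manifold_def charted_def)

definition Ck_real :: "enat \<Rightarrow> 'a mfd \<Rightarrow> ('a \<Rightarrow> real) \<Rightarrow> bool" where
  "Ck_real k M f \<longleftrightarrow> (\<forall>c\<in>mfd_atlas M. \<forall>r. enat r \<le> k \<longrightarrow>
     Ck_fun_nat r (chart_dim c) (chart_img c) (\<lambda>u. f (chart_inv c u)))"

lemma Ck_realD:
  "Ck_real k M f \<Longrightarrow> c \<in> mfd_atlas M \<Longrightarrow> enat r \<le> k \<Longrightarrow>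
    Ck_fun_nat r (chart_dim c) (chart_img c) (\<lambda>u. f (chart_inv c u))"
  by (simp add: Ck_real_def)

lemma Ck_real_cong:
  assumes "charted M" "\<And>x. x \<in> points M \<Longrightarrow> f x = g x" "Ck_real k M f"
  shows "Ck_real k M g"
  unfolding Ck_real_def
proof (intro ballI allI impI)
  fix c r assume c: "c \<in> mfd_atlas M" and r: "enat r \<le> k"
  have ch: "chart_of (mfd_top M) c" using assms c by (simp add: chartedD)
  show "Ck_fun_nat r (chart_dim c) (chart_img c) (\<lambda>u. g (chart_inv c u))"
  proof (rule Ck_fun_nat_cong[OF chart_of_openin_img[OF ch] _ Ck_realD[OF assms(3) c r]])
    fix u assume "u \<in> chart_img c"
    then have "chart_inv c u \<in> points M" by (rule chart_inv_in_points[OF ch])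
    then show "f (chart_inv c u) = g (chart_inv c u)" by (rule assms(2))
  qed
qed

lemma Ck_real_const: "Ck_real k M (\<lambda>_. a)"
  by (simp add: Ck_real_def Ck_fun_nat_const)

lemma Ck_real_add: "charted M \<Longrightarrow> Ck_real k M f \<Longrightarrow> Ck_real k M g \<Longrightarrow> Ck_real k M (\<lambda>x. f x + g x)"
  unfolding Ck_real_def
  by (intro ballI allI impI, rule Ck_fun_nat_add) (auto intro: chart_of_openin_img dest: chartedD)

lemma Ck_real_continuous:
  assumes "charted M" "Ck_real k M f"
  shows "continuous_map (mfd_top M) euclideanreal f"
proof (rule pasting_lemma)
  show "openin (mfd_top M) (chart_dom c)" if "c \<in> mfd_atlas M" for c
    using chart_of_openin_dom[OF chartedD[OF assms(1) that]] .
  show "continuous_map (subtopology (mfd_top M) (chart_dom c)) euclideanreal f" if c: "c \<in> mfd_atlas M" for c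
  proof -
    have cc: "chart_of (mfd_top M) c" using assms(1) c by (rule chartedD)
    have "Ck_fun_nat 0 (chart_dim c) (chart_img c) (\<lambda>u. f (chart_inv c u))"
      by (rule Ck_realD[OF assms(2) c]) (simp flip: zero_enat_def)
    then have "continuous_map (subtopology (Euclidean_space (chart_dim c)) (chart_img c)) euclideanreal
        (\<lambda>u. f (chart_inv c u))" by (simp add: Ck_fun_nat.simps)
    moreover have "continuous_map (subtopology (mfd_top M) (chart_dom c))
        (subtopology (Euclidean_space (chart_dim c)) (chart_img c)) (chart_map c)"
      by (rule continuous_map_into_subtopology[OF chart_of_continuous[OF cc]]) auto
    ultimately have "continuous_map (subtopology (mfd_top M) (chart_dom c)) euclideanreal
        ((\<lambda>u. f (chart_inv c u)) \<circ> chart_map c)" using continuous_map_compose by blast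
    then show ?thesis by (rule continuous_map_eq) (simp add: chart_inv_map[OF cc])
  qed
  show "\<exists>c. c \<in> mfd_atlas M \<and> x \<in> chart_dom c \<and> f x = f x" if "x \<in> topspace (mfd_top M)" for x
    using charted_obtain[OF assms(1) that] by metis
qed simp

lemma openin_chart_preimage:
  assumes c: "chart_of X c" and d: "openin Y S" and f: "continuous_map X Y f"
  shows "openin (Euclidean_space (chart_dim c)) (chart_map c ` (chart_dom c \<inter> f -` S))"
proof -
  have "chart_dom c \<inter> f -` S = chart_dom c \<inter> {x \<in> topspace X. f x \<in> S}"
    using chart_of_dom_subset[OF c] by auto
  moreover have "openin X (chart_dom c \<inter> {x \<in> topspace X. f x \<in> S})"
    using chart_of_openin_dom[OF c] openin_continuous_map_preimage[OF f d] by blast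
  ultimately show ?thesis using chart_of_open_image[OF c] by simp
qed

lemma Ck_real_compose:
  assumes N: "charted N" and M: "charted M" and g: "Ck_map k N M g" and f: "Ck_real k M f"
  shows "Ck_real k N (\<lambda>x. f (g x))"
  unfolding Ck_real_def
proof (intro ballI allI impI)
  fix c r assume c: "c \<in> mfd_atlas N" and r: "enat r \<le> k"
  have cc: "chart_of (mfd_top N) c" using N c by (rule chartedD)
  have g_cont: "continuous_map (mfd_top N) (mfd_top M) g" using g by (simp add: Ck_map_def)
  show "Ck_fun_nat r (chart_dim c) (chart_img c) (\<lambda>u. f (g (chart_inv c u)))"
  proof (rule Ck_fun_nat_local[OF chart_of_openin_img[OF cc]])
    fix u assume u: "u \<in> chart_img c"
    then have "chart_inv c u \<in> points N" by (rule chart_inv_in_points[OF cc])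
    then have "g (chart_inv c u) \<in> points M" using g_cont by (auto simp: continuous_map_def)
    then obtain d where d: "d \<in> mfd_atlas M" "chart_of (mfd_top M) d" "g (chart_inv c u) \<in> chart_dom d"
      using charted_obtain[OF M] by blast
    define W where "W = chart_map c ` (chart_dom c \<inter> g -` chart_dom d)"
    have W: "openin (Euclidean_space (chart_dim c)) W"
      unfolding W_def by (rule openin_chart_preimage[OF cc chart_of_openin_dom[OF d(2)] g_cont])
    have WD: "chart_inv c w \<in> chart_dom c \<and> g (chart_inv c w) \<in> chart_dom d" if "w \<in> W" for w
      using that chart_inv_map[OF cc] by (auto simp: W_def)
    have rep: "local_rep c d g w = chart_map d (g (chart_inv c w))" for w
      by (simp add: local_rep_def)
    have "local_Ck k c d g" using g c d by (simp add: Ck_map_def)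
    then have "Ck_fun_nat r (chart_dim c) W (\<lambda>w. local_rep c d g w j)" if "j < chart_dim d" for j
      using that r by (simp add: local_Ck_def Ck_on_def W_def)
    then have "Ck_fun_nat r (chart_dim c) W (\<lambda>w. f (chart_inv d (local_rep c d g w)))"
      by (intro Ck_fun_nat_compose[OF W chart_of_openin_img[OF d(2)] Ck_realD[OF f d(1) r]])
        (auto simp: rep dest: WD)
    then have "Ck_fun_nat r (chart_dim c) W (\<lambda>w. f (g (chart_inv c w)))"
      by (rule Ck_fun_nat_cong[OF W, rotated]) (simp add: rep chart_inv_map[OF d(2)] WD)
    moreover have "u \<in> W"
      unfolding W_def using u d(3) by (intro image_eqI[of _ _ "chart_inv c u"])
        (auto simp: chart_map_inv chart_inv_in_dom)
    ultimately show "\<exists>V. openin (Euclidean_space (chart_dim c)) V \<and> u \<in> V \<and>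
        Ck_fun_nat r (chart_dim c) V (\<lambda>u. f (g (chart_inv c u)))" using W by blast
  qed
qed

text \<open>Extension by zero. Around points of the chart domain the transition map carries
  \<open>f\<close> over; around all other points the complement of the closed set \<open>K\<close>
  is a neighbourhood on which the function vanishes. Although \<open>f\<close> is smooth, the result
  is only as regular as the transition maps.\<close>

lemma Ck_real_supported_in_chart:
  assumes M: "Ck_manifold k M" and c: "c \<in> mfd_atlas M"
    and K: "closedin (mfd_top M) K" "K \<subseteq> chart_dom c"
    and f: "\<And>r. Ck_fun_nat r (chart_dim c) (chart_img c) f"
    and off: "\<And>u. u \<in> chart_img c \<Longrightarrow> chart_inv c u \<notin> K \<Longrightarrow> f u = 0"
  shows "Ck_real k M (\<lambda>x. if x \<in> chart_dom c then f (chart_map c x) else 0)" (is "Ck_real k M ?f")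
  unfolding Ck_real_def
proof (intro ballI allI impI)
  fix d r assume d: "d \<in> mfd_atlas M" and r: "enat r \<le> k"
  have ch: "charted M" using M by (rule Ck_manifold_charted)
  have cc: "chart_of (mfd_top M) c" and dd: "chart_of (mfd_top M) d" using ch c d chartedD by blast+
  have id: "continuous_map (mfd_top M) (mfd_top M) id" by simp
  show "Ck_fun_nat r (chart_dim d) (chart_img d) (\<lambda>u. ?f (chart_inv d u))"
  proof (rule Ck_fun_nat_local[OF chart_of_openin_img[OF dd]])
    fix u assume u: "u \<in> chart_img d"
    show "\<exists>V. openin (Euclidean_space (chart_dim d)) V \<and> u \<in> V \<and>
        Ck_fun_nat r (chart_dim d) V (\<lambda>u. ?f (chart_inv d u))"
    proof (cases "chart_inv d u \<in> chart_dom c")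
      case True
      define W where "W = chart_map d ` (chart_dom d \<inter> id -` chart_dom c)"
      have W: "openin (Euclidean_space (chart_dim d)) W"
        unfolding W_def by (rule openin_chart_preimage[OF dd chart_of_openin_dom[OF cc] id])
      have WD: "chart_inv d w \<in> chart_dom d \<and> chart_inv d w \<in> chart_dom c" if "w \<in> W" for w
        using that chart_inv_map[OF dd] by (auto simp: W_def)
      have "local_Ck k d c id" using M c d by (simp add: Ck_manifold_def)
      then have "Ck_fun_nat r (chart_dim d) W (\<lambda>w. local_rep d c id w j)" if "j < chart_dim c" for j
        using that r by (simp add: local_Ck_def Ck_on_def W_def)
      then have "Ck_fun_nat r (chart_dim d) W (\<lambda>w. f (local_rep d c id w))"
        by (intro Ck_fun_nat_compose[OF W chart_of_openin_img[OF cc] f])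
          (auto simp: local_rep_def dest: WD)
      then have "Ck_fun_nat r (chart_dim d) W (\<lambda>w. ?f (chart_inv d w))"
        by (rule Ck_fun_nat_cong[OF W, rotated]) (simp add: local_rep_def WD)
      moreover have "u \<in> W"
        unfolding W_def using u True by (intro image_eqI[of _ _ "chart_inv d u"])
          (auto simp: chart_map_inv chart_inv_in_dom)
      ultimately show ?thesis using W by blast
    next
      case False
      define S where "S = topspace (mfd_top M) - K"
      have S: "openin (mfd_top M) S" using K(1) unfolding S_def by blast
      define W where "W = chart_map d ` (chart_dom d \<inter> id -` S)"
      have W: "openin (Euclidean_space (chart_dim d)) W"
        unfolding W_def by (rule openin_chart_preimage[OF dd S id])
      have "Ck_fun_nat r (chart_dim d) W (\<lambda>w. ?f (chart_inv d w))"
      proof (rule Ck_fun_nat_cong[OF W _ Ck_fun_nat_const[of r _ _ 0]])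
        fix w assume "w \<in> W"
        then have "chart_inv d w \<notin> K" using chart_inv_map[OF dd] by (auto simp: W_def S_def)
        then show "0 = ?f (chart_inv d w)"
          using off[of "chart_map c (chart_inv d w)"] chart_inv_map[OF cc] by auto
      qed
      moreover have "u \<in> W"
        unfolding W_def using u False K(2) chart_of_dom_subset[OF dd] chart_inv_in_dom[OF u]
        by (intro image_eqI[of _ _ "chart_inv d u"]) (auto simp: chart_map_inv S_def)
      ultimately show ?thesis using W by blast
    qed
  qed
qed

text \<open>Injectivity of the differential for a target with one identity chart, as a trivial
  kernel of the Jacobian. The entries of \<open>w\<close> from the dimension on are left free
  instead of being required to vanish.\<close>

definition immersive :: "'a mfd \<Rightarrow> nat \<Rightarrow> ('a \<Rightarrow> nat \<Rightarrow> real) \<Rightarrow> bool" where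
  "immersive M n F \<longleftrightarrow> (\<forall>c\<in>mfd_atlas M. \<forall>u\<in>chart_img c. \<forall>w.
     (\<forall>a<n. (\<Sum>i<chart_dim c. partial_deriv i (\<lambda>u. F (chart_inv c u) a) u * w i) = 0) \<longrightarrow>
     (\<forall>i<chart_dim c. w i = 0))"

lemma immersion_Euclidean_iff:
  assumes M: "charted M" and F: "F \<in> points M \<rightarrow> Euc n"
  shows "immersion M (Euclidean_mfd n) F \<longleftrightarrow> immersive M n F"
proof -
  define e where "e = \<lparr>chart_dim = n, chart_dom = Euc n, chart_map = id :: (nat \<Rightarrow> real) \<Rightarrow> _\<rparr>"
  have atlas: "mfd_atlas (Euclidean_mfd n) = {e}" by (simp add: Euclidean_mfd_def e_def)
  let ?A = "\<lambda>c u a i. partial_deriv i (\<lambda>u. F (chart_inv c u) a) u"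
  have e: "chart_dom e = Euc n" "chart_dim e = n" by (simp_all add: e_def)
  have diff: "differential_at (chart_dim c) n (local_rep c e F) u =
      (\<lambda>v a. if a < n then \<Sum>i<chart_dim c. ?A c u a i * v i else 0)" for c u
    by (simp add: differential_at_def local_rep_def e_def fun_eq_iff)
  have inj: "inj_on (\<lambda>v a. if a < n then \<Sum>i<d. A a i * v i else 0 :: real) (Euc d) \<longleftrightarrow>
     (\<forall>w. (\<forall>a<n. (\<Sum>i<d. A a i * w i) = 0) \<longrightarrow> (\<forall>i<d. w i = 0))" (is "?l \<longleftrightarrow> ?r")
    for A :: "nat \<Rightarrow> nat \<Rightarrow> real" and d
  proof
    assume ?l
    show ?r
    proof (intro allI impI)
      fix w :: "nat \<Rightarrow> real" and i assume w: "\<forall>a<n. (\<Sum>i<d. A a i * w i) = 0" and i: "i < d"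
      let ?w = "\<lambda>i. if i < d then w i else 0"
      have "?w = (\<lambda>_. 0)"
        by (rule inj_onD[OF \<open>?l\<close>]) (use w in \<open>auto simp: in_Euc fun_eq_iff\<close>)
      then show "w i = 0" using i by (metis)
    qed
  next
    assume ?r
    show ?l
    proof (rule inj_onI)
      fix v w assume vw: "v \<in> Euc d" "w \<in> Euc d"
        and eq: "(\<lambda>a. if a < n then \<Sum>i<d. A a i * v i else 0) = (\<lambda>a. if a < n then \<Sum>i<d. A a i * w i else 0)"
      have "(\<Sum>i<d. A a i * (v i - w i)) = 0" if "a < n" for a
        using fun_cong[OF eq, of a] that by (simp add: right_diff_distrib sum_subtractf)
      then have "\<forall>i<d. v i - w i = 0" using \<open>?r\<close>[rule_format, of "\<lambda>i. v i - w i"] by blast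
      then have "v i = w i" for i using vw by (cases "i < d") (auto simp: in_Euc)
      then show "v = w" by (rule ext)
    qed
  qed
  have "immersion M (Euclidean_mfd n) F \<longleftrightarrow> (\<forall>x\<in>points M. \<forall>c\<in>mfd_atlas M. x \<in> chart_dom c \<longrightarrow>
      (\<forall>w. (\<forall>a<n. (\<Sum>i<chart_dim c. ?A c (chart_map c x) a i * w i) = 0) \<longrightarrow> (\<forall>i<chart_dim c. w i = 0)))"
    unfolding immersion_def atlas using F by (simp add: diff inj e Pi_iff)
  also have "\<dots> \<longleftrightarrow> immersive M n F"
    unfolding immersive_def using chart_of_dom_subset[OF chartedD[OF M]] by blast
  finally show ?thesis .
qed

lemma Ck_map_Euclidean_iff:
  assumes M: "charted M" and F: "continuous_map (mfd_top M) (Euclidean_space n) F"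
  shows "Ck_map k M (Euclidean_mfd n) F \<longleftrightarrow> (\<forall>a<n. Ck_real k M (\<lambda>x. F x a))"
proof -
  have "chart_dom c \<inter> F -` Euc n = chart_dom c" if "c \<in> mfd_atlas M" for c
    using F chart_of_dom_subset[OF chartedD[OF M that]] by (auto simp: continuous_map_def)
  then show ?thesis
    using F by (auto simp: Ck_map_def Euclidean_mfd_def local_Ck_def Ck_on_def local_rep_def Ck_real_def)
qed

text \<open>In charts \<open>g\<close> is a continuous solution \<open>y\<close> of an equation
  \<open>F (chart_inv d y) = G x\<close> whose left side has injective differential, hence it is as
  regular as the composition of \<open>F\<close> and \<open>g\<close>. This is the universal
  property of immersions among continuous maps.\<close>

lemma Ck_map_from_immersive:
  assumes N: "charted N" and M: "charted M" and k: "1 \<le> k"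
    and F: "\<And>a. a < n \<Longrightarrow> Ck_real k M (\<lambda>x. F x a)" and imm: "immersive M n F"
    and g: "continuous_map (mfd_top N) (mfd_top M) g"
    and Fg: "\<And>a. a < n \<Longrightarrow> Ck_real k N (\<lambda>x. F (g x) a)"
  shows "Ck_map k N M g"
  unfolding Ck_map_def
proof (intro conjI ballI g)
  fix c d assume c: "c \<in> mfd_atlas N" and d: "d \<in> mfd_atlas M"
  have cc: "chart_of (mfd_top N) c" and dd: "chart_of (mfd_top M) d" using N M c d chartedD by blast+
  define W where "W = chart_map c ` (chart_dom c \<inter> g -` chart_dom d)"
  have W: "openin (Euclidean_space (chart_dim c)) W"
    unfolding W_def by (rule openin_chart_preimage[OF cc chart_of_openin_dom[OF dd] g])
  have WD: "chart_inv c w \<in> chart_dom c" "g (chart_inv c w) \<in> chart_dom d" if "w \<in> W" for w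
    using that chart_inv_map[OF cc] by (auto simp: W_def)
  have Wc: "W \<subseteq> chart_img c" by (auto simp: W_def)
  have rep: "local_rep c d g w = chart_map d (g (chart_inv c w))" for w
    by (simp add: local_rep_def)
  have "continuous_map (subtopology (Euclidean_space (chart_dim c)) W) (mfd_top N) (chart_inv c)"
    by (rule continuous_map_from_subtopology_mono[OF chart_of_inv_continuous[OF cc] Wc])
  from continuous_map_compose[OF this g]
  have "continuous_map (subtopology (Euclidean_space (chart_dim c)) W)
      (subtopology (mfd_top M) (chart_dom d)) (g \<circ> chart_inv c)"
    by (rule continuous_map_into_subtopology) (use WD in auto)
  from continuous_map_compose[OF this chart_of_continuous[OF dd]]
  have "continuous_on W (local_rep c d g)"
    using W openin_Euc_subset[OF W]
    by (simp add: cm_Euclidean_space_iff_continuous_on local_rep_def o_assoc Int_absorb1)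
  then have cont: "continuous_on W (\<lambda>w. local_rep c d g w j)" for j
    by (rule continuous_on_product_then_coordinatewise)
  show "local_Ck k c d g"
    unfolding local_Ck_def Ck_on_def W_def[symmetric]
  proof (intro allI impI)
    fix j r assume j: "j < chart_dim d" and r: "enat r \<le> k"
    \<comment> \<open>Regularity of implicit solutions starts with one derivative, so order 0 is
      deduced from order 1.\<close>
    obtain q where q: "r \<le> q" "1 \<le> q" "enat q \<le> k"
      by (rule that[of "max r 1"]) (use r k in \<open>auto simp: max_def one_enat_def\<close>)
    have "Ck_fun_nat q (chart_dim c) W (\<lambda>x. local_rep c d g x j)"
    proof (rule Ck_fun_nat_implicit[where H = "\<lambda>a u. F (chart_inv d u) a" and N = n
          and G = "\<lambda>a w. F (g (chart_inv c w)) a", OF W chart_of_openin_img[OF dd] cont _ q(2) _ _ _ _ j])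
      show "local_rep c d g ` W \<subseteq> chart_img d" using WD by (auto simp: rep)
      show "Ck_fun_nat q (chart_dim d) (chart_img d) (\<lambda>u. F (chart_inv d u) a)" if "a < n" for a
        by (rule Ck_realD[OF F[OF that] d q(3)])
      show "Ck_fun_nat q (chart_dim c) W (\<lambda>w. F (g (chart_inv c w)) a)" if "a < n" for a
        by (rule Ck_fun_nat_subset[OF Ck_realD[OF Fg[OF that] c q(3)] Wc])
      show "F (chart_inv d (local_rep c d g w)) a = F (g (chart_inv c w)) a" if "w \<in> W" for a w
        using WD[OF that] by (simp add: rep chart_inv_map[OF dd])
      show "\<forall>i<chart_dim d. v i = 0" if "w \<in> W"
        "\<forall>a<n. (\<Sum>i<chart_dim d. partial_deriv i (\<lambda>u. F (chart_inv d u) a) (local_rep c d g w) * v i) = 0" for w v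
        using imm d that(2) WD[OF that(1)] unfolding immersive_def rep by blast
    qed
    then show "Ck_fun_nat r (chart_dim c) W (\<lambda>x. local_rep c d g x j)"
      by (rule Ck_fun_nat_mono) (rule q)
  qed
qed

section \<open>Products and tori\<close>

lemma continuous_map_Euc_iff:
  "continuous_map X (Euclidean_space n) f \<longleftrightarrow>
    f \<in> topspace X \<rightarrow> Euc n \<and> (\<forall>i<n. continuous_map X euclideanreal (\<lambda>x. f x i))"
proof
  assume "continuous_map X (Euclidean_space n) f"
  then show "f \<in> topspace X \<rightarrow> Euc n \<and> (\<forall>i<n. continuous_map X euclideanreal (\<lambda>x. f x i))"
    unfolding Euclidean_space_def by (auto simp: continuous_map_in_subtopology Euc_def continuous_map_componentwise_UNIV)
next
  assume r: "f \<in> topspace X \<rightarrow> Euc n \<and> (\<forall>i<n. continuous_map X euclideanreal (\<lambda>x. f x i))"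
  then have "continuous_map X (Euclidean_space n) (\<lambda>x i. if i < n then f x i else 0)"
    by (simp add: continuous_map_componentwise_Euclidean_space)
  moreover have "(\<lambda>i. if i < n then f x i else 0) = f x" if "x \<in> topspace X" for x
    using r that by (auto simp: in_Euc fun_eq_iff Pi_iff)
  ultimately show "continuous_map X (Euclidean_space n) f" by (rule continuous_map_eq)
qed

lemma continuous_map_Euc_coordinate: "continuous_map (Euclidean_space n) euclideanreal (\<lambda>x. x i)"
  by (simp add: Euclidean_space_top_of_set continuous_on_subset[OF continuous_on_product_coordinates])

text \<open>Landing in \<open>Euc m\<close> requires cutting off the tail, whereas for
  \<open>right_part\<close> the shift alone leads from \<open>Euc (m + n)\<close> to
  \<open>Euc n\<close>.\<close>

definition left_part :: "nat \<Rightarrow> (nat \<Rightarrow> real) \<Rightarrow> nat \<Rightarrow> real" where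
  "left_part m z i = (if i < m then z i else 0)"

definition right_part :: "nat \<Rightarrow> (nat \<Rightarrow> real) \<Rightarrow> nat \<Rightarrow> real" where
  "right_part m z i = z (m + i)"

lemma continuous_map_left_part: "continuous_map (Euclidean_space (m + n)) (Euclidean_space m) (left_part m)"
  unfolding continuous_map_Euc_iff by (auto simp: left_part_def in_Euc continuous_map_Euc_coordinate)

lemma continuous_map_right_part: "continuous_map (Euclidean_space (m + n)) (Euclidean_space n) (right_part m)"
  unfolding continuous_map_Euc_iff by (auto simp: right_part_def in_Euc continuous_map_Euc_coordinate)

lemma prod_chart_sel [simp]:
  "chart_dim (prod_chart c d) = chart_dim c + chart_dim d"
  "chart_dom (prod_chart c d) = chart_dom c \<times> chart_dom d"
  by (simp_all add: prod_chart_def)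

lemma prod_chart_parts:
  assumes "chart_of X c" "chart_of Y d" "x \<in> chart_dom c" "y \<in> chart_dom d"
  shows "left_part (chart_dim c) (chart_map (prod_chart c d) (x, y)) = chart_map c x"
    and "right_part (chart_dim c) (chart_map (prod_chart c d) (x, y)) = chart_map d y"
    and "chart_map (prod_chart c d) (x, y) \<in> Euc (chart_dim c + chart_dim d)"
proof -
  have "chart_map c x \<in> Euc (chart_dim c)" "chart_map d y \<in> Euc (chart_dim d)"
    using assms chart_of_img_subset by blast+
  then show "left_part (chart_dim c) (chart_map (prod_chart c d) (x, y)) = chart_map c x"
    "right_part (chart_dim c) (chart_map (prod_chart c d) (x, y)) = chart_map d y"
    "chart_map (prod_chart c d) (x, y) \<in> Euc (chart_dim c + chart_dim d)"
    by (auto simp: prod_chart_def left_part_def right_part_def in_Euc fun_eq_iff)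
qed

lemma prod_chart_img:
  assumes "chart_of X c" "chart_of Y d"
  shows "chart_img (prod_chart c d) = {z \<in> Euc (chart_dim c + chart_dim d).
    left_part (chart_dim c) z \<in> chart_img c \<and> right_part (chart_dim c) z \<in> chart_img d}" (is "_ = ?R")
proof (intro equalityI subsetI)
  fix z assume "z \<in> chart_img (prod_chart c d)"
  then show "z \<in> ?R" using prod_chart_parts[OF assms] by auto
next
  fix z assume z: "z \<in> ?R"
  then obtain x y where xy: "x \<in> chart_dom c" "y \<in> chart_dom d"
    "chart_map c x = left_part (chart_dim c) z" "chart_map d y = right_part (chart_dim c) z" by auto
  have "chart_map (prod_chart c d) (x, y) = z"
    unfolding prod_chart_def using xy by (auto simp: fun_eq_iff left_part_def right_part_def)
  then show "z \<in> chart_img (prod_chart c d)" using xy(1,2) by (intro image_eqI[of _ _ "(x, y)"]) auto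
qed

lemma chart_of_prod_chart:
  assumes c: "chart_of X c" and d: "chart_of Y d"
  shows "chart_of (prod_topology X Y) (prod_chart c d)"
proof (rule chart_ofI)
  let ?m = "chart_dim c" and ?n = "chart_dim d"
  let ?E = "Euclidean_space (?m + ?n)"
  let ?S = "subtopology (prod_topology X Y) (chart_dom c \<times> chart_dom d)"
  show "openin (prod_topology X Y) (chart_dom (prod_chart c d))"
    using chart_of_openin_dom[OF c] chart_of_openin_dom[OF d] by (simp add: openin_prod_Times_iff)
  have img: "chart_img (prod_chart c d) =
      {z \<in> topspace ?E. left_part ?m z \<in> chart_img c} \<inter> {z \<in> topspace ?E. right_part ?m z \<in> chart_img d}"
    unfolding prod_chart_img[OF c d] by auto
  have "openin ?E (chart_img (prod_chart c d))"
    unfolding img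
    by (intro openin_Int openin_continuous_map_preimage[OF continuous_map_left_part chart_of_openin_img[OF c]]
        openin_continuous_map_preimage[OF continuous_map_right_part chart_of_openin_img[OF d]])
  then show "openin (Euclidean_space (chart_dim (prod_chart c d))) (chart_img (prod_chart c d))"
    by (simp only: prod_chart_sel)
  have S: "?S = prod_topology (subtopology X (chart_dom c)) (subtopology Y (chart_dom d))"
    by (simp add: subtopology_Times)
  have tS: "topspace ?S = chart_dom c \<times> chart_dom d"
    using chart_of_dom_subset[OF c] chart_of_dom_subset[OF d] by auto
  have fc: "continuous_map ?S (Euclidean_space ?m) (\<lambda>p. chart_map c (fst p))"
    unfolding S using continuous_map_compose[OF continuous_map_fst chart_of_continuous[OF c]] by (simp add: o_def)
  have fd: "continuous_map ?S (Euclidean_space ?n) (\<lambda>p. chart_map d (snd p))"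
    unfolding S using continuous_map_compose[OF continuous_map_snd chart_of_continuous[OF d]] by (simp add: o_def)
  have "continuous_map ?S ?E (chart_map (prod_chart c d))"
    unfolding continuous_map_Euc_iff tS
  proof (intro conjI allI impI)
    show "chart_map (prod_chart c d) \<in> chart_dom c \<times> chart_dom d \<rightarrow> Euc (?m + ?n)"
      using prod_chart_parts(3)[OF c d] by auto
    fix i assume i: "i < ?m + ?n"
    show "continuous_map ?S euclideanreal (\<lambda>x. chart_map (prod_chart c d) x i)"
    proof (cases "i < ?m")
      case True
      then show ?thesis using fc by (simp add: prod_chart_def continuous_map_Euc_iff case_prod_beta)
    next
      case False
      then have "i - ?m < ?n" using i by simp
      then show ?thesis using fd False by (simp add: prod_chart_def continuous_map_Euc_iff case_prod_beta)
    qed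
  qed
  then show "continuous_map (subtopology (prod_topology X Y) (chart_dom (prod_chart c d)))
      (Euclidean_space (chart_dim (prod_chart c d))) (chart_map (prod_chart c d))" by simp
  let ?g = "\<lambda>z. (chart_inv c (left_part ?m z), chart_inv d (right_part ?m z))"
  let ?I = "subtopology ?E (chart_img (prod_chart c d))"
  have I: "left_part ?m \<in> topspace ?I \<rightarrow> chart_img c" "right_part ?m \<in> topspace ?I \<rightarrow> chart_img d"
    unfolding topspace_subtopology prod_chart_img[OF c d] by auto
  have "continuous_map ?I (subtopology (Euclidean_space ?m) (chart_img c)) (left_part ?m)"
    by (rule continuous_map_into_subtopology[OF continuous_map_from_subtopology[OF continuous_map_left_part] I(1)])
  moreover have "continuous_map ?I (subtopology (Euclidean_space ?n) (chart_img d)) (right_part ?m)"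
    by (rule continuous_map_into_subtopology[OF continuous_map_from_subtopology[OF continuous_map_right_part] I(2)])
  ultimately have "continuous_map ?I X (chart_inv c \<circ> left_part ?m)" "continuous_map ?I Y (chart_inv d \<circ> right_part ?m)"
    using continuous_map_compose[OF _ chart_of_inv_continuous[OF c]]
      continuous_map_compose[OF _ chart_of_inv_continuous[OF d]] by auto
  then have "continuous_map ?I (prod_topology X Y) ?g"
    by (simp add: continuous_map_pairwise o_def)
  then show "continuous_map (subtopology (Euclidean_space (chart_dim (prod_chart c d)))
      (chart_img (prod_chart c d))) (prod_topology X Y) ?g" by simp
  show "?g (chart_map (prod_chart c d) p) = p" if "p \<in> chart_dom (prod_chart c d)" for p
    using that prod_chart_parts[OF c d] by (auto simp: chart_inv_map[OF c] chart_inv_map[OF d])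
qed

lemma prod_chart_inv:
  assumes c: "chart_of X c" and d: "chart_of Y d" and z: "z \<in> chart_img (prod_chart c d)"
  shows "chart_inv (prod_chart c d) z =
    (chart_inv c (left_part (chart_dim c) z), chart_inv d (right_part (chart_dim c) z))"
proof -
  obtain x y where xy: "x \<in> chart_dom c" "y \<in> chart_dom d" "z = chart_map (prod_chart c d) (x, y)"
    using z by auto
  then have "chart_inv (prod_chart c d) z = (x, y)"
    using chart_inv_map[OF chart_of_prod_chart[OF c d], of "(x, y)"] by simp
  then show ?thesis using xy prod_chart_parts[OF c d xy(1,2)]
    by (simp add: chart_inv_map[OF c] chart_inv_map[OF d])
qed

lemma charted_prod_mfd:
  assumes M: "charted M" and N: "charted N"
  shows "charted (prod_mfd M N)"
  unfolding charted_def
proof (intro conjI ballI)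
  fix e assume "e \<in> mfd_atlas (prod_mfd M N)"
  then obtain c d where "e = prod_chart c d" "c \<in> mfd_atlas M" "d \<in> mfd_atlas N"
    by (auto simp: prod_mfd_def)
  then show "chart_of (mfd_top (prod_mfd M N)) e"
    using chart_of_prod_chart[OF chartedD[OF M] chartedD[OF N]] by (simp add: prod_mfd_def)
next
  have "points M = \<Union> (chart_dom ` mfd_atlas M)" "points N = \<Union> (chart_dom ` mfd_atlas N)"
    using M N by (auto simp: charted_def)
  then show "\<Union> (chart_dom ` mfd_atlas (prod_mfd M N)) = points (prod_mfd M N)"
    by (fastforce simp: prod_mfd_def)
qed

subsection \<open>The torus\<close>

lemma carrier_Euclidean_group [simp]: "carrier (Euclidean_group l) = Euc l"
  by (simp add: Euclidean_group_def)

lemma comm_group_Euclidean: "comm_group (Euclidean_group l)"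
proof (rule comm_groupI)
  show "\<exists>y\<in>carrier (Euclidean_group l). y \<otimes>\<^bsub>Euclidean_group l\<^esub> x = \<one>\<^bsub>Euclidean_group l\<^esub>"
    if "x \<in> carrier (Euclidean_group l)" for x
    using that by (intro bexI[of _ "\<lambda>i. - x i"]) (auto simp: Euclidean_group_def in_Euc)
qed (auto simp: Euclidean_group_def in_Euc fun_eq_iff)

lemma normal_integer_lattice: "integer_lattice l \<lhd> Euclidean_group l"
proof -
  interpret comm_group "Euclidean_group l" by (rule comm_group_Euclidean)
  have "subgroup (integer_lattice l) (Euclidean_group l)"
  proof (rule subgroupI)
    show "integer_lattice l \<subseteq> carrier (Euclidean_group l)" by (auto simp: integer_lattice_def)
    have z: "(\<lambda>_. 0) \<in> integer_lattice l" by (simp add: integer_lattice_def in_Euc)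
    then show "integer_lattice l \<noteq> {}" by blast
    show "inv\<^bsub>Euclidean_group l\<^esub> a \<in> integer_lattice l" if a: "a \<in> integer_lattice l" for a
    proof -
      have "inv\<^bsub>Euclidean_group l\<^esub> a = (\<lambda>i. - a i)"
        by (rule inv_equality) (use a in \<open>auto simp: Euclidean_group_def integer_lattice_def in_Euc\<close>)
      then show ?thesis using a by (simp add: integer_lattice_def in_Euc)
    qed
    show "a \<otimes>\<^bsub>Euclidean_group l\<^esub> b \<in> integer_lattice l"
      if "a \<in> integer_lattice l" "b \<in> integer_lattice l" for a b
      using that by (auto simp: Euclidean_group_def integer_lattice_def in_Euc)
  qed
  then show ?thesis by (rule subgroup_imp_normal)
qed

lemma group_torus: "group (torus_group l)"
  unfolding torus_group_def by (rule normal.factorgroup_is_group[OF normal_integer_lattice])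

lemma torus_proj_eq: "torus_proj l x = {y. \<exists>z\<in>integer_lattice l. y = (\<lambda>i. z i + x i)}"
  by (auto simp: torus_proj_def r_coset_def Euclidean_group_def)

lemma torus_proj_eq_iff:
  assumes "x \<in> Euc l" "y \<in> Euc l"
  shows "torus_proj l x = torus_proj l y \<longleftrightarrow> (\<forall>i<l. x i - y i \<in> \<int>)"
proof
  assume eq: "torus_proj l x = torus_proj l y"
  have "(\<lambda>_. 0) \<in> integer_lattice l" by (simp add: integer_lattice_def in_Euc)
  then have "x \<in> torus_proj l x" by (force simp: torus_proj_eq)
  then obtain z where "z \<in> integer_lattice l" "x = (\<lambda>i. z i + y i)" unfolding eq by (auto simp: torus_proj_eq)
  then show "\<forall>i<l. x i - y i \<in> \<int>" by (simp add: integer_lattice_def)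
next
  assume int: "\<forall>i<l. x i - y i \<in> \<int>"
  have d: "(\<lambda>i. x i - y i) \<in> integer_lattice l"
    unfolding integer_lattice_def using assms int by (auto simp: in_Euc) (metis Ints_0 diff_self not_less)
  have "(\<lambda>i. z i + (x i - y i)) \<in> integer_lattice l" "(\<lambda>i. z i - (x i - y i)) \<in> integer_lattice l"
    if "z \<in> integer_lattice l" for z
    using that d by (auto simp: integer_lattice_def in_Euc)
  then show "torus_proj l x = torus_proj l y"
    unfolding torus_proj_eq
  proof (intro equalityI subsetI)
    fix u assume H: "\<And>z. z \<in> integer_lattice l \<Longrightarrow> (\<lambda>i. z i + (x i - y i)) \<in> integer_lattice l"
      "\<And>z. z \<in> integer_lattice l \<Longrightarrow> (\<lambda>i. z i - (x i - y i)) \<in> integer_lattice l"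
    {
      assume "u \<in> {u. \<exists>z\<in>integer_lattice l. u = (\<lambda>i. z i + x i)}"
      then obtain z where "z \<in> integer_lattice l" "u = (\<lambda>i. z i + x i)" by blast
      then show "u \<in> {u. \<exists>z\<in>integer_lattice l. u = (\<lambda>i. z i + y i)}"
        using H(1)[of z] by (auto simp: fun_eq_iff intro!: bexI[of _ "\<lambda>i. z i + (x i - y i)"])
    next
      assume "u \<in> {u. \<exists>z\<in>integer_lattice l. u = (\<lambda>i. z i + y i)}"
      then obtain z where "z \<in> integer_lattice l" "u = (\<lambda>i. z i + y i)" by blast
      then show "u \<in> {u. \<exists>z\<in>integer_lattice l. u = (\<lambda>i. z i + x i)}"
        using H(2)[of z] by (auto simp: fun_eq_iff intro!: bexI[of _ "\<lambda>i. z i - (x i - y i)"])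
    }
  qed
qed

lemma carrier_torus: "carrier (torus_group l) = torus_proj l ` Euc l"
  by (auto simp: torus_group_def FactGroup_def RCOSETS_def torus_proj_def)

lemma torus_mult:
  assumes "x \<in> Euc l" "y \<in> Euc l"
  shows "torus_proj l x \<otimes>\<^bsub>torus_group l\<^esub> torus_proj l y = torus_proj l (\<lambda>i. x i + y i)"
  using normal.rcos_sum[OF normal_integer_lattice, of x l y] assms
  by (simp add: torus_group_def FactGroup_def torus_proj_def) (simp add: Euclidean_group_def)

lemma torus_one: "\<one>\<^bsub>torus_group l\<^esub> = torus_proj l (\<lambda>_. 0)"
  by (auto simp: torus_group_def FactGroup_def torus_proj_eq)

lemma topspace_torus [simp]: "topspace (torus_top l) = carrier (torus_group l)"
proof -
  have "{x \<in> topspace (Euclidean_space l). torus_proj l x \<in> carrier (torus_group l)} = topspace (Euclidean_space l)"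
    by (auto simp: carrier_torus)
  then have "openin (torus_top l) (carrier (torus_group l))"
    by (simp only: openin_torus_top order_refl openin_topspace simp_thms)
  then show ?thesis
    by (metis openin_subset openin_topspace openin_torus_top subset_antisym)
qed

lemma quotient_map_torus_proj: "quotient_map (Euclidean_space l) (torus_top l) (torus_proj l)"
  unfolding quotient_map_def by (auto simp: openin_torus_top carrier_torus)

text \<open>The preimage of the image of \<open>W\<close> is the union of the translates of
  \<open>W\<close> by lattice vectors.\<close>

lemma open_map_torus_proj:
  assumes W: "openin (Euclidean_space l) W"
  shows "openin (torus_top l) (torus_proj l ` W)"
  unfolding openin_torus_top
proof
  have WE: "W \<subseteq> Euc l" using W by (rule openin_Euc_subset)
  then show "torus_proj l ` W \<subseteq> carrier (torus_group l)" by (auto simp: carrier_torus)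
  let ?T = "\<lambda>z. {x \<in> topspace (Euclidean_space l). (\<lambda>i. x i - z i) \<in> W}"
  have "{x \<in> topspace (Euclidean_space l). torus_proj l x \<in> torus_proj l ` W} = (\<Union>z\<in>integer_lattice l. ?T z)"
  proof (intro equalityI subsetI)
    fix x assume "x \<in> {x \<in> topspace (Euclidean_space l). torus_proj l x \<in> torus_proj l ` W}"
    then obtain w where x: "x \<in> Euc l" and w: "w \<in> W" "torus_proj l x = torus_proj l w" by auto
    then have "(\<lambda>i. x i - w i) \<in> integer_lattice l"
      using WE torus_proj_eq_iff[of x l w] unfolding integer_lattice_def
      by (auto simp: in_Euc) (metis Ints_0 diff_self in_Euc not_less subsetD)
    then show "x \<in> (\<Union>z\<in>integer_lattice l. ?T z)"
      using x w by (intro UN_I[of "\<lambda>i. x i - w i"]) auto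
  next
    fix x assume "x \<in> (\<Union>z\<in>integer_lattice l. ?T z)"
    then obtain z where z: "z \<in> integer_lattice l" "x \<in> Euc l" "(\<lambda>i. x i - z i) \<in> W" by auto
    have "torus_proj l x = torus_proj l (\<lambda>i. x i - z i)"
      using z WE by (subst torus_proj_eq_iff) (auto simp: integer_lattice_def)
    then show "x \<in> {x \<in> topspace (Euclidean_space l). torus_proj l x \<in> torus_proj l ` W}"
      using z by auto
  qed
  moreover have "openin (Euclidean_space l) (?T z)" if "z \<in> integer_lattice l" for z
    by (rule openin_continuous_map_preimage[OF _ W])
      (use that in \<open>auto intro!: continuous_map_Euclidean_space_diff simp: integer_lattice_def\<close>)
  ultimately show "openin (Euclidean_space l) {x \<in> topspace (Euclidean_space l). torus_proj l x \<in> torus_proj l ` W}"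
    by (simp only:) blast
qed

text \<open>Coordinates in a torus chart are thus representatives modulo the lattice, and a formula
  in representatives is already a formula in charts.\<close>

lemma torus_chart:
  fixes l V
  defines "c \<equiv> \<lparr>chart_dim = l, chart_dom = torus_proj l ` V, chart_map = inv_into V (torus_proj l)\<rparr>"
  assumes V: "openin (Euclidean_space l) V" and inj: "inj_on (torus_proj l) V"
  shows torus_chart_of: "chart_of (torus_top l) c"
    and torus_chart_img: "chart_img c = V"
    and torus_chart_inv: "u \<in> V \<Longrightarrow> chart_inv c u = torus_proj l u"
proof -
  have VE: "V \<subseteq> Euc l" using V by (rule openin_Euc_subset)
  show img: "chart_img c = V"
    using inj by (simp add: c_def image_image inv_into_f_f cong: image_cong)
  have quot: "continuous_map (Euclidean_space l) (torus_top l) (torus_proj l)"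
    using quotient_map_torus_proj quotient_imp_continuous_map by blast
  show c: "chart_of (torus_top l) c"
  proof (rule chart_ofI)
    show dom: "openin (torus_top l) (chart_dom c)" unfolding c_def using open_map_torus_proj[OF V] by simp
    show "openin (Euclidean_space (chart_dim c)) (chart_img c)" unfolding img using V by (simp add: c_def)
    show "continuous_map (subtopology (Euclidean_space (chart_dim c)) (chart_img c)) (torus_top l) (torus_proj l)"
      by (rule continuous_map_from_subtopology) (simp add: c_def quot)
    show "torus_proj l (chart_map c x) = x" if "x \<in> chart_dom c" for x
      using that by (simp add: c_def f_inv_into_f)
    have sub: "topspace (subtopology (torus_top l) (chart_dom c)) = chart_dom c"
      using openin_subset[OF dom] by auto
    show "continuous_map (subtopology (torus_top l) (chart_dom c)) (Euclidean_space (chart_dim c)) (chart_map c)"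
      unfolding continuous_map_def sub
    proof (intro conjI allI impI)
      show "chart_map c \<in> chart_dom c \<rightarrow> topspace (Euclidean_space (chart_dim c))"
        using img VE by (auto simp: c_def)
      fix U assume U: "openin (Euclidean_space (chart_dim c)) U"
      have "{x \<in> chart_dom c. chart_map c x \<in> U} = torus_proj l ` (V \<inter> U)"
        using inj by (auto simp: c_def inv_into_f_f)
      moreover have "openin (torus_top l) (torus_proj l ` (V \<inter> U))"
        using open_map_torus_proj V U by (simp add: c_def openin_Int)
      ultimately show "openin (subtopology (torus_top l) (chart_dom c)) {x \<in> chart_dom c. chart_map c x \<in> U}"
        using dom by (auto simp: openin_open_subtopology)
    qed
  qed
  show "chart_inv c u = torus_proj l u" if "u \<in> V" for u
  proof -
    have "chart_map c (torus_proj l u) = u" using that inj by (simp add: c_def inv_into_f_f)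
    moreover have "torus_proj l u \<in> chart_dom c" using that by (simp add: c_def)
    ultimately show ?thesis using chart_inv_map[OF c] by metis
  qed
qed

text \<open>Two points of the box differ by less than 1/2 in each coordinate, while points with the
  same projection differ by integers.\<close>

lemma torus_proj_inj_on_small_box:
  "inj_on (torus_proj l) {y \<in> Euc l. \<forall>i<l. \<bar>y i - x i\<bar> < 1 / 4}"
proof (rule inj_onI)
  fix y z assume y: "y \<in> {y \<in> Euc l. \<forall>i<l. \<bar>y i - x i\<bar> < 1 / 4}" and z: "z \<in> {y \<in> Euc l. \<forall>i<l. \<bar>y i - x i\<bar> < 1 / 4}"
    and eq: "torus_proj l y = torus_proj l z"
  have "y i = z i" for i
  proof (cases "i < l")
    case True
    have "y i - z i \<in> \<int>" using eq y z True torus_proj_eq_iff by blast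
    moreover have "\<bar>y i - x i\<bar> < 1 / 4" "\<bar>z i - x i\<bar> < 1 / 4" using y z True by auto
    then have "\<bar>y i - z i\<bar> < 1" by linarith
    ultimately show ?thesis using Ints_nonzero_abs_less1 by fastforce
  next
    case False then show ?thesis using y z by (auto simp: in_Euc)
  qed
  then show "y = z" by (rule ext)
qed

lemma charted_torus: "charted (torus_mfd l)"
  unfolding charted_def
proof (intro conjI ballI)
  fix c assume "c \<in> mfd_atlas (torus_mfd l)"
  then show "chart_of (mfd_top (torus_mfd l)) c" by (auto simp: torus_mfd_def torus_chart_of)
next
  have "\<exists>V. openin (Euclidean_space l) V \<and> inj_on (torus_proj l) V \<and> x \<in> V" if "x \<in> Euc l" for x
    using that openin_Euc_box[of l x "1/4"] torus_proj_inj_on_small_box[of l x]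
    by (intro exI[of _ "{y \<in> Euc l. \<forall>i<l. \<bar>y i - x i\<bar> < 1 / 4}"]) auto
  then have "carrier (torus_group l) \<subseteq> \<Union> (chart_dom ` mfd_atlas (torus_mfd l))"
    by (fastforce simp: carrier_torus torus_mfd_def)
  moreover have "\<Union> (chart_dom ` mfd_atlas (torus_mfd l)) \<subseteq> carrier (torus_group l)"
    using openin_Euc_subset by (fastforce simp: carrier_torus torus_mfd_def)
  ultimately show "\<Union> (chart_dom ` mfd_atlas (torus_mfd l)) = points (torus_mfd l)"
    by (simp add: torus_mfd_def)
qed

section \<open>From a linearizing embedding to a torus action\<close>

subsection \<open>The generator of the matrix exponential\<close>

lemma pow_smult_mat:
  fixes B :: "'a::comm_semiring_1 mat"
  assumes "B \<in> carrier_mat n n"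
  shows "(t \<cdot>\<^sub>m B) ^\<^sub>m r = t ^ r \<cdot>\<^sub>m (B ^\<^sub>m r)"
proof (induction r)
  case 0 show ?case using assms by (intro eq_matI) auto
next
  case (Suc r)
  have p: "B ^\<^sub>m r \<in> carrier_mat n n" using assms by (rule pow_carrier_mat)
  have "(t \<cdot>\<^sub>m B) ^\<^sub>m Suc r = (t ^ r \<cdot>\<^sub>m (B ^\<^sub>m r)) * (t \<cdot>\<^sub>m B)" by (simp add: Suc)
  also have "\<dots> = t \<cdot>\<^sub>m (t ^ r \<cdot>\<^sub>m (B ^\<^sub>m r * B))"
    using p assms by (simp add: mult_smult_distrib[of _ n n _ n] mult_smult_assoc_mat[of _ n n _ n])
  also have "\<dots> = t ^ Suc r \<cdot>\<^sub>m (B ^\<^sub>m Suc r)"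
    using p assms by (intro eq_matI) (auto simp: mult.assoc)
  finally show ?case .
qed

text \<open>The sum of the absolute values of all entries is a submultiplicative norm; its powers
  dominate the exponential series entry by entry.\<close>

lemma pow_mat_entry_bound:
  fixes B :: "real mat"
  assumes B: "B \<in> carrier_mat n n" and "i < n" "j < n"
  shows "\<bar>(B ^\<^sub>m r) $$ (i, j)\<bar> \<le> (\<Sum>k<n. \<Sum>l<n. \<bar>B $$ (k, l)\<bar>) ^ r"
  using assms(2,3)
proof (induction r arbitrary: i j)
  case 0 then show ?case using B by simp
next
  case (Suc r)
  let ?b = "\<Sum>k<n. \<Sum>l<n. \<bar>B $$ (k, l)\<bar>"
  have b: "0 \<le> ?b" by (intro sum_nonneg) auto
  have p: "B ^\<^sub>m r \<in> carrier_mat n n" using B by (rule pow_carrier_mat)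
  have "(B ^\<^sub>m Suc r) $$ (i, j) = (\<Sum>k<n. (B ^\<^sub>m r) $$ (i, k) * B $$ (k, j))"
    using p B Suc.prems by (simp add: scalar_prod_def atLeast0LessThan)
  also have "\<bar>\<dots>\<bar> \<le> (\<Sum>k<n. \<bar>(B ^\<^sub>m r) $$ (i, k) * B $$ (k, j)\<bar>)" by (rule sum_abs)
  also have "\<dots> \<le> (\<Sum>k<n. ?b ^ r * \<bar>B $$ (k, j)\<bar>)"
    using Suc by (intro sum_mono) (auto simp: abs_mult intro!: mult_right_mono)
  also have "\<dots> = ?b ^ r * (\<Sum>k<n. \<bar>B $$ (k, j)\<bar>)" by (simp add: sum_distrib_left)
  also have "\<dots> \<le> ?b ^ r * ?b"
  proof (rule mult_left_mono)
    show "(\<Sum>k<n. \<bar>B $$ (k, j)\<bar>) \<le> ?b"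
      using Suc.prems by (intro sum_mono member_le_sum[of j "{..<n}" "\<lambda>l. \<bar>B $$ (k, l)\<bar>" for k]) auto
  qed (use b in simp)
  finally show ?case by (simp only: power_Suc mult.commute)
qed

lemma mat_exp_entry:
  fixes B :: "real mat"
  assumes B: "B \<in> carrier_mat n n" and ij: "i < n" "j < n"
  shows "mat_exp (t \<cdot>\<^sub>m B) $$ (i, j) = (\<Sum>r. (B ^\<^sub>m r) $$ (i, j) / fact r * t ^ r)"
proof -
  have "((t \<cdot>\<^sub>m B) ^\<^sub>m r) $$ (i, j) = t ^ r * (B ^\<^sub>m r) $$ (i, j)" for r
    using carrier_matD[OF pow_carrier_mat[OF B, of r]] ij by (simp add: pow_smult_mat[OF B])
  then show ?thesis using B ij by (simp add: mat_exp_def mult.commute)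
qed

lemma summable_mat_exp_entry:
  fixes B :: "real mat"
  assumes B: "B \<in> carrier_mat n n" and ij: "i < n" "j < n"
  shows "summable (\<lambda>r. (B ^\<^sub>m r) $$ (i, j) / fact r * t ^ r)"
proof (rule summable_comparison_test)
  let ?b = "\<Sum>k<n. \<Sum>l<n. \<bar>B $$ (k, l)\<bar>"
  have "norm ((B ^\<^sub>m r) $$ (i, j) / fact r * t ^ r) \<le> inverse (fact r) * (?b * \<bar>t\<bar>) ^ r" for r
  proof -
    have "norm ((B ^\<^sub>m r) $$ (i, j) / fact r * t ^ r) = inverse (fact r) * (\<bar>(B ^\<^sub>m r) $$ (i, j)\<bar> * \<bar>t\<bar> ^ r)"
      by (simp add: abs_mult power_abs divide_inverse)
    also have "\<dots> \<le> inverse (fact r) * (?b ^ r * \<bar>t\<bar> ^ r)"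
      by (intro mult_left_mono mult_right_mono pow_mat_entry_bound[OF B ij]) auto
    finally show ?thesis by (simp add: power_mult_distrib)
  qed
  then show "\<exists>N. \<forall>r\<ge>N. norm ((B ^\<^sub>m r) $$ (i, j) / fact r * t ^ r) \<le> inverse (fact r) * (?b * \<bar>t\<bar>) ^ r" by blast
  show "summable (\<lambda>r. inverse (fact r) * (?b * \<bar>t\<bar>) ^ r)" by (rule summable_exp)
qed

text \<open>The flow property moves the derivative from time 0 to every other time, so the matrix
  exponential is differentiated only here.\<close>

lemma mat_exp_derivative_at_0:
  fixes B :: "real mat"
  assumes B: "B \<in> carrier_mat n n" and ij: "i < n" "j < n"
  shows "((\<lambda>t. mat_exp (t \<cdot>\<^sub>m B) $$ (i, j)) has_real_derivative B $$ (i, j)) (at 0)"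
proof -
  define c where "c r = (B ^\<^sub>m r) $$ (i, j) / fact r" for r
  have "((\<lambda>t. \<Sum>r. c r * t ^ r) has_real_derivative (\<Sum>r. diffs c r * 0 ^ r)) (at 0)"
    unfolding c_def by (rule termdiffs_strong_converges_everywhere[OF summable_mat_exp_entry[OF B ij]])
  moreover have "(\<Sum>r. diffs c r * 0 ^ r) = B $$ (i, j)"
    using B ij by (simp only: powser_zero) (simp add: diffs_def c_def)
  ultimately show ?thesis by (simp add: mat_exp_entry[OF B ij] c_def)
qed

subsection \<open>Bounded solutions of linear differential equations\<close>

definition flow_eigen :: "(real \<Rightarrow> 'a \<Rightarrow> 'a) \<Rightarrow> 'a set \<Rightarrow> real \<Rightarrow> ('a \<Rightarrow> complex) \<Rightarrow> bool" where
  "flow_eigen \<Phi> S \<mu> f \<longleftrightarrow> (\<forall>x\<in>S. \<forall>t. f (\<Phi> t x) = cis (\<mu> * t) * f x)"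

lemma bounded_affine_imp_const:
  fixes a b :: complex
  assumes "\<And>t::real. norm (a + of_real t * b) \<le> K"
  shows "b = 0"
proof (rule ccontr)
  assume "b \<noteq> 0"
  \<comment> \<open>Chosen so that the linear term has norm \<open>K + norm a + 1\<close>, more than
    the bound allows.\<close>
  define t where "t = (K + norm a + 1) / norm b"
  have "norm a \<le> K" using assms[of 0] by simp
  then have K: "0 \<le> K" by (rule order_trans[OF norm_ge_zero])
  have "norm (of_real t * b) = K + norm a + 1"
  proof -
    have "0 \<le> t" using K by (simp add: t_def)
    then have "norm (of_real t * b) = t * norm b" by (simp only: norm_mult norm_of_real abs_of_nonneg)
    then show ?thesis using \<open>b \<noteq> 0\<close> by (simp add: t_def)
  qed
  moreover have "norm (of_real t * b) \<le> norm (a + of_real t * b) + norm a"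
    by (metis add_diff_cancel_left' norm_triangle_ineq4)
  ultimately show False using assms[of t] by linarith
qed

lemma bounded_exp_imp_zero:
  fixes a \<nu> :: complex
  assumes "\<And>t::real. norm (exp (\<nu> * of_real t) * a) \<le> K" "Re \<nu> \<noteq> 0"
  shows "a = 0"
proof (rule ccontr)
  assume "a \<noteq> 0"
  \<comment> \<open>At this time the exponent has real part s = \<open>K / norm a\<close>, and the
    bound would give exp s \<le> s.\<close>
  define t where "t = (K / norm a) / Re \<nu>"
  have "exp (K / norm a) * norm a \<le> K"
    using assms(1)[of t] assms(2) by (simp add: norm_mult t_def)
  then have "exp (K / norm a) \<le> K / norm a"
    using \<open>a \<noteq> 0\<close> by (simp add: pos_le_divide_eq)
  then show False using exp_ge_add_one_self[of "K / norm a"] by linarith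
qed

text \<open>\<open>V\<close> will be the complex span of the components of the linearizing map.
  Boundedness, which comes from compactness, is what excludes growth, decay and polynomial factors
  in time.\<close>

locale bounded_flow_space =
  fixes \<Phi> :: "real \<Rightarrow> 'a \<Rightarrow> 'a" and S :: "'a set" and V :: "('a \<Rightarrow> complex) set"
  assumes flow_in: "x \<in> S \<Longrightarrow> \<Phi> t x \<in> S" and flow_zero: "x \<in> S \<Longrightarrow> \<Phi> 0 x = x"
    and V_add: "f \<in> V \<Longrightarrow> g \<in> V \<Longrightarrow> (\<lambda>x. f x + g x) \<in> V"
    and V_scale: "f \<in> V \<Longrightarrow> (\<lambda>x. c * f x) \<in> V"
    and V_zero: "(\<lambda>_. 0) \<in> V"
    and V_bounded: "f \<in> V \<Longrightarrow> \<exists>K. \<forall>x\<in>S. norm (f x) \<le> K"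
begin

text \<open>The family \<open>u\<close> is indexed by all reals, the zero function being an
  eigenfunction for every frequency; this lets sums over different sets be merged.\<close>

definition eigen_sum :: "('a \<Rightarrow> complex) \<Rightarrow> bool" where
  "eigen_sum f \<longleftrightarrow> (\<exists>M u. finite M \<and> (\<forall>\<mu>. u \<mu> \<in> V \<and> flow_eigen \<Phi> S \<mu> (u \<mu>)) \<and>
     (\<forall>x\<in>S. f x = (\<Sum>\<mu>\<in>M. u \<mu> x)))"

lemma V_sum: "(\<And>i. i \<in> I \<Longrightarrow> f i \<in> V) \<Longrightarrow> (\<lambda>x. \<Sum>i\<in>I. f i x) \<in> V"
  by (induction I rule: infinite_finite_induct) (auto intro: V_zero V_add)

lemma eigen_sum_zero: "eigen_sum (\<lambda>_. 0)"
  unfolding eigen_sum_def by (intro exI[of _ "{}"] exI[of _ "\<lambda>_ _. 0"]) (auto simp: V_zero flow_eigen_def)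

lemma eigen_sum_eigen:
  assumes "f \<in> V" "flow_eigen \<Phi> S \<mu> f"
  shows "eigen_sum f"
  unfolding eigen_sum_def
  by (intro exI[of _ "{\<mu>}"] exI[of _ "\<lambda>\<kappa>. if \<kappa> = \<mu> then f else (\<lambda>_. 0)"])
    (use assms V_zero in \<open>auto simp: flow_eigen_def\<close>)

lemma eigen_sum_add:
  assumes "eigen_sum f" "eigen_sum g"
  shows "eigen_sum (\<lambda>x. f x + g x)"
proof -
  obtain M u where u: "finite M" "\<And>\<mu>. u \<mu> \<in> V" "\<And>\<mu>. flow_eigen \<Phi> S \<mu> (u \<mu>)" "\<And>x. x \<in> S \<Longrightarrow> f x = (\<Sum>\<mu>\<in>M. u \<mu> x)"
    using assms(1) unfolding eigen_sum_def by blast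
  obtain N v where v: "finite N" "\<And>\<mu>. v \<mu> \<in> V" "\<And>\<mu>. flow_eigen \<Phi> S \<mu> (v \<mu>)" "\<And>x. x \<in> S \<Longrightarrow> g x = (\<Sum>\<mu>\<in>N. v \<mu> x)"
    using assms(2) unfolding eigen_sum_def by blast
  define u' where "u' \<mu> = (if \<mu> \<in> M then u \<mu> else (\<lambda>_. 0))" for \<mu>
  define v' where "v' \<mu> = (if \<mu> \<in> N then v \<mu> else (\<lambda>_. 0))" for \<mu>
  have s: "(\<Sum>\<mu>\<in>M. u \<mu> x) = (\<Sum>\<mu>\<in>M \<union> N. u' \<mu> x)" "(\<Sum>\<mu>\<in>N. v \<mu> x) = (\<Sum>\<mu>\<in>M \<union> N. v' \<mu> x)" for x
    by (rule sum.mono_neutral_cong_left; use u(1) v(1) in \<open>auto simp: u'_def v'_def\<close>)+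
  have V: "u' \<mu> \<in> V" "v' \<mu> \<in> V" and e: "flow_eigen \<Phi> S \<mu> (u' \<mu>)" "flow_eigen \<Phi> S \<mu> (v' \<mu>)" for \<mu>
    using u(2,3) v(2,3) V_zero by (auto simp: u'_def v'_def flow_eigen_def)
  show ?thesis
    unfolding eigen_sum_def
  proof (intro exI[of _ "M \<union> N"] exI[of _ "\<lambda>\<mu> x. u' \<mu> x + v' \<mu> x"] conjI allI ballI)
    show "(\<lambda>x. u' \<mu> x + v' \<mu> x) \<in> V" for \<mu> using V V_add by blast
    show "flow_eigen \<Phi> S \<mu> (\<lambda>x. u' \<mu> x + v' \<mu> x)" for \<mu>
      using e[of \<mu>] by (simp add: flow_eigen_def distrib_left)
    show "f x + g x = (\<Sum>\<mu>\<in>M \<union> N. u' \<mu> x + v' \<mu> x)" if "x \<in> S" for x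
      using that by (simp add: u(4) v(4) s sum.distrib)
  qed (use u v in auto)
qed

lemma eigen_sum_scale:
  assumes "eigen_sum f"
  shows "eigen_sum (\<lambda>x. c * f x)"
proof -
  obtain M u where u: "finite M" "\<And>\<mu>. u \<mu> \<in> V" "\<And>\<mu>. flow_eigen \<Phi> S \<mu> (u \<mu>)" "\<And>x. x \<in> S \<Longrightarrow> f x = (\<Sum>\<mu>\<in>M. u \<mu> x)"
    using assms unfolding eigen_sum_def by blast
  show ?thesis
    unfolding eigen_sum_def
  proof (intro exI[of _ M] exI[of _ "\<lambda>\<mu> x. c * u \<mu> x"] conjI allI ballI)
    show "flow_eigen \<Phi> S \<mu> (\<lambda>x. c * u \<mu> x)" for \<mu>
      using u(3)[of \<mu>] by (simp add: flow_eigen_def)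
  qed (use u V_scale in \<open>auto simp: sum_distrib_left\<close>)
qed

lemma eigen_sum_sum: "(\<And>i. i \<in> I \<Longrightarrow> eigen_sum (f i)) \<Longrightarrow> eigen_sum (\<lambda>x. \<Sum>i\<in>I. f i x)"
  by (induction I rule: infinite_finite_induct) (auto intro: eigen_sum_zero eigen_sum_add)

lemma eigen_derivative:
  assumes "flow_eigen \<Phi> S \<mu> f" "x \<in> S"
  shows "((\<lambda>t. f (\<Phi> t x)) has_vector_derivative \<i> * of_real \<mu> * f (\<Phi> t x)) (at t)"
proof -
  have eq: "f (\<Phi> t x) = exp (\<i> * of_real \<mu> * of_real t) * f x" for t
    using assms by (simp add: flow_eigen_def cis_conv_exp mult.assoc)
  have "((\<lambda>z. exp (\<i> * of_real \<mu> * z) * f x) has_field_derivative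
      \<i> * of_real \<mu> * (exp (\<i> * of_real \<mu> * of_real t) * f x)) (at (of_real t))"
    by (auto intro!: derivative_eq_intros)
  from has_vector_derivative_real_field[OF this] show ?thesis by (simp only: eq)
qed

text \<open>The forcing \<open>w\<close> has the same exponent as the homogeneous equation, so the
  solution is exp(\<nu> t) (H x + t w x). If \<nu> is imaginary, boundedness kills the secular term
  t w x; otherwise \<open>w\<close> is zero by assumption and boundedness kills
  \<open>H x\<close>.\<close>

lemma resonant_solution:
  assumes H: "H \<in> V" and w: "\<And>x t. x \<in> S \<Longrightarrow> w (\<Phi> t x) = exp (\<nu> * of_real t) * w x"
    and wz: "Re \<nu> \<noteq> 0 \<Longrightarrow> \<forall>x\<in>S. w x = 0"
    and ode: "\<And>x t. x \<in> S \<Longrightarrow>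
      ((\<lambda>t. H (\<Phi> t x)) has_vector_derivative \<nu> * H (\<Phi> t x) + w (\<Phi> t x)) (at t)"
  shows "flow_eigen \<Phi> S (Im \<nu>) H"
  unfolding flow_eigen_def
proof (intro ballI allI)
  fix x t assume x: "x \<in> S"
  define h where "h t = exp (- \<nu> * of_real t) * H (\<Phi> t x) - of_real t * w x" for t :: real
  have "(h has_vector_derivative 0) (at t)" for t
  proof -
    have "((\<lambda>z. exp (- \<nu> * z)) has_field_derivative - \<nu> * exp (- \<nu> * of_real t)) (at (of_real t))"
      by (auto intro!: derivative_eq_intros)
    from has_vector_derivative_mult[OF has_vector_derivative_real_field[OF this] ode[OF x]]
    have "((\<lambda>t. exp (- \<nu> * of_real t) * H (\<Phi> t x)) has_vector_derivative
        exp (- \<nu> * of_real t) * w (\<Phi> t x)) (at t)"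
      by (simp add: algebra_simps)
    moreover have "exp (- \<nu> * of_real t) * w (\<Phi> t x) = w x"
      by (simp add: w[OF x] mult.assoc[symmetric] exp_add[symmetric])
    moreover have "((\<lambda>t. of_real t * w x) has_vector_derivative w x) (at t)"
      by (auto intro!: derivative_eq_intros)
    ultimately show ?thesis unfolding h_def using has_vector_derivative_diff by fastforce
  qed
  then obtain c where "\<And>t. h t = c"
    using has_vector_derivative_zero_constant[OF convex_UNIV, of h] by auto
  then have "h t = h 0" for t by simp
  then have sol: "H (\<Phi> t x) = exp (\<nu> * of_real t) * (H x + of_real t * w x)" for t
  proof -
    assume "\<And>t. h t = h 0"
    then have "exp (- \<nu> * of_real t) * H (\<Phi> t x) = H x + of_real t * w x"
      by (simp add: h_def flow_zero[OF x] algebra_simps)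
    then have "exp (\<nu> * of_real t) * (exp (- \<nu> * of_real t) * H (\<Phi> t x)) = exp (\<nu> * of_real t) * (H x + of_real t * w x)"
      by simp
    then show ?thesis by (simp add: mult.assoc[symmetric] exp_add[symmetric])
  qed
  obtain K where K: "\<And>y. y \<in> S \<Longrightarrow> norm (H y) \<le> K" using V_bounded[OF H] by blast
  have bound: "norm (exp (\<nu> * of_real t) * (H x + of_real t * w x)) \<le> K" for t
    using K[OF flow_in[OF x]] by (simp add: sol)
  show "H (\<Phi> t x) = cis (Im \<nu> * t) * H x"
  proof (cases "Re \<nu> = 0")
    case True
    have "norm (H x + of_real t * w x) \<le> K" for t
      using bound[of t] True by (simp add: norm_mult)
    then have "w x = 0" by (rule bounded_affine_imp_const)
    moreover have "\<nu> = \<i> * of_real (Im \<nu>)" using True by (simp add: complex_eq_iff)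
    then have "exp (\<nu> * of_real t) = cis (Im \<nu> * t)"
      by (metis cis_conv_exp mult.assoc of_real_mult)
    ultimately show ?thesis by (simp add: sol)
  next
    case False
    then have "w x = 0" using wz x by blast
    moreover have "H x = 0"
      by (rule bounded_exp_imp_zero[OF _ False, of _ K]) (use bound \<open>w x = 0\<close> in simp)
    ultimately show ?thesis by (simp add: sol)
  qed
qed

text \<open>The modes of \<open>r\<close> for which i \<mu> differs from \<nu> are absorbed by the
  particular solution \<open>P\<close>, whose denominators are then nonzero. What remains is the
  resonant equation for \<open>H\<close>, the difference of \<open>G\<close> and
  \<open>P\<close>.\<close>

lemma eigen_sum_step:
  assumes G: "G \<in> V" and r: "eigen_sum r"
    and ode: "\<And>x t. x \<in> S \<Longrightarrow>
      ((\<lambda>t. G (\<Phi> t x)) has_vector_derivative \<nu> * G (\<Phi> t x) + r (\<Phi> t x)) (at t)"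
  shows "eigen_sum G"
proof -
  obtain M u where M: "finite M" and uV: "\<And>\<mu>. u \<mu> \<in> V" and ue: "\<And>\<mu>. flow_eigen \<Phi> S \<mu> (u \<mu>)"
    and rs: "\<And>x. x \<in> S \<Longrightarrow> r x = (\<Sum>\<mu>\<in>M. u \<mu> x)"
    using r unfolding eigen_sum_def by blast
  define N where "N = {\<mu> \<in> M. \<i> * of_real \<mu> \<noteq> \<nu>}"
  define w where "w x = (\<Sum>\<mu>\<in>M - N. u \<mu> x)" for x
  define P where "P x = (\<Sum>\<mu>\<in>N. 1 / (\<i> * of_real \<mu> - \<nu>) * u \<mu> x)" for x
  have NM: "N \<subseteq> M" by (auto simp: N_def)
  have PV: "P \<in> V" unfolding P_def by (intro V_sum V_scale uV)
  define H where "H x = G x + (- 1) * P x" for x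
  have HV: "H \<in> V" unfolding H_def by (intro V_add V_scale G PV)
  have "flow_eigen \<Phi> S (Im \<nu>) H"
  proof (rule resonant_solution[OF HV, where w = w])
    fix x t assume x: "x \<in> S"
    have "u \<mu> (\<Phi> t x) = exp (\<nu> * of_real t) * u \<mu> x" if "\<mu> \<in> M - N" for \<mu>
    proof -
      have "\<nu> = \<i> * of_real \<mu>" using that by (auto simp: N_def)
      then show ?thesis using ue[of \<mu>] x by (simp add: flow_eigen_def cis_conv_exp mult.assoc)
    qed
    then show "w (\<Phi> t x) = exp (\<nu> * of_real t) * w x"
      unfolding w_def sum_distrib_left by (intro sum.cong) auto
  next
    assume "Re \<nu> \<noteq> 0"
    then have "M - N = {}" by (auto simp: N_def)
    then have "w = (\<lambda>_. 0)" unfolding w_def by (simp only: sum.empty)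
    then show "\<forall>x\<in>S. w x = 0" by simp
  next
    fix x t assume x: "x \<in> S"
    let ?y = "\<Phi> t x"
    have dP: "((\<lambda>t. P (\<Phi> t x)) has_vector_derivative
        (\<Sum>\<mu>\<in>N. 1 / (\<i> * of_real \<mu> - \<nu>) * (\<i> * of_real \<mu> * u \<mu> ?y))) (at t)"
      unfolding P_def
      by (intro has_vector_derivative_sum has_vector_derivative_mult_right eigen_derivative[OF ue x])
    have "(\<Sum>\<mu>\<in>N. 1 / (\<i> * of_real \<mu> - \<nu>) * (\<i> * of_real \<mu> * u \<mu> ?y)) =
        (\<Sum>\<mu>\<in>N. u \<mu> ?y + \<nu> * (1 / (\<i> * of_real \<mu> - \<nu>) * u \<mu> ?y))"
      by (intro sum.cong) (auto simp: N_def field_simps)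
    also have "\<dots> = (\<Sum>\<mu>\<in>N. u \<mu> ?y) + \<nu> * P ?y"
      by (simp add: sum.distrib P_def sum_distrib_left)
    finally have eq: "(\<Sum>\<mu>\<in>N. 1 / (\<i> * of_real \<mu> - \<nu>) * (\<i> * of_real \<mu> * u \<mu> ?y)) =
        (\<Sum>\<mu>\<in>N. u \<mu> ?y) + \<nu> * P ?y" .
    have "((\<lambda>t. H (\<Phi> t x)) has_vector_derivative
        \<nu> * G ?y + r ?y - ((\<Sum>\<mu>\<in>N. u \<mu> ?y) + \<nu> * P ?y)) (at t)"
      using has_vector_derivative_diff[OF ode[OF x] dP] unfolding eq by (simp add: H_def)
    moreover have "r ?y = (\<Sum>\<mu>\<in>N. u \<mu> ?y) + w ?y"
      using rs[OF flow_in[OF x]] M NM by (simp add: w_def sum.subset_diff[of N M])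
    ultimately show "((\<lambda>t. H (\<Phi> t x)) has_vector_derivative \<nu> * H ?y + w ?y) (at t)"
      by (simp add: H_def algebra_simps)
  qed
  then have "eigen_sum H" by (rule eigen_sum_eigen[OF HV])
  moreover have "eigen_sum P"
    unfolding P_def by (intro eigen_sum_sum eigen_sum_scale eigen_sum_eigen[OF uV ue])
  ultimately have "eigen_sum (\<lambda>x. H x + P x)" by (rule eigen_sum_add)
  then show ?thesis by (simp add: H_def)
qed

text \<open>Back substitution: the last equation is homogeneous, and each earlier one is forced by
  components already known to be sums of eigenfunctions.\<close>

lemma triangular_system_eigen_sum:
  fixes G :: "nat \<Rightarrow> 'a \<Rightarrow> complex" and U :: "nat \<Rightarrow> nat \<Rightarrow> complex"
  assumes G: "\<And>i. i < n \<Longrightarrow> G i \<in> V"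
    and ode: "\<And>i x t. i < n \<Longrightarrow> x \<in> S \<Longrightarrow>
      ((\<lambda>t. G i (\<Phi> t x)) has_vector_derivative (\<Sum>k=i..<n. U i k * G k (\<Phi> t x))) (at t)"
  shows "i < n \<Longrightarrow> eigen_sum (G i)"
proof (induction "n - i" arbitrary: i rule: less_induct)
  case less
  have "{i..<n} = insert i {Suc i..<n}" using less.prems by auto
  then have "(\<Sum>k=i..<n. U i k * G k y) = U i i * G i y + (\<Sum>k=Suc i..<n. U i k * G k y)" for y
    by simp
  with ode[OF less.prems] have "((\<lambda>t. G i (\<Phi> t x)) has_vector_derivative
      U i i * G i (\<Phi> t x) + (\<Sum>k=Suc i..<n. U i k * G k (\<Phi> t x))) (at t)" if "x \<in> S" for x t
    using that by simp
  moreover have "eigen_sum (\<lambda>x. \<Sum>k=Suc i..<n. U i k * G k x)"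
    using less by (intro eigen_sum_sum eigen_sum_scale less.hyps) auto
  ultimately show ?case by (intro eigen_sum_step[OF G[OF less.prems]]) auto
qed

end

subsection \<open>Frequencies and Kronecker's theorem\<close>

definition integer_independent :: "nat \<Rightarrow> (nat \<Rightarrow> real) \<Rightarrow> bool" where
  "integer_independent l \<beta> \<longleftrightarrow>
    (\<forall>a::nat \<Rightarrow> int. (\<Sum>i<l. of_int (a i) * \<beta> i) = 0 \<longrightarrow> (\<forall>i<l. a i = 0))"

text \<open>Frequencies are added one at a time. If a nonzero multiple k \<mu> is already an integer
  combination, dividing the family by k makes \<mu> one as well; otherwise \<mu> is independent of
  the family and is appended. The lattice obtained may be finer than the group generated by
  \<open>M\<close>.\<close>

lemma integer_basis:
  assumes "finite M"
  shows "\<exists>l \<beta> m. integer_independent l \<beta> \<and> (\<forall>\<mu>\<in>M. \<mu> = (\<Sum>i<l. of_int (m \<mu> i :: int) * \<beta> i))"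
  using assms
proof induction
  case empty
  show ?case by (intro exI[of _ 0]) (auto simp: integer_independent_def)
next
  case (insert \<mu> M)
  then obtain l \<beta> m where ind: "integer_independent l \<beta>"
    and m: "\<And>\<nu>. \<nu> \<in> M \<Longrightarrow> \<nu> = (\<Sum>i<l. of_int (m \<nu> i :: int) * \<beta> i)" by blast
  show ?case
  proof (cases "\<exists>k a. k \<noteq> 0 \<and> of_int k * \<mu> = (\<Sum>i<l. of_int (a i :: int) * \<beta> i)")
    case True
    then obtain k :: int and a where k: "k \<noteq> 0" and a: "of_int k * \<mu> = (\<Sum>i<l. of_int (a i) * \<beta> i)" by blast
    define \<beta>' where "\<beta>' i = \<beta> i / of_int k" for i
    have s: "(\<Sum>i<l. of_int (b i) * \<beta>' i) = (\<Sum>i<l. of_int (b i) * \<beta> i) / of_int k" for b :: "nat \<Rightarrow> int"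
      by (simp add: \<beta>'_def sum_divide_distrib)
    have "integer_independent l \<beta>'"
      using ind k unfolding integer_independent_def s by simp
    moreover have "\<nu> = (\<Sum>i<l. of_int (k * m \<nu> i) * \<beta>' i)" if "\<nu> \<in> M" for \<nu>
    proof -
      have "\<nu> = (\<Sum>i<l. of_int (m \<nu> i) * \<beta> i)" by (rule m[OF that])
      also have "\<dots> = (\<Sum>i<l. of_int (k * m \<nu> i) * \<beta>' i)" using k by (simp add: \<beta>'_def)
      finally show ?thesis .
    qed
    moreover have "\<mu> = (\<Sum>i<l. of_int (a i) * \<beta>' i)"
      unfolding s a[symmetric] using k by simp
    ultimately show ?thesis
      by (intro exI[of _ l] exI[of _ \<beta>'] exI[of _ "\<lambda>\<nu>. if \<nu> = \<mu> then a else (\<lambda>i. k * m \<nu> i)"] conjI ballI) auto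
  next
    case False
    define \<beta>' where "\<beta>' = \<beta>(l := \<mu>)"
    have s: "(\<Sum>i<Suc l. of_int (b i) * \<beta>' i) = (\<Sum>i<l. of_int (b i) * \<beta> i) + of_int (b l) * \<mu>" for b :: "nat \<Rightarrow> int"
      by (simp add: \<beta>'_def)
    have "integer_independent (Suc l) \<beta>'"
      unfolding integer_independent_def s
    proof (intro allI impI)
      fix b :: "nat \<Rightarrow> int" and i assume b: "(\<Sum>i<l. of_int (b i) * \<beta> i) + of_int (b l) * \<mu> = 0" and i: "i < Suc l"
      have "of_int (- b l) * \<mu> = (\<Sum>i<l. of_int (b i) * \<beta> i)" using b by simp
      with False have bl: "b l = 0" by (metis neg_equal_0_iff_equal)
      with b ind have "\<forall>i<l. b i = 0" by (simp add: integer_independent_def)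
      then show "b i = 0" using bl i less_Suc_eq by blast
    qed
    moreover have "\<nu> = (\<Sum>i<Suc l. of_int (((m \<nu>)(l := 0)) i) * \<beta>' i)" if "\<nu> \<in> M" for \<nu>
      unfolding s using m[OF that] by simp
    moreover have "\<mu> = (\<Sum>i<Suc l. of_int (if i = l then 1 else 0) * \<beta>' i)"
      unfolding s by simp
    ultimately show ?thesis
      by (intro exI[of _ "Suc l"] exI[of _ \<beta>'] conjI
          exI[of _ "\<lambda>\<nu>. if \<nu> = \<mu> then (\<lambda>i. if i = l then 1 else 0) else (m \<nu>)(l := 0)"] ballI) auto
  qed
qed

text \<open>Kronecker's theorem gives one approximation for each accuracy 1/(q + 1). It speaks of
  independent sets in the reals as a module over the integers, so the family \<open>\<beta>\<close>
  is first shown to be injective with independent range.\<close>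

lemma kronecker_sequence:
  fixes \<beta> \<alpha> :: "nat \<Rightarrow> real"
  assumes "integer_independent l \<beta>"
  obtains t h where "\<And>i. i < l \<Longrightarrow> (\<lambda>q::nat. t q * \<beta> i - of_int (h q i :: int)) \<longlonglongrightarrow> \<alpha> i"
proof -
  have ind: "\<And>a i. (\<Sum>i<l. of_int (a i) * \<beta> i) = 0 \<Longrightarrow> i < l \<Longrightarrow> a i = (0::int)"
    using assms by (auto simp: integer_independent_def)
  have inj: "inj_on \<beta> {..<l}"
  proof (rule inj_onI, rule ccontr)
    fix i j assume ij: "i \<in> {..<l}" "j \<in> {..<l}" "\<beta> i = \<beta> j" "i \<noteq> j"
    \<comment> \<open>A coincidence \<open>\<beta> i = \<beta> j\<close> would be an integer
      relation with coefficients 1 and -1.\<close>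
    let ?a = "\<lambda>k. (if k = i then 1 else 0) - (if k = j then 1 else 0) :: int"
    have "(\<Sum>k<l. of_int (?a k) * \<beta> k) = (\<Sum>k<l. if k = i then \<beta> k else 0) - (\<Sum>k<l. if k = j then \<beta> k else 0)"
      unfolding sum_subtractf[symmetric] by (intro sum.cong) auto
    also have "\<dots> = 0" using ij by simp
    finally have "?a i = 0" by (rule ind) (use ij in simp)
    then show False using ij by simp
  qed
  interpret Modules.module "\<lambda>r. (*) (real_of_int r)" by unfold_locales (auto simp: algebra_simps)
  have indp: "independent (\<beta> ` {..<l})"
    unfolding independent_explicit_module
  proof (intro allI impI)
    fix t u v assume t: "finite t" "t \<subseteq> \<beta> ` {..<l}" and z: "(\<Sum>v\<in>t. real_of_int (u v) * v) = 0" and v: "v \<in> t"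
    let ?I = "{i \<in> {..<l}. \<beta> i \<in> t}"
    have tI: "t = \<beta> ` ?I" using t(2) by auto
    have "(\<Sum>i<l. of_int (if \<beta> i \<in> t then u (\<beta> i) else 0) * \<beta> i) = (\<Sum>i\<in>?I. of_int (u (\<beta> i)) * \<beta> i)"
      by (rule sum.mono_neutral_cong_right) auto
    also have "\<dots> = (\<Sum>v\<in>t. real_of_int (u v) * v)"
      by (subst (2) tI) (rule sum.reindex_cong[OF inj_on_subset[OF inj] refl refl, symmetric], auto)
    finally have s: "(\<Sum>i<l. of_int (if \<beta> i \<in> t then u (\<beta> i) else 0) * \<beta> i) = 0" using z by simp
    obtain i where i: "i < l" "v = \<beta> i" using v t(2) by auto
    show "u v = 0" using ind[OF s i(1)] i v by simp
  qed
  have "\<exists>t h. \<forall>i<l. \<bar>t * \<beta> i - of_int (h i :: int) - \<alpha> i\<bar> < inverse (of_nat (Suc q))" for q :: nat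
  proof -
    obtain t h where "\<And>i. i < l \<Longrightarrow> \<bar>t * \<beta> i - of_int (h i) - \<alpha> i\<bar> < inverse (of_nat (Suc q))"
      by (rule Kronecker_thm_1[OF indp inj, of "inverse (of_nat (Suc q))" \<alpha>]) auto
    then show ?thesis by blast
  qed
  then obtain t h where th: "\<And>q i. i < l \<Longrightarrow> \<bar>t q * \<beta> i - of_int (h q i :: int) - \<alpha> i\<bar> < inverse (of_nat (Suc q))"
    by metis
  have "(\<lambda>q. t q * \<beta> i - of_int (h q i)) \<longlonglongrightarrow> \<alpha> i" if "i < l" for i
  proof (rule LIM_zero_cancel, rule Lim_null_comparison[OF _ LIMSEQ_inverse_real_of_nat])
    show "\<forall>\<^sub>F q in sequentially. norm (t q * \<beta> i - of_int (h q i) - \<alpha> i) \<le> inverse (real (Suc q))"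
      using th[OF that] by (auto intro!: always_eventually less_imp_le)
  qed
  then show ?thesis using that by blast
qed

lemma cis_integer_shift:
  fixes m h :: "nat \<Rightarrow> int" and x :: "nat \<Rightarrow> real"
  shows "cis (2 * pi * (\<Sum>i<l. of_int (m i) * (x i - of_int (h i)))) = cis (2 * pi * (\<Sum>i<l. of_int (m i) * x i))"
proof -
  have "2 * pi * (\<Sum>i<l. of_int (m i) * (x i - of_int (h i))) =
      2 * pi * (\<Sum>i<l. of_int (m i) * x i) + 2 * pi * of_int (- (\<Sum>i<l. m i * h i))"
    by (simp add: algebra_simps sum_subtractf)
  then show ?thesis by (simp only: cis_mult[symmetric] cis_multiple_2pi[OF Ints_of_int] mult_1_right)
qed

text \<open>Compactness turns the approximations of a torus element by flow times into an actual point.\<close>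
lemma torus_translate_exists:
  fixes u :: "nat \<Rightarrow> real \<Rightarrow> 'a \<Rightarrow> complex"
  assumes X: "compact_space X" and x: "x \<in> topspace X" and M: "finite M"
    and flow: "\<And>t. \<Phi> t x \<in> topspace X"
    and u: "\<And>j \<mu>. continuous_map X euclidean (u j \<mu>)"
    and eig: "\<And>j \<mu> t. j < n \<Longrightarrow> \<mu> \<in> M \<Longrightarrow> u j \<mu> (\<Phi> t x) = cis (\<mu> * t) * u j \<mu> x"
    and ind: "integer_independent l \<omega>"
    and m: "\<And>\<mu>. \<mu> \<in> M \<Longrightarrow> \<mu> = 2 * pi * (\<Sum>i<l. of_int (m \<mu> i :: int) * \<omega> i)"
  shows "\<exists>y\<in>topspace X. \<forall>j<n. \<forall>\<mu>\<in>M. u j \<mu> y = cis (2 * pi * (\<Sum>i<l. of_int (m \<mu> i) * h i)) * u j \<mu> x"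
proof -
  let ?c = "\<lambda>\<mu>. cis (2 * pi * (\<Sum>i<l. of_int (m \<mu> i) * h i))"
  \<comment> \<open>The total defect of \<open>y\<close> from being the translate of
    \<open>x\<close>. It attains its minimum on the compact space, and the minimum is 0 because the
    defect tends to 0 along suitable flow times.\<close>
  define \<psi> where "\<psi> y = (\<Sum>p\<in>{..<n} \<times> M. norm (u (fst p) (snd p) y - ?c (snd p) * u (fst p) (snd p) x))" for y
  have fin: "finite ({..<n} \<times> M)" using M by simp
  have \<psi>_cont: "continuous_map X euclideanreal \<psi>"
    unfolding \<psi>_def by (intro continuous_map_sum fin continuous_map_norm continuous_map_diff u) simp
  have "compactin X (topspace X)" using X by (simp add: compact_space_def)
  then have "compact (\<psi> ` topspace X)"
    using image_compactin[OF _ \<psi>_cont] by (simp add: compactin_euclidean_iff)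
  moreover have "\<psi> ` topspace X \<noteq> {}" using x by blast
  ultimately have "\<exists>s\<in>\<psi> ` topspace X. \<forall>t\<in>\<psi> ` topspace X. s \<le> t" by (rule compact_attains_inf)
  then obtain y where y: "y \<in> topspace X" "\<And>z. z \<in> topspace X \<Longrightarrow> \<psi> y \<le> \<psi> z" by auto
  obtain t k where tk: "\<And>i. i < l \<Longrightarrow> (\<lambda>q::nat. t q * \<omega> i - of_int (k q i :: int)) \<longlonglongrightarrow> h i"
    using kronecker_sequence[OF ind, of h] by blast
  have lim: "(\<lambda>q. u j \<mu> (\<Phi> (t q) x)) \<longlonglongrightarrow> ?c \<mu> * u j \<mu> x" if j: "j < n" "\<mu> \<in> M" for j \<mu>
  proof -
    have "u j \<mu> (\<Phi> (t q) x) = cis (2 * pi * (\<Sum>i<l. of_int (m \<mu> i) * (t q * \<omega> i - of_int (k q i)))) * u j \<mu> x" for q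
    proof -
      have "\<mu> * t q = 2 * pi * (\<Sum>i<l. of_int (m \<mu> i) * (t q * \<omega> i))"
        by (subst m[OF j(2)]) (simp add: sum_distrib_left sum_distrib_right mult_ac)
      then show ?thesis unfolding cis_integer_shift using eig[OF j] by simp
    qed
    moreover have "(\<lambda>q. cis (2 * pi * (\<Sum>i<l. of_int (m \<mu> i) * (t q * \<omega> i - of_int (k q i)))) * u j \<mu> x)
        \<longlonglongrightarrow> ?c \<mu> * u j \<mu> x"
      by (intro tendsto_intros tk) auto
    ultimately show ?thesis by simp
  qed
  have "(\<lambda>q. \<psi> (\<Phi> (t q) x)) \<longlonglongrightarrow> (\<Sum>p\<in>{..<n} \<times> M. norm (?c (snd p) * u (fst p) (snd p) x - ?c (snd p) * u (fst p) (snd p) x))"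
    unfolding \<psi>_def by (intro tendsto_sum tendsto_norm tendsto_diff tendsto_const lim) auto
  then have "(\<lambda>q. \<psi> (\<Phi> (t q) x)) \<longlonglongrightarrow> 0" by simp
  then have "\<psi> y \<le> 0"
    by (rule tendsto_lowerbound) (use y(2) flow in auto)
  moreover have "0 \<le> \<psi> y" unfolding \<psi>_def by (intro sum_nonneg) auto
  ultimately have "\<psi> y = 0" by simp
  then have "\<forall>p\<in>{..<n} \<times> M. norm (u (fst p) (snd p) y - ?c (snd p) * u (fst p) (snd p) x) = 0"
    unfolding \<psi>_def by (subst (asm) sum_nonneg_eq_0_iff[OF fin]) auto
  then show ?thesis using y(1) by (intro bexI[of _ y]) auto
qed

subsection \<open>Decomposition of a linearizing map\<close>

lemma flow_facts:
  assumes "group_action real_group S \<Phi>"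
  shows flow_closed: "x \<in> S \<Longrightarrow> \<Phi> t x \<in> S"
    and flow_0: "x \<in> S \<Longrightarrow> \<Phi> 0 x = x"
    and flow_add: "x \<in> S \<Longrightarrow> \<Phi> (s + t) x = \<Phi> s (\<Phi> t x)"
    and flow_extensional: "\<Phi> t \<in> extensional S"
proof -
  interpret group_action real_group S \<Phi> by (rule assms)
  have c: "\<And>t. t \<in> carrier real_group" by (simp add: real_group_def)
  show "x \<in> S \<Longrightarrow> \<Phi> t x \<in> S" using element_image[OF c] by blast
  show "x \<in> S \<Longrightarrow> \<Phi> 0 x = x" using fun_cong[OF id_eq_one, of x] by (simp add: real_group_def)
  show "x \<in> S \<Longrightarrow> \<Phi> (s + t) x = \<Phi> s (\<Phi> t x)"
    using composition_rule[OF _ c c, of x s t] by (simp add: real_group_def)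
  show "\<Phi> t \<in> extensional S" using bij_prop0[OF c] by (simp add: Bij_def)
qed

lemma linearizing_derivative:
  assumes act: "group_action real_group (points X) \<Phi>" and lin: "linearizing X \<Phi> n F"
  obtains B where "B \<in> carrier_mat n n"
    "\<And>j x t. j < n \<Longrightarrow> x \<in> points X \<Longrightarrow>
      ((\<lambda>t. F (\<Phi> t x) j) has_real_derivative (\<Sum>k<n. B $$ (j, k) * F (\<Phi> t x) k)) (at t)"
proof -
  obtain B where B: "B \<in> carrier_mat n n" and eq: "\<And>t x. x \<in> points X \<Longrightarrow>
      Matrix.vec n (F (\<Phi> t x)) = mat_exp (t \<cdot>\<^sub>m B) *\<^sub>v Matrix.vec n (F x)"
    using lin unfolding linearizing_def by blast
  have "((\<lambda>t. F (\<Phi> t x) j) has_real_derivative (\<Sum>k<n. B $$ (j, k) * F (\<Phi> t x) k)) (at t)"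
    if j: "j < n" and x: "x \<in> points X" for j x t
  proof -
    let ?y = "\<Phi> t x"
    have y: "?y \<in> points X" using flow_closed[OF act x] .
    \<comment> \<open>Restarting the flow at \<open>?y\<close> reduces the derivative at time
      \<open>t\<close> to that of the exponential at 0.\<close>
    have "F (\<Phi> (s + t) x) j = (\<Sum>k<n. mat_exp (s \<cdot>\<^sub>m B) $$ (j, k) * F ?y k)" for s
    proof -
      have "F (\<Phi> (s + t) x) j = Matrix.vec n (F (\<Phi> s ?y)) $ j" using j flow_add[OF act x] by simp
      also have "\<dots> = (\<Sum>k<n. mat_exp (s \<cdot>\<^sub>m B) $$ (j, k) * F ?y k)"
        using j B by (simp add: eq[OF y] scalar_prod_def mat_exp_def atLeast0LessThan)
      finally show ?thesis .
    qed
    moreover have "((\<lambda>s. \<Sum>k<n. mat_exp (s \<cdot>\<^sub>m B) $$ (j, k) * F ?y k) has_real_derivative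
        (\<Sum>k<n. B $$ (j, k) * F ?y k)) (at 0)"
      using j by (intro DERIV_sum DERIV_cmult_right mat_exp_derivative_at_0[OF B]) auto
    ultimately have "((\<lambda>s. F (\<Phi> (s + t) x) j) has_real_derivative (\<Sum>k<n. B $$ (j, k) * F ?y k)) (at 0)"
      by simp
    then show ?thesis
      using DERIV_shift[of "\<lambda>t. F (\<Phi> t x) j" _ 0 t] by simp
  qed
  then show ?thesis using that B by blast
qed

text \<open>A Schur triangularisation \<open>A = P * U * Q\<close> of the complexified generator
  turns the combinations \<open>G\<close> of the components of \<open>F\<close> with coefficients
  \<open>Q\<close> into a triangular system, and \<open>P\<close> recovers the components of
  \<open>F\<close>. Eigencomponents are given by coefficients \<open>c\<close>, so what is known
  about the components of \<open>F\<close> passes on to them.\<close>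

lemma linearizing_eigen_data:
  assumes act: "group_action real_group (points X) \<Phi>" and lin: "linearizing X \<Phi> n F"
    and bdd: "\<And>j. j < n \<Longrightarrow> \<exists>K. \<forall>x\<in>points X. \<bar>F x j\<bar> \<le> K"
  obtains M c where "finite M"
    "\<And>j x. j < n \<Longrightarrow> x \<in> points X \<Longrightarrow>
      of_real (F x j) = (\<Sum>\<mu>\<in>M. \<Sum>k<n. c j \<mu> k * of_real (F x k) :: complex)"
    "\<And>j \<mu>. j < n \<Longrightarrow> flow_eigen \<Phi> (points X) \<mu> (\<lambda>x. \<Sum>k<n. c j \<mu> k * of_real (F x k))"
proof -
  let ?S = "points X"
  let ?f = "\<lambda>k x. complex_of_real (F x k)"
  define V where "V = range (\<lambda>c x. \<Sum>k<n. c k * ?f k x)"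
  have VI: "(\<lambda>x. \<Sum>k<n. c k * ?f k x) \<in> V" for c by (simp add: V_def)
  interpret bounded_flow_space \<Phi> ?S V
  proof
    show "\<And>x t. x \<in> ?S \<Longrightarrow> \<Phi> t x \<in> ?S" by (rule flow_closed[OF act])
    show "\<And>x. x \<in> ?S \<Longrightarrow> \<Phi> 0 x = x" by (rule flow_0[OF act])
    show "(\<lambda>x. f x + g x) \<in> V" if fg: "f \<in> V" "g \<in> V" for f g
    proof -
      obtain c d where "f = (\<lambda>x. \<Sum>k<n. c k * ?f k x)" "g = (\<lambda>x. \<Sum>k<n. d k * ?f k x)"
        using fg by (auto simp: V_def)
      then have "(\<lambda>x. f x + g x) = (\<lambda>x. \<Sum>k<n. (c k + d k) * ?f k x)"
        by (simp add: distrib_right sum.distrib)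
      then show ?thesis using VI by metis
    qed
    show "(\<lambda>x. a * f x) \<in> V" if f: "f \<in> V" for f a
    proof -
      obtain c where "f = (\<lambda>x. \<Sum>k<n. c k * ?f k x)" using f by (auto simp: V_def)
      then have "(\<lambda>x. a * f x) = (\<lambda>x. \<Sum>k<n. (a * c k) * ?f k x)"
        by (simp add: sum_distrib_left mult.assoc)
      then show ?thesis using VI by metis
    qed
    show "(\<lambda>_. 0) \<in> V" using VI[of "\<lambda>_. 0"] by simp
    show "\<exists>K. \<forall>x\<in>?S. norm (f x) \<le> K" if f: "f \<in> V" for f
    proof -
      obtain c where c: "f = (\<lambda>x. \<Sum>k<n. c k * ?f k x)" using f by (auto simp: V_def)
      obtain K where K: "\<And>j x. j < n \<Longrightarrow> x \<in> ?S \<Longrightarrow> \<bar>F x j\<bar> \<le> K j" using bdd by metis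
      have "norm (f x) \<le> (\<Sum>k<n. norm (c k) * K k)" if "x \<in> ?S" for x
        unfolding c by (rule sum_norm_le) (use K that in \<open>auto simp: norm_mult intro!: mult_left_mono\<close>)
      then show ?thesis by blast
    qed
  qed
  obtain B where B: "B \<in> carrier_mat n n" and D: "\<And>j x t. j < n \<Longrightarrow> x \<in> ?S \<Longrightarrow>
      ((\<lambda>t. F (\<Phi> t x) j) has_real_derivative (\<Sum>k<n. B $$ (j, k) * F (\<Phi> t x) k)) (at t)"
    using linearizing_derivative[OF act lin] by blast
  define A where "A = map_mat complex_of_real B"
  have A: "A \<in> carrier_mat n n" using B by (simp add: A_def)
  obtain es where es: "char_poly A = (\<Prod>a\<leftarrow>es. [:- a, 1:])" using char_poly_factorized[OF A] by blast
  obtain U P Q where UPQ: "schur_decomposition A es = (U, P, Q)" by (cases "schur_decomposition A es") auto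
  from schur_decomposition[OF A es UPQ] have tri: "upper_triangular U" and sim: "similar_mat_wit A U P Q" by auto
  have dims: "U \<in> carrier_mat n n" "P \<in> carrier_mat n n" "Q \<in> carrier_mat n n"
    and PQ: "P * Q = 1\<^sub>m n" "Q * P = 1\<^sub>m n" and APQ: "A = P * U * Q"
    using sim A by (auto simp: similar_mat_wit_def Let_def)
  have QA: "Q * A = U * Q"
  proof -
    have "Q * A = Q * P * U * Q" unfolding APQ using dims by (simp add: assoc_mult_mat[of _ n n _ n _ n])
    then show ?thesis using dims by (simp add: PQ)
  qed
  define G where "G i x = (\<Sum>k<n. Q $$ (i, k) * ?f k x)" for i x
  have GV: "G i \<in> V" for i unfolding G_def by (rule VI)
  have entry: "(C * E) $$ (i, j) = (\<Sum>k<n. C $$ (i, k) * E $$ (k, j))"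
    if "C \<in> carrier_mat n n" "E \<in> carrier_mat n n" "i < n" "j < n" for C E :: "complex mat" and i j
    using that by (simp add: scalar_prod_def atLeast0LessThan)
  have ode: "((\<lambda>t. G i (\<Phi> t x)) has_vector_derivative (\<Sum>k=i..<n. U $$ (i, k) * G k (\<Phi> t x))) (at t)"
    if i: "i < n" and x: "x \<in> ?S" for i x t
  proof -
    let ?y = "\<Phi> t x"
    have "((\<lambda>t. G i (\<Phi> t x)) has_vector_derivative
        (\<Sum>k<n. Q $$ (i, k) * complex_of_real (\<Sum>l<n. B $$ (k, l) * F ?y l))) (at t)"
      unfolding G_def
      by (intro has_vector_derivative_sum has_vector_derivative_mult_right has_vector_derivative_of_real D x) auto
    also have "(\<Sum>k<n. Q $$ (i, k) * complex_of_real (\<Sum>l<n. B $$ (k, l) * F ?y l)) =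
        (\<Sum>k<n. \<Sum>l<n. Q $$ (i, k) * A $$ (k, l) * ?f l ?y)"
      using B by (simp add: A_def sum_distrib_left mult.assoc)
    also have "\<dots> = (\<Sum>l<n. (Q * A) $$ (i, l) * ?f l ?y)"
      using i by (subst sum.swap) (simp add: entry[OF dims(3) A] sum_distrib_right)
    also have "\<dots> = (\<Sum>l<n. \<Sum>k<n. U $$ (i, k) * Q $$ (k, l) * ?f l ?y)"
      unfolding QA using i by (simp add: entry[OF dims(1,3)] sum_distrib_right)
    also have "\<dots> = (\<Sum>k<n. U $$ (i, k) * G k ?y)"
      by (subst sum.swap) (simp add: G_def sum_distrib_left mult.assoc)
    also have "\<dots> = (\<Sum>k=i..<n. U $$ (i, k) * G k ?y)"
    proof (rule sum.mono_neutral_right)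
      show "\<forall>k\<in>{..<n} - {i..<n}. U $$ (i, k) * G k ?y = 0"
        using tri dims(1) i by (auto simp: upper_triangular_def)
    qed auto
    finally show ?thesis .
  qed
  have Gs: "eigen_sum (G i)" if "i < n" for i
    by (rule triangular_system_eigen_sum[OF GV ode that])
  have Fs: "eigen_sum (?f j)" if j: "j < n" for j
  proof -
    have "(\<Sum>i<n. P $$ (j, i) * G i x) = ?f j x" for x
    proof -
      have "(\<Sum>i<n. P $$ (j, i) * G i x) = (\<Sum>k<n. \<Sum>i<n. P $$ (j, i) * Q $$ (i, k) * ?f k x)"
        by (subst sum.swap) (simp add: G_def sum_distrib_left mult.assoc)
      also have "\<dots> = (\<Sum>k<n. (P * Q) $$ (j, k) * ?f k x)"
        using j by (simp add: entry[OF dims(2,3)] sum_distrib_right)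
      also have "\<dots> = (\<Sum>k<n. if k = j then ?f k x else 0)"
        unfolding PQ using j by (intro sum.cong) auto
      finally show ?thesis using j by simp
    qed
    moreover have "eigen_sum (\<lambda>x. \<Sum>i<n. P $$ (j, i) * G i x)"
      by (intro eigen_sum_sum eigen_sum_scale Gs) auto
    ultimately show ?thesis by simp
  qed
  define R where "R j M c \<longleftrightarrow> finite M \<and> (\<forall>\<mu>. flow_eigen \<Phi> ?S \<mu> (\<lambda>x. \<Sum>k<n. c \<mu> k * ?f k x)) \<and>
      (\<forall>x\<in>?S. ?f j x = (\<Sum>\<mu>\<in>M. \<Sum>k<n. c \<mu> k * ?f k x))" for j M c
  have "\<exists>M c. R j M c" if j: "j < n" for j
  proof -
    obtain M u where u: "finite M" "\<And>\<mu>. u \<mu> \<in> V" "\<And>\<mu>. flow_eigen \<Phi> ?S \<mu> (u \<mu>)"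
      "\<And>x. x \<in> ?S \<Longrightarrow> ?f j x = (\<Sum>\<mu>\<in>M. u \<mu> x)"
      using Fs[OF j] unfolding eigen_sum_def by blast
    have "\<forall>\<mu>. \<exists>c. u \<mu> = (\<lambda>x. \<Sum>k<n. c k * ?f k x)"
      using u(2) by (auto simp: V_def)
    from choice[OF this] obtain c where "\<And>\<mu>. u \<mu> = (\<lambda>x. \<Sum>k<n. c \<mu> k * ?f k x)" by blast
    then show ?thesis using u unfolding R_def by (intro exI[of _ M] exI[of _ c]) auto
  qed
  then have "\<forall>j. \<exists>M c. j < n \<longrightarrow> R j M c" by blast
  then obtain N c where R: "\<And>j. j < n \<Longrightarrow> R j (N j) (c j)" by metis
  have N: "\<And>j. j < n \<Longrightarrow> finite (N j)"
    and e: "\<And>j \<mu>. j < n \<Longrightarrow> flow_eigen \<Phi> ?S \<mu> (\<lambda>x. \<Sum>k<n. c j \<mu> k * ?f k x)"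
    and s: "\<And>j x. j < n \<Longrightarrow> x \<in> ?S \<Longrightarrow> ?f j x = (\<Sum>\<mu>\<in>N j. \<Sum>k<n. c j \<mu> k * ?f k x)"
    using R unfolding R_def by blast+
  \<comment> \<open>Zero coefficients outside \<open>N j\<close> let a single frequency set serve
    all components.\<close>
  define c' where "c' j \<mu> = (if \<mu> \<in> N j then c j \<mu> else (\<lambda>_. 0))" for j \<mu>
  show ?thesis
  proof (rule that[of "\<Union>j<n. N j" c'])
    show fin: "finite (\<Union>j<n. N j)" using N by auto
    show "?f j x = (\<Sum>\<mu>\<in>(\<Union>j<n. N j). \<Sum>k<n. c' j \<mu> k * ?f k x)" if "j < n" "x \<in> ?S" for j x
      unfolding s[OF that] by (rule sum.mono_neutral_cong_left[OF fin]) (use that in \<open>auto simp: c'_def\<close>)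
    show "flow_eigen \<Phi> ?S \<mu> (\<lambda>x. \<Sum>k<n. c' j \<mu> k * ?f k x)" if "j < n" for j \<mu>
      using e[OF that, of \<mu>] by (cases "\<mu> \<in> N j") (simp_all add: c'_def flow_eigen_def)
  qed
qed

subsection \<open>Construction of the torus action\<close>

text \<open>The real part of a + i b times the character with exponents \<open>m\<close>, in lifted
  torus coordinates.\<close>

lemma Ck_fun_nat_trig_monomial:
  assumes U: "openin (Euclidean_space d) U"
  shows "Ck_fun_nat r d U (\<lambda>z. a * cos (2 * pi * (\<Sum>i<l. of_int (m i) * z i)) - b * sin (2 * pi * (\<Sum>i<l. of_int (m i) * z i)))"
proof -
  have lin: "Ck_fun_nat r d U (\<lambda>z. 2 * pi * (\<Sum>i<l. of_int (m i) * z i))"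
    by (intro Ck_fun_nat_mult[OF U] Ck_fun_nat_sum[OF U] Ck_fun_nat_const Ck_fun_nat_coordinate[OF U])
  have "Ck_fun_nat r d U (\<lambda>z. a * cos (2 * pi * (\<Sum>i<l. of_int (m i) * z i)) +
      (- b) * sin (2 * pi * (\<Sum>i<l. of_int (m i) * z i)))"
    by (intro Ck_fun_nat_add[OF U] Ck_fun_nat_mult[OF U] Ck_fun_nat_const Ck_fun_nat_cos[OF U lin] Ck_fun_nat_sin[OF U lin])
  then show ?thesis by simp
qed

lemma Ck_fun_nat_right_part:
  assumes U: "openin (Euclidean_space (l + d)) U" and V: "openin (Euclidean_space d) V"
    and UV: "\<And>z. z \<in> U \<Longrightarrow> right_part l z \<in> V" and f: "Ck_fun_nat r d V f"
  shows "Ck_fun_nat r (l + d) U (\<lambda>z. f (right_part l z))"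
proof (rule Ck_fun_nat_compose[OF U V f])
  show "Ck_fun_nat r (l + d) U (\<lambda>z. right_part l z i)" for i
    unfolding right_part_def by (rule Ck_fun_nat_coordinate[OF U])
qed (use UV in auto)

text \<open>In a product chart the torus coordinates are a representative \<open>h\<close> of the
  torus element, so \<open>g\<close> is a trigonometric polynomial in them whose coefficients depend
  on the remaining coordinates through \<open>f\<close>.\<close>

lemma Ck_real_torus_prod:
  assumes X: "charted X"
    and f: "\<And>k. k < n \<Longrightarrow> Ck_real q X (f k)"
    and g: "\<And>h x. h \<in> Euc l \<Longrightarrow> x \<in> points X \<Longrightarrow> g (torus_proj l h, x) = (\<Sum>\<mu>\<in>M. \<Sum>k<n.
      (a \<mu> k * cos (2 * pi * (\<Sum>i<l. of_int (m \<mu> i :: int) * h i)) -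
       b \<mu> k * sin (2 * pi * (\<Sum>i<l. of_int (m \<mu> i) * h i))) * f k x)"
  shows "Ck_real q (prod_mfd (torus_mfd l) X) g"
  unfolding Ck_real_def
proof (intro ballI allI impI)
  fix e r assume e: "e \<in> mfd_atlas (prod_mfd (torus_mfd l) X)" and r: "enat r \<le> q"
  obtain c d where ecd: "e = prod_chart c d" and c: "c \<in> mfd_atlas (torus_mfd l)" and d: "d \<in> mfd_atlas X"
    using e by (auto simp: prod_mfd_def)
  obtain V where cV: "c = \<lparr>chart_dim = l, chart_dom = torus_proj l ` V, chart_map = inv_into V (torus_proj l)\<rparr>"
    and V: "openin (Euclidean_space l) V" "inj_on (torus_proj l) V"
    using c by (auto simp: torus_mfd_def)
  have cc: "chart_of (torus_top l) c" and cimg: "chart_img c = V"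
    and cinv: "\<And>u. u \<in> V \<Longrightarrow> chart_inv c u = torus_proj l u"
    unfolding cV using torus_chart[OF V] by auto
  have dd: "chart_of (mfd_top X) d" using X d by (rule chartedD)
  have cl: "chart_dim c = l" by (simp add: cV)
  have ee: "chart_of (prod_topology (torus_top l) (mfd_top X)) e" unfolding ecd by (rule chart_of_prod_chart[OF cc dd])
  have U: "openin (Euclidean_space (l + chart_dim d)) (chart_img e)"
    using chart_of_openin_img[OF ee] by (simp only: ecd prod_chart_sel cl)
  have img: "chart_img e = {z \<in> Euc (l + chart_dim d). left_part l z \<in> V \<and> right_part l z \<in> chart_img d}"
    unfolding ecd prod_chart_img[OF cc dd] cimg cl by simp
  let ?t = "\<lambda>\<mu> k z. a \<mu> k * cos (2 * pi * (\<Sum>i<l. of_int (m \<mu> i) * z i)) -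
       b \<mu> k * sin (2 * pi * (\<Sum>i<l. of_int (m \<mu> i) * z i))"
  have "Ck_fun_nat r (l + chart_dim d) (chart_img e)
      (\<lambda>z. \<Sum>\<mu>\<in>M. \<Sum>k<n. ?t \<mu> k z * f k (chart_inv d (right_part l z)))"
  proof (intro Ck_fun_nat_sum[OF U] Ck_fun_nat_mult[OF U] Ck_fun_nat_trig_monomial[OF U])
    fix k assume "k \<in> {..<n}"
    then show "Ck_fun_nat r (l + chart_dim d) (chart_img e) (\<lambda>z. f k (chart_inv d (right_part l z)))"
      by (intro Ck_fun_nat_right_part[OF U chart_of_openin_img[OF dd]] Ck_realD[OF f d r]) (auto simp: img)
  qed
  then have "Ck_fun_nat r (l + chart_dim d) (chart_img e) (\<lambda>z. g (chart_inv e z))"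
  proof (rule Ck_fun_nat_cong[OF U, rotated])
    fix z assume z: "z \<in> chart_img e"
    then have z': "z \<in> Euc (l + chart_dim d)" "left_part l z \<in> V" "right_part l z \<in> chart_img d"
      by (simp_all only: img mem_Collect_eq simp_thms)
    have "chart_inv e z = (torus_proj l (left_part l z), chart_inv d (right_part l z))"
      using prod_chart_inv[OF cc dd, of z] z cinv[OF z'(2)] by (simp only: ecd cl)
    moreover have "chart_inv d (right_part l z) \<in> points X" by (rule chart_inv_in_points[OF dd z'(3)])
    moreover have "left_part l z \<in> Euc l" by (simp add: left_part_def in_Euc)
    ultimately have "g (chart_inv e z) = (\<Sum>\<mu>\<in>M. \<Sum>k<n. ?t \<mu> k (left_part l z) * f k (chart_inv d (right_part l z)))"
      using g by simp
    moreover have "(\<Sum>i<l. of_int (m \<mu> i) * left_part l z i) = (\<Sum>i<l. of_int (m \<mu> i) * z i)" for \<mu>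
      by (intro sum.cong) (auto simp: left_part_def)
    ultimately show "(\<Sum>\<mu>\<in>M. \<Sum>k<n. ?t \<mu> k z * f k (chart_inv d (right_part l z))) = g (chart_inv e z)"
      by simp
  qed
  then show "Ck_fun_nat r (chart_dim e) (chart_img e) (\<lambda>z. g (chart_inv e z))"
    by (simp only: ecd prod_chart_sel cl)
qed

text \<open>Bijectivity comes for free: the inverse group element provides the inverse map.\<close>

lemma group_actionI:
  assumes G: "group G"
    and ext: "\<And>g. g \<in> carrier G \<Longrightarrow> \<phi> g \<in> extensional S"
    and closed: "\<And>g x. g \<in> carrier G \<Longrightarrow> x \<in> S \<Longrightarrow> \<phi> g x \<in> S"
    and mult: "\<And>g h x. g \<in> carrier G \<Longrightarrow> h \<in> carrier G \<Longrightarrow> x \<in> S \<Longrightarrow> \<phi> (g \<otimes>\<^bsub>G\<^esub> h) x = \<phi> g (\<phi> h x)"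
    and one: "\<And>x. x \<in> S \<Longrightarrow> \<phi> \<one>\<^bsub>G\<^esub> x = x"
  shows "group_action G S \<phi>"
proof -
  interpret group G by (rule G)
  have bij: "\<phi> g \<in> Bij S" if g: "g \<in> carrier G" for g
  proof -
    have "bij_betw (\<phi> g) S S"
      by (rule bij_betw_byWitness[of _ "\<phi> (inv\<^bsub>G\<^esub> g)"])
        (use g closed in \<open>auto simp: mult[symmetric] one\<close>)
    then show ?thesis using ext[OF g] by (simp add: Bij_def)
  qed
  have "\<phi> \<in> hom G (BijGroup S)"
  proof (rule homI)
    show "\<phi> g \<in> carrier (BijGroup S)" if "g \<in> carrier G" for g
      using bij[OF that] by (simp add: BijGroup_def)
    show "\<phi> (g \<otimes>\<^bsub>G\<^esub> h) = \<phi> g \<otimes>\<^bsub>BijGroup S\<^esub> \<phi> h" if gh: "g \<in> carrier G" "h \<in> carrier G" for g h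
    proof -
      have "\<phi> (g \<otimes>\<^bsub>G\<^esub> h) = compose S (\<phi> g) (\<phi> h)"
        by (rule extensionalityI[of _ S]) (use gh ext mult in \<open>auto simp: compose_eq\<close>)
      then show ?thesis using bij gh by (simp add: BijGroup_def)
    qed
  qed
  then show ?thesis
    by (intro group_action.intro group_hom.intro group_hom_axioms.intro G group_BijGroup)
qed

text \<open>The translate of a point is defined inside \<open>X\<close> by the relation
  \<open>rel\<close> between eigencomponents. Existence is Kronecker's theorem with compactness,
  uniqueness is injectivity of \<open>F\<close>, and the laws of an action follow from those of the
  characters \<open>e \<mu>\<close>.\<close>

lemma linearizable_imp_torus_action:
  assumes k: "1 \<le> k" and X: "Ck_manifold k X" and cpt: "compact_space (mfd_top X)"
    and act: "group_action real_group (points X) \<Phi>"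
    and emb: "Ck_embedding k X (Euclidean_mfd n) F" and lin: "linearizing X \<Phi> n F"
  shows "\<exists>l \<Theta>. Ck_torus_action k l X \<Theta> \<and> one_parameter_subgroup \<Phi> l \<Theta>"
proof -
  let ?S = "points X"
  have ch: "charted X" using X by (rule Ck_manifold_charted)
  have Ck: "Ck_map k X (Euclidean_mfd n) F" and imm: "immersion X (Euclidean_mfd n) F"
    and embF: "embedding_map (mfd_top X) (Euclidean_space n) F"
    using emb by (auto simp: Ck_embedding_def Euclidean_mfd_def)
  have Fc: "continuous_map (mfd_top X) (Euclidean_space n) F"
    using Ck by (simp add: Ck_map_def Euclidean_mfd_def)
  have FE: "F \<in> ?S \<rightarrow> Euc n" and Fcj: "\<And>j. j < n \<Longrightarrow> continuous_map (mfd_top X) euclideanreal (\<lambda>x. F x j)"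
    using Fc by (auto simp: continuous_map_Euc_iff)
  have FCk: "Ck_real k X (\<lambda>x. F x a)" if "a < n" for a
    using Ck that by (simp add: Ck_map_Euclidean_iff[OF ch Fc])
  have Fimm: "immersive X n F" using imm immersion_Euclidean_iff[OF ch FE] by blast
  have hF: "homeomorphic_map (mfd_top X) (subtopology (Euclidean_space n) (F ` ?S)) F"
    using embF by (simp add: embedding_map_def)
  have Finj: "inj_on F ?S" by (rule homeomorphic_imp_injective_map[OF hF])
  have bdd: "\<exists>K. \<forall>x\<in>?S. \<bar>F x j\<bar> \<le> K" if j: "j < n" for j
  proof -
    have "compactin (mfd_top X) ?S" using cpt by (simp add: compact_space_def)
    then have "compact ((\<lambda>x. F x j) ` ?S)"
      using image_compactin[OF _ Fcj[OF j]] by (simp add: compactin_euclidean_iff)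
    then have "bounded ((\<lambda>x. F x j) ` ?S)" by (rule compact_imp_bounded)
    then show ?thesis by (auto simp: bounded_iff)
  qed
  obtain M c where M: "finite M"
    and dec: "\<And>j x. j < n \<Longrightarrow> x \<in> ?S \<Longrightarrow>
      of_real (F x j) = (\<Sum>\<mu>\<in>M. \<Sum>k<n. c j \<mu> k * of_real (F x k) :: complex)"
    and eig: "\<And>j \<mu>. j < n \<Longrightarrow> flow_eigen \<Phi> ?S \<mu> (\<lambda>x. \<Sum>k<n. c j \<mu> k * of_real (F x k))"
    using linearizing_eigen_data[OF act lin bdd] by blast
  define u where "u j \<mu> x = (\<Sum>k<n. c j \<mu> k * of_real (F x k))" for j \<mu> x
  have u_cont: "continuous_map (mfd_top X) euclidean (u j \<mu>)" for j \<mu>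
    unfolding u_def
  proof (rule continuous_map_sum)
    fix k assume "k \<in> {..<n}"
    then have "continuous_map (mfd_top X) euclidean ((\<lambda>r. c j \<mu> k * complex_of_real r) \<circ> (\<lambda>x. F x k))"
      by (intro continuous_map_compose[OF Fcj]) (auto intro!: continuous_intros)
    then show "continuous_map (mfd_top X) euclidean (\<lambda>x. c j \<mu> k * complex_of_real (F x k))"
      by (simp add: o_def)
  qed simp
  \<comment> \<open>Characters of the torus are written with a factor 2 pi, which is therefore split
    off the frequencies first.\<close>
  obtain l \<omega> m0 where ind: "integer_independent l \<omega>"
    and m0: "\<And>\<nu>. \<nu> \<in> (\<lambda>\<mu>. \<mu> / (2 * pi)) ` M \<Longrightarrow> \<nu> = (\<Sum>i<l. of_int (m0 \<nu> i :: int) * \<omega> i)"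
    using integer_basis[of "(\<lambda>\<mu>. \<mu> / (2 * pi)) ` M"] M by blast
  define m where "m \<mu> = m0 (\<mu> / (2 * pi))" for \<mu>
  have m: "\<mu> = 2 * pi * (\<Sum>i<l. of_int (m \<mu> i) * \<omega> i)" if "\<mu> \<in> M" for \<mu>
    using m0[of "\<mu> / (2 * pi)"] that by (simp add: m_def field_simps)
  define e where "e \<mu> h = cis (2 * pi * (\<Sum>i<l. of_int (m \<mu> i) * h i))" for \<mu> and h :: "nat \<Rightarrow> real"
  define rel where "rel h x y \<longleftrightarrow> (\<forall>j<n. \<forall>\<mu>\<in>M. u j \<mu> y = e \<mu> h * u j \<mu> x)" for h x y
  \<comment> \<open>The eigencomponents of a point add up to its image under \<open>F\<close>, and
    \<open>F\<close> is injective.\<close>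
  have uniq: "y = z" if "y \<in> ?S" "z \<in> ?S" "rel h x y" "rel h x z" for h x y z
  proof (rule inj_onD[OF Finj _ that(1,2)], rule ext)
    fix j
    show "F y j = F z j"
    proof (cases "j < n")
      case True
      have "complex_of_real (F y j) = (\<Sum>\<mu>\<in>M. u j \<mu> y)" using dec[OF True that(1)] by (simp add: u_def)
      also have "\<dots> = (\<Sum>\<mu>\<in>M. u j \<mu> z)" using that(3,4) True by (simp add: rel_def)
      also have "\<dots> = complex_of_real (F z j)" using dec[OF True that(2)] by (simp add: u_def)
      finally show ?thesis by simp
    qed (use FE that in \<open>auto simp: in_Euc Pi_iff\<close>)
  qed
  have ex: "\<exists>y\<in>?S. rel h x y" if x: "x \<in> ?S" for h x
    unfolding rel_def e_def
  proof (rule torus_translate_exists[OF cpt _ M _ _ _ ind m, where \<Phi> = \<Phi>])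
    show "u j \<mu> (\<Phi> t x) = cis (\<mu> * t) * u j \<mu> x" if "j < n" "\<mu> \<in> M" for j \<mu> t
      using eig[OF that(1), of \<mu>] x by (simp add: flow_eigen_def u_def)
  qed (use x flow_closed[OF act] u_cont in auto)
  define T where "T h = (\<lambda>x\<in>?S. SOME y. y \<in> ?S \<and> rel h x y)" for h
  have T: "T h x \<in> ?S" "rel h x (T h x)" if x: "x \<in> ?S" for h x
    using someI_ex[of "\<lambda>y. y \<in> ?S \<and> rel h x y"] ex[OF x, of h] x by (auto simp: T_def)
  have T_eq: "T h x = y" if "x \<in> ?S" "y \<in> ?S" "rel h x y" for h x y
    using uniq[OF T(1)[OF that(1)] that(2) T(2)[OF that(1)] that(3)] .
  have T_ext: "T h \<in> extensional ?S" for h by (simp add: T_def)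
  have e_add: "e \<mu> (\<lambda>i. h i + h' i) = e \<mu> h * e \<mu> h'" for \<mu> h h'
    by (simp add: e_def cis_mult algebra_simps sum.distrib)
  have T_add: "T (\<lambda>i. h i + h' i) x = T h (T h' x)" if x: "x \<in> ?S" for h h' x
  proof (rule T_eq[OF x])
    note y = T[OF x, of h'] and z = T[OF T(1)[OF x], of h h']
    show "T h (T h' x) \<in> ?S" by (rule z(1))
    show "rel (\<lambda>i. h i + h' i) x (T h (T h' x))"
      using y(2) z(2) unfolding rel_def e_add by simp
  qed
  have T_int: "T h = T h'" if "torus_proj l h = torus_proj l h'" "h \<in> Euc l" "h' \<in> Euc l" for h h'
  proof -
    have "e \<mu> h = e \<mu> h'" for \<mu>
    proof -
      define d where "d i = \<lfloor>h i - h' i\<rfloor>" for i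
      have "h' i = h i - of_int (d i)" if "i < l" for i
        using torus_proj_eq_iff[OF \<open>h \<in> Euc l\<close> \<open>h' \<in> Euc l\<close>] \<open>torus_proj l h = torus_proj l h'\<close> \<open>i < l\<close>
        by (simp add: d_def)
      then have "(\<Sum>i<l. of_int (m \<mu> i) * h' i) = (\<Sum>i<l. of_int (m \<mu> i) * (h i - of_int (d i)))" by simp
      then show ?thesis unfolding e_def by (simp only: cis_integer_shift)
    qed
    then have "rel h = rel h'" by (simp add: rel_def fun_eq_iff)
    then show ?thesis by (simp add: T_def)
  qed
  \<comment> \<open>By invariance under the lattice the choice of the representative is
    immaterial.\<close>
  define \<Theta> where "\<Theta> H = T (SOME h. h \<in> Euc l \<and> torus_proj l h = H)" for H
  have \<Theta>: "\<Theta> (torus_proj l h) = T h" if "h \<in> Euc l" for h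
  proof -
    let ?s = "SOME h'. h' \<in> Euc l \<and> torus_proj l h' = torus_proj l h"
    have "?s \<in> Euc l \<and> torus_proj l ?s = torus_proj l h" by (rule someI[of _ h]) (use that in simp)
    then show ?thesis unfolding \<Theta>_def using T_int that by blast
  qed
  have action: "group_action (torus_group l) ?S \<Theta>"
  proof (rule group_actionI[OF group_torus])
    show "\<Theta> H \<in> extensional ?S" for H by (simp add: \<Theta>_def T_ext)
    show "\<Theta> H x \<in> ?S" if "x \<in> ?S" for H x using T(1)[OF that] by (simp add: \<Theta>_def)
    show "\<Theta> (H \<otimes>\<^bsub>torus_group l\<^esub> K) x = \<Theta> H (\<Theta> K x)"
      if HK: "H \<in> carrier (torus_group l)" "K \<in> carrier (torus_group l)" and x: "x \<in> ?S" for H K x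
    proof -
      obtain h h' where h: "h \<in> Euc l" "h' \<in> Euc l" "H = torus_proj l h" "K = torus_proj l h'"
        using HK by (auto simp: carrier_torus)
      moreover have "(\<lambda>i. h i + h' i) \<in> Euc l" using h by (simp add: in_Euc)
      ultimately show ?thesis using T_add[OF x] by (simp add: torus_mult \<Theta>)
    qed
    show "\<Theta> \<one>\<^bsub>torus_group l\<^esub> x = x" if x: "x \<in> ?S" for x
    proof -
      have "\<Theta> \<one>\<^bsub>torus_group l\<^esub> = T (\<lambda>_. 0)" unfolding torus_one by (rule \<Theta>) (simp add: in_Euc)
      moreover have "T (\<lambda>_. 0) x = x" by (rule T_eq[OF x x]) (simp add: rel_def e_def)
      ultimately show ?thesis by simp
    qed
  qed
  let ?N = "prod_mfd (torus_mfd l) X" and ?g = "\<lambda>(H, x). \<Theta> H x"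
  have N: "charted ?N" by (rule charted_prod_mfd[OF charted_torus ch])
  have pN: "points ?N = carrier (torus_group l) \<times> ?S" by (simp add: prod_mfd_def torus_mfd_def)
  have gS: "?g p \<in> ?S" if "p \<in> points ?N" for p
    using that T(1) by (auto simp: pN \<Theta>_def)
  \<comment> \<open>After translation by \<open>h\<close>, every component of \<open>F\<close> is a
    trigonometric polynomial in \<open>h\<close> with the components of \<open>F x\<close> as
    coefficients.\<close>
  have FgCk: "Ck_real k ?N (\<lambda>p. F (?g p) a)" if a: "a < n" for a
  proof (rule Ck_real_torus_prod[OF ch FCk, where M = M and m = m and a = "\<lambda>\<mu> k. Re (c a \<mu> k)" and b = "\<lambda>\<mu> k. Im (c a \<mu> k)"])
    fix h x assume h: "h \<in> Euc l" and x: "x \<in> ?S"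
    have re: "Re (cis \<theta> * (z * complex_of_real r)) = (Re z * cos \<theta> - Im z * sin \<theta>) * r" for \<theta> z r
      by (simp add: algebra_simps)
    have "complex_of_real (F (T h x) a) = (\<Sum>\<mu>\<in>M. u a \<mu> (T h x))"
      using dec[OF a T(1)[OF x]] by (simp add: u_def)
    also have "\<dots> = (\<Sum>\<mu>\<in>M. e \<mu> h * u a \<mu> x)" using T(2)[OF x, of h] a by (simp add: rel_def)
    finally have "F (T h x) a = Re (\<Sum>\<mu>\<in>M. e \<mu> h * u a \<mu> x)" by (metis Re_complex_of_real)
    also have "\<dots> = (\<Sum>\<mu>\<in>M. \<Sum>k<n.
      (Re (c a \<mu> k) * cos (2 * pi * (\<Sum>i<l. of_int (m \<mu> i) * h i)) -
       Im (c a \<mu> k) * sin (2 * pi * (\<Sum>i<l. of_int (m \<mu> i) * h i))) * F x k)"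
      unfolding e_def u_def sum_distrib_left Re_sum re by (rule refl)
    finally show "F (case (torus_proj l h, x) of (H, x) \<Rightarrow> \<Theta> H x) a = (\<Sum>\<mu>\<in>M. \<Sum>k<n.
      (Re (c a \<mu> k) * cos (2 * pi * (\<Sum>i<l. of_int (m \<mu> i) * h i)) -
       Im (c a \<mu> k) * sin (2 * pi * (\<Sum>i<l. of_int (m \<mu> i) * h i))) * F x k)"
      using h by (simp add: \<Theta>)
  qed
  have g_cont: "continuous_map (mfd_top ?N) (mfd_top X) ?g"
  proof -
    \<comment> \<open>\<open>F\<close> after the action is continuous, and the continuous inverse
      \<open>G\<close> of the embedding removes \<open>F\<close> again.\<close>
    obtain G where G: "homeomorphic_maps (mfd_top X) (subtopology (Euclidean_space n) (F ` ?S)) F G"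
      using hF homeomorphic_map_maps by blast
    have "continuous_map (mfd_top ?N) (subtopology (Euclidean_space n) (F ` ?S)) (\<lambda>p. F (?g p))"
      unfolding continuous_map_in_subtopology continuous_map_Euc_iff
      using gS FE Ck_real_continuous[OF N FgCk] by auto
    moreover have "continuous_map (subtopology (Euclidean_space n) (F ` ?S)) (mfd_top X) G"
      using G by (simp add: homeomorphic_maps_def)
    ultimately have "continuous_map (mfd_top ?N) (mfd_top X) (G \<circ> (\<lambda>p. F (?g p)))"
      by (rule continuous_map_compose)
    then show ?thesis
      by (rule continuous_map_eq) (use G gS in \<open>auto simp: homeomorphic_maps_def\<close>)
  qed
  have "Ck_map k ?N X ?g"
    by (rule Ck_map_from_immersive[OF N ch k FCk Fimm g_cont FgCk])
  with action have torus: "Ck_torus_action k l X \<Theta>" by (simp add: Ck_torus_action_def)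
  have "one_parameter_subgroup \<Phi> l \<Theta>"
    unfolding one_parameter_subgroup_def
  \<comment> \<open>The values of \<open>\<omega>\<close> from \<open>l\<close> on are arbitrary and
    are cut off to obtain a vector of \<open>Euc l\<close>.\<close>
  proof (intro bexI[of _ "left_part l \<omega>"] allI)
    show "left_part l \<omega> \<in> topspace (Euclidean_space l)" by (simp add: left_part_def in_Euc)
    fix t
    have "(\<lambda>i. left_part l \<omega> i * t) \<in> Euc l" by (simp add: left_part_def in_Euc)
    then have "\<Theta> (torus_proj l (\<lambda>i. left_part l \<omega> i * t)) = T (\<lambda>i. left_part l \<omega> i * t)" by (rule \<Theta>)
    moreover have "\<Phi> t = T (\<lambda>i. left_part l \<omega> i * t)"
    proof (rule extensionalityI[OF flow_extensional[OF act] T_ext])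
      fix x assume x: "x \<in> ?S"
      have "e \<mu> (\<lambda>i. left_part l \<omega> i * t) = cis (\<mu> * t)" if "\<mu> \<in> M" for \<mu>
      proof -
        have "(\<Sum>i<l. of_int (m \<mu> i) * (left_part l \<omega> i * t)) = (\<Sum>i<l. of_int (m \<mu> i) * \<omega> i) * t"
          by (simp add: left_part_def sum_distrib_right mult.assoc)
        then have "e \<mu> (\<lambda>i. left_part l \<omega> i * t) = cis (2 * pi * (\<Sum>i<l. of_int (m \<mu> i) * \<omega> i) * t)"
          by (simp add: e_def mult.assoc)
        then show ?thesis using m[OF that] by simp
      qed
      then have "rel (\<lambda>i. left_part l \<omega> i * t) x (\<Phi> t x)"
        using eig x by (simp add: rel_def flow_eigen_def u_def)
      from T_eq[OF x flow_closed[OF act x] this] show "\<Phi> t x = T (\<lambda>i. left_part l \<omega> i * t) x" by simp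
    qed
    ultimately show "\<Phi> t = \<Theta> (torus_proj l (\<lambda>i. left_part l \<omega> i * t))" by simp
  qed
  with torus show ?thesis by blast
qed

section \<open>From a torus action to a linearizing embedding\<close>

subsection \<open>Fourier coefficients on the circle\<close>

lemma integral_reflect_unit:
  fixes f :: "real \<Rightarrow> real"
  assumes "continuous_on {0..1} f"
  shows "integral {0..1} (\<lambda>t. f (1 - t)) = integral {0..1} f"
proof -
  have "(f has_integral integral {0..1} f) (cbox 0 1)"
    using assms by (simp add: integrable_integral integrable_continuous_interval)
  from has_integral_affinity[OF this, of "-1" 1]
  have "((\<lambda>t. f (1 - t)) has_integral integral {0..1} f) ((\<lambda>x. 1 - x) ` {0..1})" by simp
  moreover have "(\<lambda>x. 1 - x) ` {0..1} = {0..1::real}"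
    using image_affinity_atLeastAtMost_diff[of "-1" "-1" "0::real" 1] by simp
  ultimately show ?thesis by (simp add: integral_unique)
qed

text \<open>Periodicity reduces the shift to its fractional part \<open>r\<close>; the piece of the
  integral beyond 1 is then moved back to the beginning of the unit interval.\<close>

lemma integral_periodic_shift:
  fixes f :: "real \<Rightarrow> complex"
  assumes cont: "continuous_on UNIV f" and per: "\<And>t. f (t + 1) = f t"
  shows "integral {0..1} (\<lambda>t. f (t + s)) = integral {0..1} f"
proof -
  have shift: "integral {a..b} (\<lambda>t. f (t + c)) = integral {a + c..b + c} f" for a b c
  proof -
    have "(f has_integral integral {a + c..b + c} f) (cbox (a + c) (b + c))"
      using continuous_on_subset[OF cont, of "{a + c..b + c}"]
      by (simp add: integrable_integral integrable_continuous_interval)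
    from has_integral_affinity[OF this, of 1 c]
    have "((\<lambda>t. f (t + c)) has_integral integral {a + c..b + c} f) ((\<lambda>x. x - c) ` {a + c..b + c})" by simp
    then show ?thesis by (simp add: integral_unique)
  qed
  have int: "f integrable_on {a..b}" for a b
    using continuous_on_subset[OF cont, of "{a..b}"] by (simp add: integrable_continuous_interval)
  have per_nat: "f (t + of_nat n) = f t" for t n
  proof (induction n)
    case (Suc n)
    have "t + of_nat (Suc n) = (t + of_nat n) + 1" by simp
    then show ?case by (simp only: per Suc)
  qed simp
  have per_int: "f (t + of_int n) = f t" for t n
  proof (cases "0 \<le> n")
    case True then show ?thesis using per_nat[of t "nat n"] by simp
  next
    case False then show ?thesis using per_nat[of "t + of_int n" "nat (- n)"] by simp
  qed
  define r where "r = frac s"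
  have r: "0 \<le> r" "r < 1" by (simp_all add: r_def frac_lt_1)
  have "f (t + s) = f (t + r)" for t
    using per_int[of "t + r" "\<lfloor>s\<rfloor>"] by (simp add: r_def frac_def)
  then have "integral {0..1} (\<lambda>t. f (t + s)) = integral {r..1 + r} f"
    using shift[of 0 1 r] by simp
  also have "\<dots> = integral {r..1} f + integral {1..1 + r} f"
    by (rule Henstock_Kurzweil_Integration.integral_combine[symmetric]) (use r int in auto)
  also have "integral {1..1 + r} f = integral {0..r} f"
    using shift[of 0 1 r] shift[of 0 r 1] per by (simp add: add.commute)
  also have "integral {r..1} f + integral {0..r} f = integral {0..1} f"
    by (subst add.commute) (rule Henstock_Kurzweil_Integration.integral_combine; use r int in auto)
  finally show ?thesis .
qed

text \<open>The cosine coefficients see only the even part \<open>E t = g t + g (1 - t)\<close>,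
  whose value at 0 is twice \<open>g 0\<close> by the condition at the ends. Polynomials in the
  cosine approximate \<open>E\<close> uniformly, so \<open>E\<close> is orthogonal to itself and
  vanishes.\<close>

lemma fourier_zero:
  fixes g :: "real \<Rightarrow> real"
  assumes g: "continuous_on {0..1} g"
    and zero: "\<And>m::nat. integral {0..1} (\<lambda>t. cos (2 * pi * of_nat m * t) * g t) = 0"
    and per: "g 0 = g 1"
  shows "g 0 = 0"
proof -
  define co where "co = (\<lambda>t::real. cos (2 * pi * t))"
  define Z where "Z = {h. continuous_on {0..1} h \<and> (\<forall>m::nat. integral {0..1} (\<lambda>t. cos (2 * pi * of_nat m * t) * h t) = 0)}"
  have int: "(\<lambda>t. cos (2 * pi * of_nat m * t) * h t) integrable_on {0..1}" if "continuous_on {0..1} h" for m and h :: "real \<Rightarrow> real"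
    by (intro integrable_continuous_interval continuous_intros that)
  have Z_add: "(\<lambda>t. h t + k t) \<in> Z" if "h \<in> Z" "k \<in> Z" for h k
    using that int by (auto simp: Z_def distrib_left integral_add intro: continuous_intros)
  have Z_scale: "(\<lambda>t. c * h t) \<in> Z" if "h \<in> Z" for c h
    using that by (auto simp: Z_def mult.left_commute[of _ c] intro: continuous_intros)
  have Z_cos: "(\<lambda>t. co t * h t) \<in> Z" if h: "h \<in> Z" for h
  proof -
    have hc: "continuous_on {0..1} h" and hz: "\<And>m::nat. integral {0..1} (\<lambda>t. cos (2 * pi * of_nat m * t) * h t) = 0"
      using h by (auto simp: Z_def)
    have "integral {0..1} (\<lambda>t. cos (2 * pi * of_nat m * t) * (co t * h t)) = 0" for m :: nat
    proof -
      \<comment> \<open>The absolute value of m - 1: for \<open>m = 0\<close> the product formula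
        yields cos(-2 pi t), which is again the first cosine.\<close>
      define m' where "m' = (if m = 0 then 1 else m - 1)"
      have "cos (2 * pi * of_nat m * t) * co t =
          (cos (2 * pi * of_nat (Suc m) * t) + cos (2 * pi * of_nat m' * t)) / 2" for t :: real
      proof -
        have "cos (2 * pi * of_nat m * t) * cos (2 * pi * t) =
          (cos (2 * pi * of_nat m * t - 2 * pi * t) + cos (2 * pi * of_nat m * t + 2 * pi * t)) / 2"
          by (rule cos_times_cos)
        moreover have "cos (2 * pi * of_nat m * t - 2 * pi * t) = cos (2 * pi * of_nat m' * t)"
          by (cases m) (simp_all add: m'_def algebra_simps)
        ultimately show ?thesis by (simp add: co_def algebra_simps)
      qed
      then have "(\<lambda>t. cos (2 * pi * of_nat m * t) * (co t * h t)) =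
          (\<lambda>t. (1 / 2) * (cos (2 * pi * of_nat (Suc m) * t) * h t + cos (2 * pi * of_nat m' * t) * h t))"
        by (simp add: mult.assoc[symmetric] add_divide_distrib distrib_right)
      then show ?thesis
        by (simp only: integral_mult_right integral_add[OF int[OF hc] int[OF hc]] hz) simp
    qed
    moreover have "continuous_on {0..1} (\<lambda>t. co t * h t)" unfolding co_def by (intro continuous_intros hc)
    ultimately show ?thesis by (simp add: Z_def)
  qed
  have gZ: "g \<in> Z" using g zero by (simp add: Z_def)
  \<comment> \<open>Symmetric multipliers that preserve the vanishing of all cosine coefficients
    form a ring, and by the product formula \<open>co\<close> belongs to it.\<close>
  define R where "R = {q. continuous_on UNIV q \<and> (\<forall>t. q (1 - t) = q t) \<and> (\<forall>h\<in>Z. (\<lambda>t. q t * h t) \<in> Z)}"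
  have co_R: "co \<in> R"
  proof -
    have "co (1 - t) = co t" for t
      using cos_2pi_minus[of "2 * pi * t"] by (simp add: co_def algebra_simps)
    then show ?thesis using Z_cos by (auto simp: R_def co_def intro!: continuous_intros)
  qed
  \<comment> \<open>On half of the circle \<open>co\<close> is injective, so the Stone-Weierstrass
    theorem applies there; the symmetry of \<open>E\<close> and of the members of \<open>R\<close>
    later extends the estimate to the unit interval.\<close>
  interpret function_ring_on R "{0..1/2}"
  proof
    show "continuous_on {0..1/2} f" if "f \<in> R" for f
      using that continuous_on_subset by (auto simp: R_def)
    show "(\<lambda>t. f t + k t) \<in> R" if "f \<in> R" "k \<in> R" for f k
      using that Z_add by (auto simp: R_def distrib_right intro: continuous_intros)
    show "(\<lambda>t. f t * k t) \<in> R" if "f \<in> R" "k \<in> R" for f k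
      using that by (auto simp: R_def mult.assoc intro: continuous_intros)
    show "(\<lambda>_. c) \<in> R" for c using Z_scale by (auto simp: R_def)
    show "\<exists>f\<in>R. f x \<noteq> f y" if "x \<in> {0..1/2}" "y \<in> {0..1/2}" "x \<noteq> y" for x y
    proof (intro bexI[OF _ co_R])
      have "2 * pi * x \<le> pi" "2 * pi * y \<le> pi"
        using mult_left_mono[of x "1/2" "2 * pi"] mult_left_mono[of y "1/2" "2 * pi"] that by auto
      then show "co x \<noteq> co y"
        using cos_inj_pi[of "2 * pi * x" "2 * pi * y"] that by (auto simp: co_def)
    qed
  qed simp
  define E where "E t = g t + g (1 - t)" for t
  have g': "continuous_on {0..1} (\<lambda>t. g (1 - t))"
    by (rule continuous_on_compose2[OF g]) (auto intro!: continuous_intros)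
  have E: "continuous_on {0..1} E" unfolding E_def by (intro continuous_intros g g')
  have Esym: "E (1 - t) = E t" for t by (simp add: E_def)
  have qg: "integral {0..1} (\<lambda>t. q t * g t) = 0" if "q \<in> R" for q
  proof -
    have "(\<lambda>t. q t * g t) \<in> Z" using that gZ by (auto simp: R_def)
    then have "\<forall>m::nat. integral {0..1} (\<lambda>t. cos (2 * pi * of_nat m * t) * (q t * g t)) = 0"
      unfolding Z_def by blast
    from spec[OF this, of 0] show ?thesis by simp
  qed
  \<comment> \<open>By reflection the two summands of the second factor \<open>E t\<close>
    contribute equally.\<close>
  have EE: "integral {0..1} (\<lambda>t. E t * E t) = 2 * integral {0..1} (\<lambda>t. E t * g t)"
  proof -
    have c1: "continuous_on {0..1} (\<lambda>t. E t * g t)" by (intro continuous_intros E g)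
    have c2: "continuous_on {0..1} (\<lambda>t. E t * g (1 - t))" by (intro continuous_intros E g')
    have "integral {0..1} (\<lambda>t. E t * E t) = integral {0..1} (\<lambda>t. E t * g t + E t * g (1 - t))"
      by (simp add: E_def algebra_simps)
    also have "\<dots> = integral {0..1} (\<lambda>t. E t * g t) + integral {0..1} (\<lambda>t. E t * g (1 - t))"
      by (intro integral_add integrable_continuous_interval c1 c2)
    also have "integral {0..1} (\<lambda>t. E t * g (1 - t)) = integral {0..1} (\<lambda>t. E t * g t)"
      using integral_reflect_unit[OF c1] by (simp add: Esym)
    finally show ?thesis by simp
  qed
  define K where "K = integral {0..1} (\<lambda>t. \<bar>g t\<bar>)"
  have K: "0 \<le> K" unfolding K_def by (intro integral_nonneg integrable_continuous_interval continuous_intros g) auto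
  have "integral {0..1} (\<lambda>t. E t * g t) \<le> \<epsilon>" if e: "\<epsilon> > 0" for \<epsilon>
  proof -
    \<comment> \<open>\<open>K\<close> is the integral of the absolute value of \<open>g\<close>, by
      which the error gets multiplied; adding 1 keeps the denominator positive.\<close>
    obtain q where q: "q \<in> R" "\<And>t. t \<in> {0..1/2} \<Longrightarrow> \<bar>E t - q t\<bar> < \<epsilon> / (K + 1)"
      using Stone_Weierstrass_basic[OF continuous_on_subset[OF E], of "\<epsilon> / (K + 1)"] K e by auto
    have qc: "continuous_on {0..1} q" and qs: "\<And>t. q (1 - t) = q t"
      using q(1) continuous_on_subset by (auto simp: R_def)
    have close: "\<bar>E t - q t\<bar> \<le> \<epsilon> / (K + 1)" if "t \<in> {0..1}" for t
    proof (cases "t \<le> 1/2")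
      case True then show ?thesis using q(2)[of t] that by simp
    next
      case False then show ?thesis using q(2)[of "1 - t"] that by (simp add: Esym qs)
    qed
    have i1: "(\<lambda>t. E t * g t) integrable_on {0..1}" "(\<lambda>t. q t * g t) integrable_on {0..1}"
      "(\<lambda>t. (E t - q t) * g t) integrable_on {0..1}" "(\<lambda>t. \<epsilon> / (K + 1) * \<bar>g t\<bar>) integrable_on {0..1}"
      by (intro integrable_continuous_interval continuous_intros E g qc)+
    have "integral {0..1} (\<lambda>t. E t * g t) = integral {0..1} (\<lambda>t. (E t - q t) * g t)"
      using integral_diff[OF i1(1,2)] qg[OF q(1)] by (simp add: left_diff_distrib)
    also have "\<dots> \<le> integral {0..1} (\<lambda>t. \<epsilon> / (K + 1) * \<bar>g t\<bar>)"
    proof (rule integral_le[OF i1(3,4)])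
      fix t :: real assume "t \<in> {0..1}"
      have "(E t - q t) * g t \<le> \<bar>E t - q t\<bar> * \<bar>g t\<bar>" by (metis abs_ge_self abs_mult)
      also have "\<dots> \<le> \<epsilon> / (K + 1) * \<bar>g t\<bar>" by (intro mult_right_mono close \<open>t \<in> {0..1}\<close>) simp
      finally show "(E t - q t) * g t \<le> \<epsilon> / (K + 1) * \<bar>g t\<bar>" .
    qed
    also have "\<dots> = \<epsilon> * (K / (K + 1))" by (simp add: K_def)
    also have "\<dots> \<le> \<epsilon> * 1" using K e by (intro mult_left_mono) auto
    finally show ?thesis by simp
  qed
  then have "integral {0..1} (\<lambda>t. E t * g t) \<le> 0" by (rule field_le_epsilon[of _ 0, simplified])
  moreover have "0 \<le> integral {0..1} (\<lambda>t. E t * E t)"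
    by (intro integral_nonneg integrable_continuous_interval continuous_intros E) auto
  ultimately have "integral {0..1} (\<lambda>t. E t * E t) = 0" using EE by linarith
  then have "E 0 * E 0 = 0"
    by (subst (asm) integral_eq_0_iff) (auto intro!: continuous_intros E)
  then show ?thesis using per by (simp add: E_def)
qed

subsection \<open>Kernels of differentials\<close>

text \<open>In \<open>d\<close> unknowns no more than \<open>d\<close> equations are ever needed:
  one member with nonzero last coefficient eliminates the last unknown, and induction treats the
  rest.\<close>

lemma finite_trivial_kernel:
  fixes r :: "'f \<Rightarrow> nat \<Rightarrow> real"
  assumes "\<And>w. (\<forall>f\<in>A. (\<Sum>i<d. r f i * w i) = 0) \<Longrightarrow> \<forall>i<d. w i = 0"
  shows "\<exists>G. finite G \<and> G \<subseteq> A \<and> (\<forall>w. (\<forall>f\<in>G. (\<Sum>i<d. r f i * w i) = 0) \<longrightarrow> (\<forall>i<d. w i = 0))"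
  using assms
proof (induction d arbitrary: r)
  case 0 show ?case by (intro exI[of _ "{}"]) auto
next
  case (Suc d)
  obtain f0 where f0: "f0 \<in> A" "r f0 d \<noteq> 0"
  proof (rule ccontr)
    assume "\<not> thesis"
    with that have "\<And>f. f \<in> A \<Longrightarrow> r f d = 0" by blast
    then have "\<forall>i<Suc d. (if i = d then 1 else 0 :: real) = 0" by (intro Suc.prems) simp
    then show False by auto
  qed
  define r' where "r' f i = r f i - r f d / r f0 d * r f0 i" for f i
  have r': "(\<Sum>i<d. r' f i * w i) = (\<Sum>i<d. r f i * w i) - r f d / r f0 d * (\<Sum>i<d. r f0 i * w i)" for f w
    by (simp add: r'_def left_diff_distrib sum_subtractf sum_distrib_left mult.assoc)
  have "\<exists>G. finite G \<and> G \<subseteq> A \<and> (\<forall>w. (\<forall>f\<in>G. (\<Sum>i<d. r' f i * w i) = 0) \<longrightarrow> (\<forall>i<d. w i = 0))"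
  proof (rule Suc.IH)
    fix w assume w: "\<forall>f\<in>A. (\<Sum>i<d. r' f i * w i) = 0"
    define w' where "w' = w(d := - (\<Sum>i<d. r f0 i * w i) / r f0 d)"
    have eq: "(\<Sum>i<Suc d. r f i * w' i) = (\<Sum>i<d. r' f i * w i)" for f
      by (simp add: r' w'_def)
    have "\<forall>f\<in>A. (\<Sum>i<Suc d. r f i * w' i) = 0" using w by (simp only: eq)
    then have "\<forall>i<Suc d. w' i = 0" by (rule Suc.prems)
    then show "\<forall>i<d. w i = 0" by (simp add: w'_def) (metis less_SucI less_irrefl)
  qed
  then obtain G where G: "finite G" "G \<subseteq> A"
    "\<And>w. (\<forall>f\<in>G. (\<Sum>i<d. r' f i * w i) = 0) \<Longrightarrow> \<forall>i<d. w i = 0" by blast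
  show ?case
  proof (rule exI[of _ "insert f0 G"], rule conjI[OF _ conjI[OF _ allI[OF impI]]])
    show "finite (insert f0 G)" "insert f0 G \<subseteq> A" using G f0 by auto
    fix w assume w: "\<forall>f\<in>insert f0 G. (\<Sum>i<Suc d. r f i * w i) = 0"
    have s: "(\<Sum>i<d. r f i * w i) = - r f d * w d" if "f \<in> insert f0 G" for f using w that by auto
    have "(\<Sum>i<d. r' f i * w i) = 0" if "f \<in> G" for f
      using s[of f] s[of f0] that f0 by (simp add: r')
    then have *: "\<forall>i<d. w i = 0" using G(3) by blast
    then have "r f0 d * w d = 0" using s[of f0] by simp
    then show "\<forall>i<Suc d. w i = 0" using * f0(2) less_Suc_eq by auto
  qed
qed

text \<open>Dually, the differentials of the members of \<open>A\<close> at \<open>x\<close> span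
  the cotangent space.\<close>

definition chart_kernel_trivial :: "'a chart \<Rightarrow> 'a \<Rightarrow> ('a \<Rightarrow> real) set \<Rightarrow> bool" where
  "chart_kernel_trivial c x A \<longleftrightarrow> (\<forall>w.
     (\<forall>f\<in>A. (\<Sum>i<chart_dim c. partial_deriv i (\<lambda>u. f (chart_inv c u)) (chart_map c x) * w i) = 0) \<longrightarrow>
     (\<forall>i<chart_dim c. w i = 0))"

text \<open>By the chain rule the chart transition sends a kernel vector \<open>w\<close> to a
  kernel vector \<open>v\<close>; as the transition is invertible, \<open>v = 0\<close> forces
  \<open>w = 0\<close>.\<close>

lemma chart_kernel_trivial_transfer:
  assumes M: "Ck_manifold k M" and k: "1 \<le> k" and c: "c \<in> mfd_atlas M" and e: "e \<in> mfd_atlas M"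
    and x: "x \<in> chart_dom c" "x \<in> chart_dom e"
    and A: "\<And>f. f \<in> A \<Longrightarrow> Ck_real k M f"
    and triv: "chart_kernel_trivial e x A"
  shows "chart_kernel_trivial c x A"
  unfolding chart_kernel_trivial_def
proof (intro allI impI)
  fix w :: "nat \<Rightarrow> real" and i0
  assume w: "\<forall>f\<in>A. (\<Sum>i<chart_dim c. partial_deriv i (\<lambda>u. f (chart_inv c u)) (chart_map c x) * w i) = 0"
    and i0: "i0 < chart_dim c"
  have ch: "charted M" using M by (rule Ck_manifold_charted)
  have cc: "chart_of (mfd_top M) c" and ee: "chart_of (mfd_top M) e" using ch c e chartedD by blast+
  have k1: "enat (Suc 0) \<le> k" using k by (simp add: one_enat_def)
  define trans where "trans a b = chart_map b \<circ> chart_inv a" for a b :: "'a chart"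
  define dom where "dom a b = chart_map a ` (chart_dom a \<inter> id -` chart_dom b)" for a b :: "'a chart"
  have dom: "openin (Euclidean_space (chart_dim a)) (dom a b)"
    and tr: "\<And>j. j < chart_dim b \<Longrightarrow> Ck_fun_nat (Suc 0) (chart_dim a) (dom a b) (\<lambda>u. trans a b u j)"
    and img: "trans a b ` dom a b \<subseteq> dom b a"
    and inverse: "\<And>u. u \<in> dom a b \<Longrightarrow> trans b a (trans a b u) = u"
    and mem: "\<And>u. u \<in> dom a b \<Longrightarrow> chart_inv b (trans a b u) = chart_inv a u"
    if ab: "a \<in> mfd_atlas M" "b \<in> mfd_atlas M" for a b
  proof -
    have aa: "chart_of (mfd_top M) a" and bb: "chart_of (mfd_top M) b" using ch ab chartedD by blast+
    show "openin (Euclidean_space (chart_dim a)) (dom a b)"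
      unfolding dom_def by (rule openin_chart_preimage[OF aa chart_of_openin_dom[OF bb]]) simp
    have "local_Ck k a b id" using M ab by (simp add: Ck_manifold_def)
    then show "Ck_fun_nat (Suc 0) (chart_dim a) (dom a b) (\<lambda>u. trans a b u j)" if "j < chart_dim b" for j
      using that k1 by (simp add: local_Ck_def Ck_on_def dom_def local_rep_def trans_def)
    show "trans a b ` dom a b \<subseteq> dom b a"
      by (auto simp: trans_def dom_def chart_inv_map[OF aa])
    show "trans b a (trans a b u) = u" "chart_inv b (trans a b u) = chart_inv a u" if "u \<in> dom a b" for u
      using that by (auto simp: trans_def dom_def chart_inv_map[OF aa] chart_inv_map[OF bb])
  qed
  let ?u = "chart_map c x" and ?\<tau> = "trans c e"
  have u: "?u \<in> dom c e" using x by (auto simp: dom_def)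
  have \<tau>u: "?\<tau> ?u = chart_map e x" using x by (simp add: trans_def chart_inv_map[OF cc])
  define v where "v j = (\<Sum>i<chart_dim c. partial_deriv i (\<lambda>u. ?\<tau> u j) ?u * w i)" for j
  have chain: "(\<Sum>i<chart_dim c. partial_deriv i h ?u * w i) =
      (\<Sum>j<chart_dim e. partial_deriv j g (chart_map e x) * v j)"
    if g: "Ck_fun_nat (Suc 0) (chart_dim e) (dom e c) g" and hg: "\<And>u. u \<in> dom c e \<Longrightarrow> h u = g (?\<tau> u)" for g h
  proof -
    have "partial_deriv i h ?u = (\<Sum>j<chart_dim e. partial_deriv j g (chart_map e x) * partial_deriv i (\<lambda>u. ?\<tau> u j) ?u)"
      if i: "i < chart_dim c" for i
    proof -
      have "partial_deriv i h ?u = partial_deriv i (\<lambda>u. g (?\<tau> u)) ?u"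
        by (rule partial_deriv_cong[OF dom[OF c e] hg u i])
      also have "\<dots> = (\<Sum>j<chart_dim e. partial_deriv j g (?\<tau> ?u) * partial_deriv i (\<lambda>u. ?\<tau> u j) ?u)"
        unfolding partial_deriv_def[of i "\<lambda>u. g (?\<tau> u)"]
        by (rule DERIV_imp_deriv[OF partial_compose[OF dom[OF c e] dom[OF e c] g tr[OF c e] img[OF c e] u i]])
      finally show ?thesis unfolding \<tau>u .
    qed
    then have "(\<Sum>i<chart_dim c. partial_deriv i h ?u * w i) =
      (\<Sum>i<chart_dim c. \<Sum>j<chart_dim e. partial_deriv j g (chart_map e x) * partial_deriv i (\<lambda>u. ?\<tau> u j) ?u * w i)"
      by (simp add: sum_distrib_right)
    also have "\<dots> = (\<Sum>j<chart_dim e. partial_deriv j g (chart_map e x) * v j)"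
      by (subst sum.swap) (simp add: v_def sum_distrib_left mult.assoc)
    finally show ?thesis .
  qed
  have "(\<Sum>j<chart_dim e. partial_deriv j (\<lambda>u. f (chart_inv e u)) (chart_map e x) * v j) = 0" if f: "f \<in> A" for f
  proof -
    have "dom e c \<subseteq> chart_img e" by (auto simp: dom_def)
    from Ck_fun_nat_subset[OF Ck_realD[OF A[OF f] e k1] this]
    have "(\<Sum>i<chart_dim c. partial_deriv i (\<lambda>u. f (chart_inv c u)) ?u * w i) =
      (\<Sum>j<chart_dim e. partial_deriv j (\<lambda>u. f (chart_inv e u)) (chart_map e x) * v j)"
      by (rule chain) (simp add: mem[OF c e])
    then show ?thesis using w f by simp
  qed
  with triv have v0: "\<forall>j<chart_dim e. v j = 0" unfolding chart_kernel_trivial_def by blast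
  \<comment> \<open>The coordinate \<open>i0\<close> is a component of the inverse transition
    composed with the transition, so its derivative along \<open>w\<close> is a derivative along
    \<open>v\<close>.\<close>
  have "w i0 = (\<Sum>i<chart_dim c. (if i = i0 then 1 else 0) * w i)"
    using i0 by (simp add: if_distrib[of "\<lambda>t. t * _"] sum.delta cong: if_cong)
  also have "\<dots> = (\<Sum>i<chart_dim c. partial_deriv i (\<lambda>u. u i0) ?u * w i)"
  proof (rule sum.cong)
    fix i
    have "((\<lambda>t. (?u(i := t)) i0) has_real_derivative (if i = i0 then 1 else 0)) (at (?u i))"
      by (cases "i = i0") auto
    then have "partial_deriv i (\<lambda>u. u i0) ?u = (if i = i0 then 1 else 0)"
      unfolding partial_deriv_def by (rule DERIV_imp_deriv)
    then show "(if i = i0 then 1 else 0) * w i = partial_deriv i (\<lambda>u. u i0) ?u * w i" by simp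
  qed simp
  also have "\<dots> = (\<Sum>j<chart_dim e. partial_deriv j (\<lambda>u. trans e c u i0) (chart_map e x) * v j)"
    by (rule chain[OF tr[OF e c i0]]) (simp add: inverse[OF c e])
  also have "\<dots> = 0" using v0 by simp
  finally show "w i0 = 0" .
qed

subsection \<open>Separation of points and tangent vectors\<close>

text \<open>Injectivity and immersivity of the possibly infinite-dimensional map whose components
  are the members of \<open>A\<close>.\<close>

definition separating :: "'a mfd \<Rightarrow> ('a \<Rightarrow> real) set \<Rightarrow> bool" where
  "separating M A \<longleftrightarrow>
     (\<forall>x\<in>points M. \<forall>y\<in>points M. (\<forall>f\<in>A. f x = f y) \<longrightarrow> x = y) \<and>
     (\<forall>c\<in>mfd_atlas M. \<forall>x\<in>chart_dom c. chart_kernel_trivial c x A)"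

text \<open>A closed subset of a product of compact intervals; from \<open>d\<close> on both the
  centre and the points are 0.\<close>

lemma compact_Euc_ball:
  assumes u0: "u0 \<in> Euc d"
  shows "compact {u \<in> Euc d. (\<Sum>i<d. (u i - u0 i)\<^sup>2) \<le> \<delta>}" (is "compact ?K")
proof -
  let ?B = "Pi\<^sub>E UNIV (\<lambda>i. {u0 i - sqrt \<delta>..u0 i + sqrt \<delta>})"
  have "compact ?B"
    using compactin_PiE[of "\<lambda>_. euclideanreal" UNIV "\<lambda>i. {u0 i - sqrt \<delta>..u0 i + sqrt \<delta>}"]
    by (simp add: euclidean_product_topology compactin_euclidean_iff)
  moreover have "closed ?K"
  proof -
    have "closed (Euc d)"
      using closedin_Euclidean_space[of d] by (simp add: euclidean_product_topology)
    moreover have "closed {u. (\<Sum>i<d. (u i - u0 i)\<^sup>2) \<le> \<delta>}"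
      by (intro closed_Collect_le continuous_intros continuous_on_product_coordinates)
    moreover have "?K = Euc d \<inter> {u. (\<Sum>i<d. (u i - u0 i)\<^sup>2) \<le> \<delta>}" by auto
    ultimately show ?thesis by (simp add: closed_Int)
  qed
  moreover have "?K \<subseteq> ?B"
  proof
    fix u assume u: "u \<in> ?K"
    moreover have "0 \<le> (\<Sum>i<d. (u i - u0 i)\<^sup>2)" by (intro sum_nonneg) auto
    ultimately have nn: "0 \<le> \<delta>" by simp
    have "\<bar>u i - u0 i\<bar> \<le> sqrt \<delta>" for i
    proof (cases "i < d")
      case True
      then have "(u i - u0 i)\<^sup>2 \<le> (\<Sum>i<d. (u i - u0 i)\<^sup>2)" by (intro member_le_sum) auto
      with u have "(u i - u0 i)\<^sup>2 \<le> \<delta>" by simp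
      from real_sqrt_le_mono[OF this] show ?thesis by simp
    next
      case False then show ?thesis using u u0 nn by (auto simp: in_Euc)
    qed
    then show "u \<in> ?B" by (auto simp: abs_le_iff algebra_simps)
  qed
  then have "?K = ?B \<inter> ?K" by (rule Int_absorb1[symmetric])
  ultimately show ?thesis using compact_Int_closed[of ?B ?K] by (simp only:)
qed

text \<open>The bump carries an arbitrary smooth factor \<open>Q\<close> because it serves twice:
  with a constant to separate points, with a coordinate function to produce differentials. The bound
  \<open>e\<close> makes it possible to keep the bump away from a given point.\<close>

lemma bump_in_chart:
  assumes M: "Ck_manifold k M" and c: "c \<in> mfd_atlas M" and u0: "u0 \<in> chart_img c" and e: "0 < e"
  shows "\<exists>\<delta>. 0 < \<delta> \<and> \<delta> \<le> e \<and>
    (\<forall>r. Ck_fun_nat r (chart_dim c) (chart_img c) (\<lambda>u. flat_exp 0 (\<delta> - (\<Sum>i<chart_dim c. (u i - u0 i)\<^sup>2)))) \<and>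
    (\<forall>Q. (\<forall>r. Ck_fun_nat r (chart_dim c) (chart_img c) Q) \<longrightarrow> Ck_real k M (\<lambda>x. if x \<in> chart_dom c
        then flat_exp 0 (\<delta> - (\<Sum>i<chart_dim c. (chart_map c x i - u0 i)\<^sup>2)) * Q (chart_map c x) else 0))"
proof -
  let ?d = "chart_dim c"
  let ?sq = "\<lambda>u. \<Sum>i<?d. (u i - u0 i)\<^sup>2"
  have cc: "chart_of (mfd_top M) c" using chartedD[OF Ck_manifold_charted[OF M] c] .
  have I: "openin (Euclidean_space ?d) (chart_img c)" by (rule chart_of_openin_img[OF cc])
  obtain \<epsilon> where \<epsilon>: "\<epsilon> > 0" "{y \<in> Euc ?d. \<forall>i<?d. \<bar>y i - u0 i\<bar> < \<epsilon>} \<subseteq> chart_img c"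
    by (rule openin_Euc_contains_box[OF I u0])
  \<comment> \<open>A bound for the squared distance; half of \<open>\<epsilon>\<close> keeps the
    closed ball inside the open box.\<close>
  define \<delta> where "\<delta> = min e ((\<epsilon> / 2)\<^sup>2)"
  have \<delta>: "0 < \<delta>" "\<delta> \<le> e" "\<delta> \<le> (\<epsilon> / 2)\<^sup>2" using e \<epsilon>(1) by (auto simp: \<delta>_def)
  define K where "K = {u \<in> Euc ?d. ?sq u \<le> \<delta>}"
  have KI: "K \<subseteq> chart_img c"
  proof
    fix u assume u: "u \<in> K"
    have "\<bar>u i - u0 i\<bar> < \<epsilon>" if "i < ?d" for i
    proof -
      have "(u i - u0 i)\<^sup>2 \<le> ?sq u" using that by (intro member_le_sum) auto
      with u \<delta>(3) have "(u i - u0 i)\<^sup>2 \<le> (\<epsilon> / 2)\<^sup>2" by (simp add: K_def)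
      then have "\<bar>u i - u0 i\<bar> \<le> \<epsilon> / 2" using \<epsilon>(1) power2_le_iff_abs_le[of "\<epsilon> / 2"] by simp
      then show ?thesis using \<epsilon>(1) by linarith
    qed
    then show "u \<in> chart_img c" using \<epsilon>(2) u by (auto simp: K_def)
  qed
  have "u0 \<in> Euc ?d" using u0 chart_of_img_subset[OF cc] by blast
  then have "compact K" unfolding K_def by (rule compact_Euc_ball)
  then have "compactin (subtopology (Euclidean_space ?d) (chart_img c)) K"
    using KI by (simp add: Euclidean_space_top_of_set compactin_subtopology compactin_euclidean_iff K_def)
  then have "compactin (mfd_top M) (chart_inv c ` K)"
    by (rule image_compactin[OF _ chart_of_inv_continuous[OF cc]])
  \<comment> \<open>A compact subset of the Hausdorff space \<open>M\<close> is closed in it, so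
    extension by zero applies.\<close>
  then have clos: "closedin (mfd_top M) (chart_inv c ` K)"
    using M by (auto simp: Ck_manifold_def intro: compactin_imp_closedin)
  have sub: "chart_inv c ` K \<subseteq> chart_dom c"
    using KI by (auto intro!: chart_inv_in_dom)
  have sq: "Ck_fun_nat r ?d (chart_img c) (\<lambda>u. flat_exp 0 (\<delta> - ?sq u))" for r
  proof -
    have "Ck_fun_nat r ?d (chart_img c) (\<lambda>u. flat_exp 0 (\<delta> + (\<Sum>i<?d. (- 1) * ((u i + - u0 i) * (u i + - u0 i)))))"
      by (intro Ck_fun_nat_flat_exp[OF I] Ck_fun_nat_add[OF I] Ck_fun_nat_sum[OF I] Ck_fun_nat_mult[OF I]
          Ck_fun_nat_const Ck_fun_nat_coordinate[OF I])
    then show ?thesis by (simp add: power2_eq_square sum_negf)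
  qed
  show ?thesis
  proof (intro exI[of _ \<delta>] conjI \<delta>(1,2) allI sq impI)
    fix Q assume Q': "\<forall>r. Ck_fun_nat r ?d (chart_img c) Q"
    then have Q: "\<And>r. Ck_fun_nat r ?d (chart_img c) Q" by blast
    show "Ck_real k M (\<lambda>x. if x \<in> chart_dom c then flat_exp 0 (\<delta> - ?sq (chart_map c x)) * Q (chart_map c x) else 0)"
    proof (rule Ck_real_supported_in_chart[OF M c clos sub Ck_fun_nat_mult[OF I sq Q]])
      fix u assume u: "u \<in> chart_img c" "chart_inv c u \<notin> chart_inv c ` K"
      then have "u \<notin> K" by blast
      then have "\<delta> - ?sq u \<le> 0" using u(1) chart_of_img_subset[OF cc] by (auto simp: K_def)
      then show "flat_exp 0 (\<delta> - ?sq u) * Q u = 0" by (simp only: flat_exp_nonpos mult_zero_left)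
    qed
  qed
qed

lemma separating_Ck_real:
  assumes M: "Ck_manifold k M"
  shows "separating M {f. Ck_real k M f}"
  unfolding separating_def
proof (intro conjI ballI impI)
  have ch: "charted M" using M by (rule Ck_manifold_charted)
  fix x y assume x: "x \<in> points M" and eq: "\<forall>f\<in>{f. Ck_real k M f}. f x = f y"
  obtain c where c: "c \<in> mfd_atlas M" "chart_of (mfd_top M) c" "x \<in> chart_dom c"
    using charted_obtain[OF ch x] by blast
  let ?sq = "\<lambda>u. \<Sum>i<chart_dim c. (u i - chart_map c x i)\<^sup>2"
  show "x = y"
  proof (rule ccontr)
    assume "x \<noteq> y"
    \<comment> \<open>The squared distance to \<open>y\<close>, so that a bump of at most this size
      vanishes at \<open>y\<close>; outside the chart the extension by zero does so anyway.\<close>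
    define e where "e = (if y \<in> chart_dom c then ?sq (chart_map c y) else 1)"
    have "0 < ?sq (chart_map c y)" if y: "y \<in> chart_dom c"
    proof (rule ccontr)
      assume "\<not> 0 < ?sq (chart_map c y)"
      then have "?sq (chart_map c y) = 0" by (meson not_less order_antisym sum_nonneg zero_le_power2)
      then have "\<forall>i\<in>{..<chart_dim c}. chart_map c y i = chart_map c x i"
        by (subst (asm) sum_nonneg_eq_0_iff) auto
      then have "chart_map c y i = chart_map c x i" for i
        using chart_of_img_subset[OF c(2)] y c(3) by (cases "i < chart_dim c") (auto simp: in_Euc image_subset_iff)
      then have "chart_map c y = chart_map c x" by (rule ext)
      then show False using chart_of_inj[OF c(2)] y c(3) \<open>x \<noteq> y\<close> by (auto dest: inj_onD)
    qed
    then have "0 < e" by (simp add: e_def)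
    from bump_in_chart[OF M c(1) imageI[OF c(3)] this]
    obtain \<delta> where \<delta>: "0 < \<delta>" "\<delta> \<le> e" and Ck: "\<forall>Q. (\<forall>r. Ck_fun_nat r (chart_dim c) (chart_img c) Q) \<longrightarrow>
        Ck_real k M (\<lambda>x. if x \<in> chart_dom c then flat_exp 0 (\<delta> - ?sq (chart_map c x)) * Q (chart_map c x) else 0)"
      by (elim exE conjE)
    let ?f = "\<lambda>x. if x \<in> chart_dom c then flat_exp 0 (\<delta> - ?sq (chart_map c x)) * 1 else 0"
    have "?f \<in> {f. Ck_real k M f}"
      unfolding mem_Collect_eq by (rule Ck[rule_format]) (rule Ck_fun_nat_const)
    from bspec[OF eq this] have "?f x = ?f y" .
    moreover have "?f x > 0" using c(3) flat_exp_pos[OF \<delta>(1)] by simp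
    moreover have "?f y = 0"
    proof (cases "y \<in> chart_dom c")
      case True
      then have "\<delta> - ?sq (chart_map c y) \<le> 0" using \<delta>(2) by (simp add: e_def)
      from flat_exp_nonpos[OF this] show ?thesis by simp
    qed simp
    ultimately show False by linarith
  qed
next
  fix c x assume c: "c \<in> mfd_atlas M" and x: "x \<in> chart_dom c"
  have cc: "chart_of (mfd_top M) c" using chartedD[OF Ck_manifold_charted[OF M] c] .
  have I: "openin (Euclidean_space (chart_dim c)) (chart_img c)" by (rule chart_of_openin_img[OF cc])
  let ?u = "chart_map c x"
  let ?sq = "\<lambda>u. \<Sum>i<chart_dim c. (u i - ?u i)\<^sup>2"
  have u: "?u \<in> chart_img c" using x by simp
  have "0 < (1::real)" by simp
  from bump_in_chart[OF M c u this]
  obtain \<delta> where \<delta>: "0 < \<delta>" and B': "\<forall>r. Ck_fun_nat r (chart_dim c) (chart_img c) (\<lambda>u. flat_exp 0 (\<delta> - ?sq u))"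
    and Ck: "\<forall>Q. (\<forall>r. Ck_fun_nat r (chart_dim c) (chart_img c) Q) \<longrightarrow>
        Ck_real k M (\<lambda>x. if x \<in> chart_dom c then flat_exp 0 (\<delta> - ?sq (chart_map c x)) * Q (chart_map c x) else 0)"
    by (elim exE conjE)
  note B = B'[rule_format]
  show "chart_kernel_trivial c x {f. Ck_real k M f}"
    unfolding chart_kernel_trivial_def
  proof (intro allI impI)
    fix w :: "nat \<Rightarrow> real" and j assume w: "\<forall>f\<in>{f. Ck_real k M f}.
        (\<Sum>i<chart_dim c. partial_deriv i (\<lambda>u. f (chart_inv c u)) ?u * w i) = 0" and j: "j < chart_dim c"
    \<comment> \<open>As \<open>?Q\<close> vanishes at the centre, the differential of the product
      there is that of the \<open>j\<close>-th coordinate times the positive value of the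
      bump.\<close>
    let ?B = "\<lambda>u. flat_exp 0 (\<delta> - ?sq u)" and ?Q = "\<lambda>u. u j + - ?u j"
    let ?f = "\<lambda>x. if x \<in> chart_dom c then ?B (chart_map c x) * ?Q (chart_map c x) else 0"
    have Q: "Ck_fun_nat r (chart_dim c) (chart_img c) ?Q" for r
      by (intro Ck_fun_nat_add[OF I] Ck_fun_nat_coordinate[OF I] Ck_fun_nat_const)
    have "partial_deriv i (\<lambda>u. ?f (chart_inv c u)) ?u = (if i = j then ?B ?u else 0)" if i: "i < chart_dim c" for i
    proof -
      have "partial_deriv i (\<lambda>u. ?f (chart_inv c u)) ?u = partial_deriv i (\<lambda>u. ?B u * ?Q u) ?u"
        by (rule partial_deriv_cong[OF I _ u i]) (simp add: chart_inv_in_dom chart_map_inv)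
      also have "((\<lambda>t. ?Q (?u(i := t))) has_real_derivative (if i = j then 1 else 0)) (at (?u i))"
        by (cases "i = j") (auto intro!: derivative_eq_intros)
      from DERIV_mult[OF Ck_fun_nat_Suc_D(1)[OF I B i u] this]
      have "((\<lambda>t. ?B (?u(i := t)) * ?Q (?u(i := t))) has_real_derivative (if i = j then ?B ?u else 0)) (at (?u i))"
        by (rule DERIV_cong) (simp add: fun_upd_triv)
      then have "partial_deriv i (\<lambda>u. ?B u * ?Q u) ?u = (if i = j then ?B ?u else 0)"
        unfolding partial_deriv_def by (rule DERIV_imp_deriv)
      finally show ?thesis .
    qed
    then have "(\<Sum>i<chart_dim c. partial_deriv i (\<lambda>u. ?f (chart_inv c u)) ?u * w i) =
        (\<Sum>i<chart_dim c. (if i = j then ?B ?u * w i else 0))"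
      by (intro sum.cong) auto
    also have "\<dots> = ?B ?u * w j" using j by simp
    moreover have "?f \<in> {f. Ck_real k M f}"
      unfolding mem_Collect_eq by (rule Ck[rule_format]) (rule Q)
    from bspec[OF w this]
    have "(\<Sum>i<chart_dim c. partial_deriv i (\<lambda>u. ?f (chart_inv c u)) ?u * w i) = 0" .
    ultimately have "?B ?u * w j = 0" by (simp only:)
    then show "w j = 0" using flat_exp_pos[OF \<delta>] by simp
  qed
qed

subsection \<open>Finite separating families\<close>

text \<open>For two points close to \<open>p\<close>, the differences of finitely many functions are
  given by a matrix near the injective Jacobian at \<open>p\<close>, applied to the difference of
  the coordinates. Such a matrix has a left inverse, so equal values force equal points.\<close>

lemma local_finite_separation:
  assumes M: "Ck_manifold k M" and k: "1 \<le> k" and A: "\<And>f. f \<in> A \<Longrightarrow> Ck_real k M f"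
    and sep: "separating M A" and p: "p \<in> points M"
  shows "\<exists>U G. openin (mfd_top M) U \<and> p \<in> U \<and> finite G \<and> G \<subseteq> A \<and>
    (\<forall>x\<in>U. \<forall>c\<in>mfd_atlas M. x \<in> chart_dom c \<longrightarrow> chart_kernel_trivial c x G) \<and>
    (\<forall>x\<in>U. \<forall>y\<in>U. (\<forall>g\<in>G. g x = g y) \<longrightarrow> x = y)"
proof -
  have ch: "charted M" using M by (rule Ck_manifold_charted)
  have k1: "enat (Suc 0) \<le> k" using k by (simp add: one_enat_def)
  obtain c where c: "c \<in> mfd_atlas M" "chart_of (mfd_top M) c" "p \<in> chart_dom c"
    using charted_obtain[OF ch p] by blast
  let ?d = "chart_dim c" and ?I = "chart_img c" and ?u = "chart_map c p"
  have I: "openin (Euclidean_space ?d) ?I" by (rule chart_of_openin_img[OF c(2)])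
  have u: "?u \<in> ?I" using c(3) by simp
  have "chart_kernel_trivial c p A" using sep c by (simp add: separating_def)
  then have "\<exists>G. finite G \<and> G \<subseteq> A \<and> (\<forall>w. (\<forall>f\<in>G. (\<Sum>i<?d. partial_deriv i (\<lambda>u. f (chart_inv c u)) ?u * w i) = 0)
      \<longrightarrow> (\<forall>i<?d. w i = 0))"
    unfolding chart_kernel_trivial_def by (intro finite_trivial_kernel) blast
  then obtain G where G: "finite G" "G \<subseteq> A"
    and triv: "\<And>w. (\<forall>f\<in>G. (\<Sum>i<?d. partial_deriv i (\<lambda>u. f (chart_inv c u)) ?u * w i) = 0) \<Longrightarrow> \<forall>i<?d. w i = 0"
    by blast
  obtain N g where Gg: "G = g ` {i. i < (N::nat)}" using G(1) unfolding finite_conv_nat_seg_image by blast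
  define H where "H a = (\<lambda>u. g a (chart_inv c u))" for a
  have H: "Ck_fun_nat (Suc 0) ?d ?I (H a)" if "a < N" for a
    unfolding H_def using G(2) Gg that by (intro Ck_realD[OF A c(1) k1]) auto
  have inj: "\<forall>i<?d. w i = 0" if "\<forall>a<N. (\<Sum>i<?d. partial_deriv i (H a) ?u * w i) = 0" for w
  proof (rule triv, rule ballI)
    fix f assume "f \<in> G"
    then obtain a where "a < N" "f = g a" by (auto simp: Gg)
    with that show "(\<Sum>i<?d. partial_deriv i (\<lambda>u. f (chart_inv c u)) ?u * w i) = 0" by (simp only: H_def)
  qed
  \<comment> \<open>The Jacobian stays injective on \<open>W\<close> because it keeps a left inverse
    there.\<close>
  obtain L W where W: "openin (Euclidean_space ?d) W" "?u \<in> W" "W \<subseteq> ?I"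
    and L: "\<And>y z i. y \<in> W \<Longrightarrow> i < ?d \<Longrightarrow> z i = (\<Sum>a<N. L i a y * (\<Sum>j<?d. partial_deriv j (H a) y * z j))"
    by (rule left_inverse_Ck[where A = "\<lambda>a i. partial_deriv i (H a)" and n = N and q = 0, OF I u Ck_fun_nat_Suc_D(2)[OF I H] inj])
      (assumption | blast)+
  let ?F = "inf (nhds ?u) (principal ?I)"
  \<comment> \<open>Pairs of points that approach \<open>p\<close> independently of each
    other.\<close>
  let ?FF = "?F \<times>\<^sub>F ?F"
  have "?F \<noteq> bot"
    using eventually_within_open_Euc[OF I u, of "\<lambda>_. False"] by (auto simp: trivial_limit_def)
  then have FF: "?FF \<noteq> bot" by (simp add: prod_filter_eq_bot)
  have coord: "((\<lambda>v. v i) \<longlongrightarrow> ?u i) ?F" for i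
    by (rule tendsto_mono[OF inf_le1 tendsto_coordinate[OF filterlim_ident]])
  have inE: "\<forall>\<^sub>F v in ?F. v \<in> Euc ?d"
    using openin_Euc_subset[OF I] by (auto simp: eventually_inf_principal intro!: always_eventually)
  have "\<exists>Q. (\<forall>i<?d. (Q i \<longlongrightarrow> partial_deriv i (H a) ?u) ?FF) \<and>
      (\<forall>\<^sub>F s in ?FF. H a (snd s) - H a (fst s) = (\<Sum>i<?d. Q i s * (snd s i - fst s i)))" if a: "a < N" for a
  proof -
    obtain Q where "\<And>i. i < ?d \<Longrightarrow> (Q i \<longlongrightarrow> partial_deriv i (H a) ?u) ?FF"
      "\<forall>\<^sub>F s in ?FF. H a (snd s) - H a (fst s) = (\<Sum>i<?d. Q i s * (snd s i - fst s i))"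
    proof (rule mean_value_germ[OF I H[OF a] u, of fst ?FF snd])
      show "\<forall>\<^sub>F s in ?FF. fst s \<in> Euc ?d" "\<forall>\<^sub>F s in ?FF. snd s \<in> Euc ?d"
        using filterlim_fst filterlim_snd inE unfolding filterlim_iff by blast+
      show "((\<lambda>s. fst s i) \<longlongrightarrow> ?u i) ?FF" "((\<lambda>s. snd s i) \<longlongrightarrow> ?u i) ?FF" for i
        by (rule filterlim_compose[OF coord filterlim_fst], rule filterlim_compose[OF coord filterlim_snd])
    qed blast
    then show ?thesis by blast
  qed
  then have "\<forall>a\<in>{..<N}. \<exists>Q. (\<forall>i<?d. (Q i \<longlongrightarrow> partial_deriv i (H a) ?u) ?FF) \<and>
      (\<forall>\<^sub>F s in ?FF. H a (snd s) - H a (fst s) = (\<Sum>i<?d. Q i s * (snd s i - fst s i)))" by simp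
  from bchoice[OF this] obtain Q where
    QQ: "\<forall>a\<in>{..<N}. (\<forall>i<?d. (Q a i \<longlongrightarrow> partial_deriv i (H a) ?u) ?FF) \<and>
      (\<forall>\<^sub>F s in ?FF. H a (snd s) - H a (fst s) = (\<Sum>i<?d. Q a i s * (snd s i - fst s i)))" by blast
  have Q: "(Q a i \<longlongrightarrow> partial_deriv i (H a) ?u) ?FF" if "a < N" "i < ?d" for a i using QQ that by simp
  obtain L' L0 where Lev: "\<forall>\<^sub>F s in ?FF. \<forall>z. \<forall>i<?d. z i = (\<Sum>a<N. L' i a s * (\<Sum>j<?d. Q a j s * z j))"
    by (rule left_inverse_limit[OF FF Q inj]) (assumption | blast)+
  have "\<forall>\<^sub>F s in ?FF. \<forall>a\<in>{..<N}. H a (snd s) - H a (fst s) = (\<Sum>i<?d. Q a i s * (snd s i - fst s i))"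
    using QQ by (intro eventually_ball_finite) auto
  with Lev have "\<forall>\<^sub>F s in ?FF. (\<forall>a<N. H a (snd s) = H a (fst s)) \<longrightarrow> (\<forall>i<?d. snd s i = fst s i)"
  proof eventually_elim
    case (elim s)
    show ?case
    proof (intro impI allI)
      fix i assume eq: "\<forall>a<N. H a (snd s) = H a (fst s)" and i: "i < ?d"
      have "snd s i - fst s i = (\<Sum>a<N. L' i a s * (\<Sum>j<?d. Q a j s * (snd s j - fst s j)))"
        using elim(1)[rule_format, of i "\<lambda>i. snd s i - fst s i"] i by blast
      also have "\<dots> = (\<Sum>a<N. L' i a s * 0)"
      proof (rule sum.cong[OF refl])
        fix a assume "a \<in> {..<N}"
        then have "(\<Sum>j<?d. Q a j s * (snd s j - fst s j)) = 0" using elim(2) eq by simp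
        then show "L' i a s * (\<Sum>j<?d. Q a j s * (snd s j - fst s j)) = L' i a s * 0" by simp
      qed
      finally show "snd s i = fst s i" by simp
    qed
  qed
  then obtain P1 P2 where P: "eventually P1 ?F" "eventually P2 ?F"
    and P12: "\<And>v v'. P1 v \<Longrightarrow> P2 v' \<Longrightarrow> (\<forall>a<N. H a v' = H a v) \<Longrightarrow> \<forall>i<?d. v' i = v i"
    unfolding eventually_prod_filter by auto
  obtain W1 where W1: "openin (Euclidean_space ?d) W1" "?u \<in> W1" "W1 \<subseteq> ?I" "\<And>v. v \<in> W1 \<Longrightarrow> P1 v"
    using P(1) unfolding eventually_within_open_Euc[OF I u] by blast
  obtain W2 where W2: "openin (Euclidean_space ?d) W2" "?u \<in> W2" "W2 \<subseteq> ?I" "\<And>v. v \<in> W2 \<Longrightarrow> P2 v"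
    using P(2) unfolding eventually_within_open_Euc[OF I u] by blast
  define U where "U = {x \<in> chart_dom c. chart_map c x \<in> W \<inter> W1 \<inter> W2}"
  have "openin (subtopology (mfd_top M) (chart_dom c)) U"
  proof -
    have "topspace (subtopology (mfd_top M) (chart_dom c)) = chart_dom c"
      using chart_of_dom_subset[OF c(2)] by auto
    then show ?thesis
      using openin_continuous_map_preimage[OF chart_of_continuous[OF c(2)], of "W \<inter> W1 \<inter> W2"] W(1) W1(1) W2(1)
      by (simp add: U_def openin_Int)
  qed
  then have Uo: "openin (mfd_top M) U"
    using chart_of_openin_dom[OF c(2)] by (simp add: openin_open_subtopology)
  have kern: "chart_kernel_trivial e x G" if x: "x \<in> U" and e: "e \<in> mfd_atlas M" "x \<in> chart_dom e" for x e
  proof (rule chart_kernel_trivial_transfer[OF M k e(1) c(1) e(2)])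
    show xc: "x \<in> chart_dom c" using x by (simp add: U_def)
    show "chart_kernel_trivial c x G"
      unfolding chart_kernel_trivial_def
    proof (intro allI impI)
      fix w :: "nat \<Rightarrow> real" and i
      assume w: "\<forall>f\<in>G. (\<Sum>i<?d. partial_deriv i (\<lambda>u. f (chart_inv c u)) (chart_map c x) * w i) = 0" and i: "i < ?d"
      have z: "(\<Sum>j<?d. partial_deriv j (H a) (chart_map c x) * w j) = 0" if "a < N" for a
        unfolding H_def by (rule bspec[OF w]) (use that in \<open>simp add: Gg\<close>)
      have "w i = (\<Sum>a<N. L i a (chart_map c x) * (\<Sum>j<?d. partial_deriv j (H a) (chart_map c x) * w j))"
        using x i by (intro L) (auto simp: U_def)
      also have "\<dots> = 0" by (rule sum.neutral) (simp add: z)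
      finally show "w i = 0" .
    qed
  qed (use A G(2) in auto)
  have "x = y" if xy: "x \<in> U" "y \<in> U" and eq: "\<forall>g\<in>G. g x = g y" for x y
  proof -
    have dom: "x \<in> chart_dom c" "y \<in> chart_dom c" using xy by (auto simp: U_def)
    have "\<forall>i<?d. chart_map c y i = chart_map c x i"
    proof (rule P12)
      show "P1 (chart_map c x)" "P2 (chart_map c y)" using xy W1(4) W2(4) by (auto simp: U_def)
      show "\<forall>a<N. H a (chart_map c y) = H a (chart_map c x)"
        using eq dom by (auto simp: Gg H_def chart_inv_map[OF c(2)])
    qed
    moreover have "chart_map c x \<in> Euc ?d" "chart_map c y \<in> Euc ?d"
      using dom chart_of_img_subset[OF c(2)] by auto
    ultimately have "chart_map c y i = chart_map c x i" for i
      by (cases "i < ?d") (auto simp: in_Euc)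
    then have "chart_map c x = chart_map c y" by auto
    then show ?thesis using chart_of_inj[OF c(2)] dom by (auto dest: inj_onD)
  qed
  then show ?thesis
    using Uo c(3) u W(2) W1(2) W2(2) G kern by (intro exI[of _ U] exI[of _ G]) (auto simp: U_def)
qed

lemma compact_space_finite_cover:
  assumes "compact_space X" "\<And>x. x \<in> topspace X \<Longrightarrow> \<exists>U. openin X U \<and> x \<in> U \<and> P U"
  obtains \<F> where "finite \<F>" "\<And>U. U \<in> \<F> \<Longrightarrow> P U" "topspace X \<subseteq> \<Union>\<F>"
proof -
  have "\<exists>\<F>. finite \<F> \<and> \<F> \<subseteq> {U. openin X U \<and> P U} \<and> topspace X \<subseteq> \<Union>\<F>"
    by (rule assms(1)[unfolded compact_space_alt, rule_format]) (use assms(2) in auto)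
  then show ?thesis using that by blast
qed

text \<open>Compactness is used twice: on \<open>M\<close> for tangent vectors and on the square of
  \<open>M\<close> for pairs of points. Pairs near the diagonal are covered by local injectivity, a
  pair off the diagonal has a neighbourhood on which one function distinguishes the two
  points.\<close>

lemma finite_separating_family:
  assumes M: "Ck_manifold k M" and k: "1 \<le> k" and cpt: "compact_space (mfd_top M)"
    and A: "\<And>f. f \<in> A \<Longrightarrow> Ck_real k M f" and sep: "separating M A"
  shows "\<exists>G. finite G \<and> G \<subseteq> A \<and> separating M G"
proof -
  have ch: "charted M" using M by (rule Ck_manifold_charted)
  note loc = local_finite_separation[OF M k A sep]
  define P where "P U \<longleftrightarrow> (\<exists>G. finite G \<and> G \<subseteq> A \<and>
    (\<forall>x\<in>U. \<forall>c\<in>mfd_atlas M. x \<in> chart_dom c \<longrightarrow> chart_kernel_trivial c x G))" for U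
  define R where "R V \<longleftrightarrow> (\<exists>G. finite G \<and> G \<subseteq> A \<and>
    (\<forall>x y. (x, y) \<in> V \<longrightarrow> (\<forall>g\<in>G. g x = g y) \<longrightarrow> x = y))" for V
  obtain \<U> where \<U>: "finite \<U>" "\<And>U. U \<in> \<U> \<Longrightarrow> P U" "points M \<subseteq> \<Union>\<U>"
  proof (rule compact_space_finite_cover[OF cpt, of P])
    show "\<exists>U. openin (mfd_top M) U \<and> x \<in> U \<and> P U" if "x \<in> points M" for x
      using loc[OF _ that] unfolding P_def by blast
  qed blast
  obtain \<V> where \<V>: "finite \<V>" "\<And>V. V \<in> \<V> \<Longrightarrow> R V" "points M \<times> points M \<subseteq> \<Union>\<V>"
  proof (rule compact_space_finite_cover[of "prod_topology (mfd_top M) (mfd_top M)" R])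
    show "compact_space (prod_topology (mfd_top M) (mfd_top M))"
      using cpt by (simp add: compact_space_prod_topology)
    fix z assume z: "z \<in> topspace (prod_topology (mfd_top M) (mfd_top M))"
    obtain x y where xy: "z = (x, y)" "x \<in> points M" "y \<in> points M" using z by auto
    show "\<exists>V. openin (prod_topology (mfd_top M) (mfd_top M)) V \<and> z \<in> V \<and> R V"
    proof (cases "x = y")
      case True
      obtain U G where U: "openin (mfd_top M) U" "x \<in> U" "finite G" "G \<subseteq> A"
        "\<forall>x\<in>U. \<forall>y\<in>U. (\<forall>g\<in>G. g x = g y) \<longrightarrow> x = y"
        using loc[OF _ xy(2)] by blast
      then have "R (U \<times> U)" unfolding R_def by (intro exI[of _ G]) blast
      then show ?thesis using U xy True by (intro exI[of _ "U \<times> U"]) (simp add: openin_prod_Times_iff)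
    next
      case False
      then obtain f where f: "f \<in> A" "f x \<noteq> f y" using sep xy unfolding separating_def by blast
      have fc: "continuous_map (mfd_top M) euclideanreal f" by (rule Ck_real_continuous[OF ch A[OF f(1)]])
      let ?V = "{z \<in> topspace (prod_topology (mfd_top M) (mfd_top M)). f (fst z) - f (snd z) \<in> - {0}}"
      have "continuous_map (prod_topology (mfd_top M) (mfd_top M)) euclideanreal (\<lambda>z. f (fst z) - f (snd z))"
        using continuous_map_compose[OF continuous_map_fst fc] continuous_map_compose[OF continuous_map_snd fc]
        by (intro continuous_map_diff) (auto simp: o_def)
      then have "openin (prod_topology (mfd_top M) (mfd_top M)) ?V"
        by (rule openin_continuous_map_preimage) (simp add: open_Compl flip: open_openin)
      moreover have "R ?V" unfolding R_def using f(1) by (intro exI[of _ "{f}"]) auto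
      ultimately show ?thesis using xy f(2) z by (intro exI[of _ ?V]) auto
    qed
  qed auto
  have "\<forall>U\<in>\<U>. P U" using \<U>(2) by blast
  from bchoice[OF this[unfolded P_def]]
  obtain GU where GU: "\<forall>U\<in>\<U>. finite (GU U) \<and> GU U \<subseteq> A \<and>
      (\<forall>x\<in>U. \<forall>c\<in>mfd_atlas M. x \<in> chart_dom c \<longrightarrow> chart_kernel_trivial c x (GU U))" by (elim exE)
  have "\<forall>V\<in>\<V>. R V" using \<V>(2) by blast
  from bchoice[OF this[unfolded R_def]]
  obtain GV where GV: "\<forall>V\<in>\<V>. finite (GV V) \<and> GV V \<subseteq> A \<and>
      (\<forall>x y. (x, y) \<in> V \<longrightarrow> (\<forall>g\<in>GV V. g x = g y) \<longrightarrow> x = y)" by (elim exE)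
  let ?G = "(\<Union>U\<in>\<U>. GU U) \<union> (\<Union>V\<in>\<V>. GV V)"
  have "finite ?G" "?G \<subseteq> A" using \<U>(1) \<V>(1) GU GV by auto
  moreover have "separating M ?G"
    unfolding separating_def
  proof (intro conjI ballI impI)
    fix x y assume xy: "x \<in> points M" "y \<in> points M" and eq: "\<forall>f\<in>?G. f x = f y"
    obtain V where V: "V \<in> \<V>" "(x, y) \<in> V" using \<V>(3) xy by blast
    then have "\<forall>g\<in>GV V. g x = g y" using eq by blast
    then show "x = y" using GV V by blast
  next
    fix c x assume c: "c \<in> mfd_atlas M" and x: "x \<in> chart_dom c"
    have "x \<in> points M" using chart_of_dom_subset[OF chartedD[OF ch c]] x by blast
    then obtain U where U: "U \<in> \<U>" "x \<in> U" using \<U>(3) by blast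
    then have "chart_kernel_trivial c x (GU U)" using GU c x by blast
    then show "chart_kernel_trivial c x ?G" using U unfolding chart_kernel_trivial_def by blast
  qed
  ultimately show ?thesis by blast
qed

subsection \<open>Averaging over circles\<close>

definition axis_vec :: "nat \<Rightarrow> real \<Rightarrow> nat \<Rightarrow> real" where
  "axis_vec j t i = (if i = j then t else 0)"

lemma axis_vec_in_Euc: "j < l \<Longrightarrow> axis_vec j t \<in> Euc l"
  by (auto simp: axis_vec_def in_Euc)

locale Ck_torus_action_on =
  fixes k :: enat and X :: "'a mfd" and l :: nat and \<Theta> :: "(nat \<Rightarrow> real) set \<Rightarrow> 'a \<Rightarrow> 'a"
  assumes k: "1 \<le> k" and X: "Ck_manifold k X"
    and action: "Ck_torus_action k l X \<Theta>"
begin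

lemma ch: "charted X"
  using X by (rule Ck_manifold_charted)

text \<open>The action lifted to R^l, so that group elements are vectors rather than cosets.\<close>

definition T :: "(nat \<Rightarrow> real) \<Rightarrow> 'a \<Rightarrow> 'a" where
  "T h = \<Theta> (torus_proj l h)"

lemma T_facts:
  assumes x: "x \<in> points X"
  shows T_closed: "h \<in> Euc l \<Longrightarrow> T h x \<in> points X"
    and T_add: "h \<in> Euc l \<Longrightarrow> h' \<in> Euc l \<Longrightarrow> T (\<lambda>i. h i + h' i) x = T h (T h' x)"
    and T_zero: "T (\<lambda>_. 0) x = x"
proof -
  interpret group_action "torus_group l" "points X" \<Theta>
    using action by (simp add: Ck_torus_action_def)
  have c: "torus_proj l h \<in> carrier (torus_group l)" if "h \<in> Euc l" for h
    using that by (simp add: carrier_torus)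
  show "h \<in> Euc l \<Longrightarrow> T h x \<in> points X"
    unfolding T_def using element_image[OF c x] by blast
  show "h \<in> Euc l \<Longrightarrow> h' \<in> Euc l \<Longrightarrow> T (\<lambda>i. h i + h' i) x = T h (T h' x)"
    unfolding T_def using composition_rule[OF x c c] by (simp add: torus_mult)
  show "T (\<lambda>_. 0) x = x"
    using fun_cong[OF id_eq_one, of x] x by (simp add: T_def torus_one)
qed

lemma T_integer: "h \<in> Euc l \<Longrightarrow> h' \<in> Euc l \<Longrightarrow> (\<And>i. i < l \<Longrightarrow> h i - h' i \<in> \<int>) \<Longrightarrow> T h = T h'"
  unfolding T_def using torus_proj_eq_iff[of h l h'] by simp

section \<open>The circles of the torus and their orbits in coordinates\<close>

definition \<Psi> :: "nat \<Rightarrow> real \<Rightarrow> 'a \<Rightarrow> 'a" where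
  "\<Psi> j t = T (axis_vec j t)"

lemma \<Psi>_facts:
  assumes x: "x \<in> points X" and j: "j < l"
  shows \<Psi>_closed: "\<Psi> j t x \<in> points X"
    and \<Psi>_add: "\<Psi> j (s + t) x = \<Psi> j s (\<Psi> j t x)"
    and \<Psi>_periodic: "\<Psi> j (t + 1) x = \<Psi> j t x"
    and \<Psi>_0: "\<Psi> j 0 x = x" and \<Psi>_1: "\<Psi> j 1 x = x"
    and \<Psi>_commute: "i < l \<Longrightarrow> \<Psi> i s (\<Psi> j t x) = \<Psi> j t (\<Psi> i s x)"
proof -
  note E = axis_vec_in_Euc[OF j]
  show "\<Psi> j t x \<in> points X" unfolding \<Psi>_def by (rule T_closed[OF x E])
  have "axis_vec j (s + t) = (\<lambda>i. axis_vec j s i + axis_vec j t i)" by (auto simp: axis_vec_def)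
  then show "\<Psi> j (s + t) x = \<Psi> j s (\<Psi> j t x)" unfolding \<Psi>_def by (simp add: T_add[OF x E E])
  have per: "T (axis_vec j (t + 1)) = T (axis_vec j t)" for t
    by (rule T_integer[OF E E]) (simp add: axis_vec_def)
  then show "\<Psi> j (t + 1) x = \<Psi> j t x" by (simp add: \<Psi>_def)
  have "axis_vec j 0 = (\<lambda>_. 0)" by (auto simp: axis_vec_def)
  then show 0: "\<Psi> j 0 x = x" unfolding \<Psi>_def by (simp add: T_zero[OF x])
  show "\<Psi> j 1 x = x" using per[of 0] 0 by (simp add: \<Psi>_def)
  show "\<Psi> i s (\<Psi> j t x) = \<Psi> j t (\<Psi> i s x)" if i: "i < l"
    unfolding \<Psi>_def using T_add[OF x axis_vec_in_Euc[OF i, of s] E[of t]] T_add[OF x E[of t] axis_vec_in_Euc[OF i, of s]]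
    by (simp add: add.commute)
qed

text \<open>The torus factor is unrolled to all of R^l: a full circle does not fit into one torus
  chart, whereas integrating over it requires a single coordinate domain.\<close>

definition action_dom :: "'a chart \<Rightarrow> (nat \<Rightarrow> real) set" where
  "action_dom c = {z \<in> Euc (l + chart_dim c). right_part l z \<in> chart_img c}"

definition action_rep :: "'a chart \<Rightarrow> ('a \<Rightarrow> real) \<Rightarrow> (nat \<Rightarrow> real) \<Rightarrow> real" where
  "action_rep c f z = f (T (left_part l z) (chart_inv c (right_part l z)))"

lemma openin_action_dom:
  assumes "c \<in> mfd_atlas X"
  shows "openin (Euclidean_space (l + chart_dim c)) (action_dom c)"
  using openin_continuous_map_preimage[OF continuous_map_right_part[of l "chart_dim c"]
      chart_of_openin_img[OF chartedD[OF ch assms]]]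
  by (simp add: action_dom_def)

text \<open>Around each point a small box in the torus coordinates is the range of a torus chart, in
  which the lifted expression agrees with the chart expression of the action; regularity is
  local.\<close>

lemma Ck_action_rep:
  assumes f: "Ck_real k X f" and c: "c \<in> mfd_atlas X" and r: "enat r \<le> k"
  shows "Ck_fun_nat r (l + chart_dim c) (action_dom c) (action_rep c f)"
proof (rule Ck_fun_nat_local[OF openin_action_dom[OF c]])
  fix z assume z: "z \<in> action_dom c"
  have cc: "chart_of (mfd_top X) c" by (rule chartedD[OF ch c])
  let ?N = "prod_mfd (torus_mfd l) X"
  define V where "V = {y \<in> Euc l. \<forall>i<l. \<bar>y i - left_part l z i\<bar> < 1 / 4}"
  have V: "openin (Euclidean_space l) V" "inj_on (torus_proj l) V"
    unfolding V_def by (rule openin_Euc_box, rule torus_proj_inj_on_small_box)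
  define e where "e = \<lparr>chart_dim = l, chart_dom = torus_proj l ` V, chart_map = inv_into V (torus_proj l)\<rparr>"
  have e: "e \<in> mfd_atlas (torus_mfd l)" unfolding torus_mfd_def e_def using V by auto
  have ee: "chart_of (torus_top l) e" and eimg: "chart_img e = V"
    and einv: "\<And>u. u \<in> V \<Longrightarrow> chart_inv e u = torus_proj l u"
    unfolding e_def using torus_chart[OF V] by auto
  have el: "chart_dim e = l" by (simp add: e_def)
  have pe: "prod_chart e c \<in> mfd_atlas ?N" using e c by (auto simp: prod_mfd_def)
  have "Ck_real k ?N (\<lambda>p. f ((\<lambda>(h, x). \<Theta> h x) p))"
    by (rule Ck_real_compose[OF charted_prod_mfd[OF charted_torus ch] ch _ f])
      (use action in \<open>simp add: Ck_torus_action_def\<close>)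
  from Ck_realD[OF this pe r]
  have Ck: "Ck_fun_nat r (l + chart_dim c) (chart_img (prod_chart e c))
      (\<lambda>z. f ((\<lambda>(h, x). \<Theta> h x) (chart_inv (prod_chart e c) z)))"
    by (simp only: prod_chart_sel el)
  have open_img: "openin (Euclidean_space (l + chart_dim c)) (chart_img (prod_chart e c))"
    using chart_of_openin_img[OF chart_of_prod_chart[OF ee cc]] by (simp only: prod_chart_sel el)
  have img: "chart_img (prod_chart e c) = {z \<in> Euc (l + chart_dim c). left_part l z \<in> V \<and> right_part l z \<in> chart_img c}"
    unfolding prod_chart_img[OF ee cc] eimg el by simp
  have "Ck_fun_nat r (l + chart_dim c) (chart_img (prod_chart e c)) (action_rep c f)"
  proof (rule Ck_fun_nat_cong[OF open_img _ Ck])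
    fix y assume y: "y \<in> chart_img (prod_chart e c)"
    then have "left_part l y \<in> V" by (simp only: img mem_Collect_eq simp_thms)
    then show "f ((\<lambda>(h, x). \<Theta> h x) (chart_inv (prod_chart e c) y)) = action_rep c f y"
      unfolding prod_chart_inv[OF ee cc y] action_rep_def T_def el by (simp add: einv)
  qed
  moreover have "z \<in> chart_img (prod_chart e c)"
    unfolding img using z by (auto simp: action_dom_def V_def left_part_def in_Euc)
  ultimately show "\<exists>V. openin (Euclidean_space (l + chart_dim c)) V \<and> z \<in> V \<and>
      Ck_fun_nat r (l + chart_dim c) V (action_rep c f)"
    using open_img by blast
qed

text \<open>The integrand coordinates required by the parameter integrals: a torus vector on the
  \<open>j\<close>-th axis, followed by the chart coordinates \<open>u\<close>.\<close>

definition orbit_point :: "nat \<Rightarrow> real \<Rightarrow> (nat \<Rightarrow> real) \<Rightarrow> nat \<Rightarrow> real" where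
  "orbit_point j t u i = (if i < l then axis_vec j t i else u (i - l))"

lemma orbit_point_parts:
  assumes "j < l"
  shows "left_part l (orbit_point j t u) = axis_vec j t" "right_part l (orbit_point j t u) = u"
  using assms by (auto simp: left_part_def right_part_def orbit_point_def axis_vec_def)

lemma orbit_point_in_dom:
  assumes "j < l" "c \<in> mfd_atlas X" "u \<in> chart_img c"
  shows "orbit_point j t u \<in> action_dom c"
proof -
  have "u \<in> Euc (chart_dim c)" using chart_of_img_subset[OF chartedD[OF ch assms(2)]] assms(3) by blast
  then have "orbit_point j t u \<in> Euc (l + chart_dim c)" by (auto simp: in_Euc orbit_point_def)
  then show ?thesis using assms by (simp add: action_dom_def orbit_point_parts)
qed

lemma action_rep_orbit_point: "j < l \<Longrightarrow> action_rep c f (orbit_point j t u) = f (\<Psi> j t (chart_inv c u))"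
  by (simp add: action_rep_def orbit_point_parts \<Psi>_def)

lemma continuous_axis_vec: "continuous_on A (\<lambda>t. axis_vec j t i)"
  by (cases "i = j") (auto simp: axis_vec_def intro: continuous_intros)

lemma continuous_orbit_point: "continuous_on A (\<lambda>t. orbit_point j t u)"
proof (rule continuous_on_coordinatewise_then_product)
  show "continuous_on A (\<lambda>t. orbit_point j t u i)" for i
    by (cases "i < l") (auto simp: orbit_point_def continuous_axis_vec)
qed

lemma continuous_orbit:
  assumes f: "Ck_real k X f" and j: "j < l" and x: "x \<in> points X"
  shows "continuous_on A (\<lambda>t. f (\<Psi> j t x))"
proof -
  obtain c where c: "c \<in> mfd_atlas X" "chart_of (mfd_top X) c" "x \<in> chart_dom c"
    using charted_obtain[OF ch x] by blast
  have u: "chart_map c x \<in> chart_img c" using c(3) by simp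
  have "continuous_on (action_dom c) (action_rep c f)"
    by (rule Ck_fun_nat_imp_continuous[OF openin_action_dom[OF c(1)] Ck_action_rep[OF f c(1), of 0]])
      (simp flip: zero_enat_def)
  from continuous_on_compose2[OF this continuous_orbit_point[of A j "chart_map c x"]]
  have "continuous_on A (\<lambda>t. action_rep c f (orbit_point j t (chart_map c x)))"
    using orbit_point_in_dom[OF j c(1) u] by auto
  then show ?thesis by (simp add: action_rep_orbit_point[OF j] chart_inv_map[OF c(2,3)])
qed

definition avg :: "nat \<Rightarrow> (real \<Rightarrow> real) \<Rightarrow> ('a \<Rightarrow> real) \<Rightarrow> 'a \<Rightarrow> real" where
  "avg j w f x = integral {0..1} (\<lambda>t. w t * f (\<Psi> j t x))"

lemma Ck_real_avg:
  assumes f: "Ck_real k X f" and j: "j < l" and w: "continuous_on {0..1} w"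
  shows "Ck_real k X (avg j w f)"
  unfolding Ck_real_def
proof (intro ballI allI impI)
  fix c r assume c: "c \<in> mfd_atlas X" and r: "enat r \<le> k"
  have "Ck_fun_nat r (chart_dim c) (chart_img c)
      (\<lambda>u. integral {0..1} (\<lambda>t. w t * action_rep c f (\<lambda>i. if i < l then axis_vec j t i else u (i - l))))"
    by (rule Ck_fun_nat_integral[OF chart_of_openin_img[OF chartedD[OF ch c]] openin_action_dom[OF c]
          continuous_axis_vec _ w Ck_action_rep[OF f c r]])
      (use orbit_point_in_dom[OF j c] in \<open>simp add: orbit_point_def[abs_def]\<close>)
  then show "Ck_fun_nat r (chart_dim c) (chart_img c) (\<lambda>u. avg j w f (chart_inv c u))"
    unfolding avg_def action_rep_orbit_point[OF j, symmetric] by (simp add: orbit_point_def[abs_def])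
qed

text \<open>
  Applied to differences of values at two points and to tangent vectors; \<open>\<gamma> t\<close> is then the value
  of \<open>D\<close> on \<open>f\<close> translated by \<open>t\<close> along the \<open>j\<close>-th circle.
\<close>
definition averaging :: "nat \<Rightarrow> (('a \<Rightarrow> real) \<Rightarrow> real) \<Rightarrow> bool" where
  "averaging j D \<longleftrightarrow>
    (\<forall>f g. Ck_real k X f \<longrightarrow> Ck_real k X g \<longrightarrow> D (\<lambda>x. f x + g x) = D f + D g) \<and>
    (\<forall>f g. (\<forall>x\<in>points X. f x = g x) \<longrightarrow> D f = D g) \<and>
    (\<forall>f. Ck_real k X f \<longrightarrow> (\<exists>\<gamma>. continuous_on {0..1} \<gamma> \<and> \<gamma> 0 = D f \<and> \<gamma> 1 = D f \<and>
       (\<forall>w. continuous_on {0..1} w \<longrightarrow> D (avg j w f) = integral {0..1} (\<lambda>t. w t * \<gamma> t))))"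

lemma averaging_points:
  assumes j: "j < l" and x: "x \<in> points X" and y: "y \<in> points X"
  shows "averaging j (\<lambda>f. f x - f y)"
  unfolding averaging_def
proof (intro conjI allI impI)
  fix f assume f: "Ck_real k X f"
  note cont = continuous_orbit[OF f j x] continuous_orbit[OF f j y]
  show "\<exists>\<gamma>. continuous_on {0..1} \<gamma> \<and> \<gamma> 0 = f x - f y \<and> \<gamma> 1 = f x - f y \<and>
    (\<forall>w. continuous_on {0..1} w \<longrightarrow> avg j w f x - avg j w f y = integral {0..1} (\<lambda>t. w t * \<gamma> t))"
  proof (intro exI[of _ "\<lambda>t. f (\<Psi> j t x) - f (\<Psi> j t y)"] conjI allI impI)
    show "continuous_on {0..1} (\<lambda>t. f (\<Psi> j t x) - f (\<Psi> j t y))" by (intro continuous_intros cont)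
    fix w :: "real \<Rightarrow> real" assume w: "continuous_on {0..1} w"
    have "integral {0..1} (\<lambda>t. w t * f (\<Psi> j t x) - w t * f (\<Psi> j t y)) = avg j w f x - avg j w f y"
      unfolding avg_def by (intro integral_diff integrable_continuous_interval continuous_intros w cont)
    then show "avg j w f x - avg j w f y = integral {0..1} (\<lambda>t. w t * (f (\<Psi> j t x) - f (\<Psi> j t y)))"
      by (simp add: right_diff_distrib)
  qed (simp_all add: \<Psi>_0 \<Psi>_1 x y j)
qed (use x y in auto)

text \<open>Here \<gamma> t is the derivative along \<open>v\<close> of \<open>f\<close> composed
  with the rotation by t. At times 0 and 1 the rotation is the identity, so both ends give back the
  derivative of \<open>f\<close>; differentiation under the integral sign gives the
  averages.\<close>

lemma averaging_tangent:
  assumes j: "j < l" and c: "c \<in> mfd_atlas X" and u: "u \<in> chart_img c"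
  shows "averaging j (\<lambda>f. \<Sum>i<chart_dim c. partial_deriv i (\<lambda>u. f (chart_inv c u)) u * v i)"
  unfolding averaging_def
proof (intro conjI allI impI)
  let ?d = "chart_dim c" and ?I = "chart_img c"
  have cc: "chart_of (mfd_top X) c" by (rule chartedD[OF ch c])
  have I: "openin (Euclidean_space ?d) ?I" by (rule chart_of_openin_img[OF cc])
  have k1: "enat (Suc 0) \<le> k" using k by (simp add: one_enat_def)
  have D: "((\<lambda>t. f (chart_inv c (u(i := t)))) has_real_derivative partial_deriv i (\<lambda>u. f (chart_inv c u)) u) (at (u i))"
    if "Ck_real k X f" "i < ?d" for f i
    by (rule Ck_fun_nat_Suc_D(1)[OF I Ck_realD[OF that(1) c k1] that(2) u])
  {
    fix f g assume fg: "Ck_real k X f" "Ck_real k X g"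
    have "partial_deriv i (\<lambda>u. f (chart_inv c u) + g (chart_inv c u)) u =
        partial_deriv i (\<lambda>u. f (chart_inv c u)) u + partial_deriv i (\<lambda>u. g (chart_inv c u)) u" if i: "i < ?d" for i
      unfolding partial_deriv_def[of i "\<lambda>u. f (chart_inv c u) + g (chart_inv c u)"]
      by (rule DERIV_imp_deriv[OF DERIV_add[OF D[OF fg(1) i] D[OF fg(2) i]]])
    then show "(\<Sum>i<?d. partial_deriv i (\<lambda>u. f (chart_inv c u) + g (chart_inv c u)) u * v i) =
      (\<Sum>i<?d. partial_deriv i (\<lambda>u. f (chart_inv c u)) u * v i) + (\<Sum>i<?d. partial_deriv i (\<lambda>u. g (chart_inv c u)) u * v i)"
      unfolding sum.distrib[symmetric] by (intro sum.cong) (auto simp: distrib_right)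
  next
    fix f g :: "'a \<Rightarrow> real" assume fg: "\<forall>x\<in>points X. f x = g x"
    have "partial_deriv i (\<lambda>u. f (chart_inv c u)) u = partial_deriv i (\<lambda>u. g (chart_inv c u)) u" if "i < ?d" for i
      by (rule partial_deriv_cong[OF I _ u that]) (use fg chart_inv_in_points[OF cc] in simp)
    then show "(\<Sum>i<?d. partial_deriv i (\<lambda>u. f (chart_inv c u)) u * v i) =
        (\<Sum>i<?d. partial_deriv i (\<lambda>u. g (chart_inv c u)) u * v i)"
      by (intro sum.cong) auto
  next
    fix f assume f: "Ck_real k X f"
    define G where "G = action_rep c f"
    note W = openin_action_dom[OF c]
    have G: "Ck_fun_nat (Suc 0) (l + ?d) (action_dom c) G" unfolding G_def by (rule Ck_action_rep[OF f c k1])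
    define \<gamma> where "\<gamma> t = (\<Sum>i<?d. partial_deriv (l + i) G (orbit_point j t u) * v i)" for t
    have cont_i: "continuous_on {0..1} (\<lambda>t. partial_deriv (l + i) G (orbit_point j t u))" if "i < ?d" for i
      by (rule continuous_on_compose2[OF Ck_fun_nat_imp_continuous[OF W Ck_fun_nat_Suc_D(2)[OF W G]] continuous_orbit_point])
        (use that orbit_point_in_dom[OF j c u] in auto)
    have ends: "\<gamma> t = (\<Sum>i<?d. partial_deriv i (\<lambda>u. f (chart_inv c u)) u * v i)"
      if t: "\<And>x. x \<in> points X \<Longrightarrow> \<Psi> j t x = x" for t
      unfolding \<gamma>_def
    proof (intro sum.cong refl arg_cong2[of _ _ _ _ "(*)"])
      fix i assume i: "i \<in> {..<?d}"
      have upd: "(orbit_point j t u)(l + i := s) = orbit_point j t (u(i := s))" for s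
        by (auto simp: orbit_point_def fun_eq_iff)
      have at: "orbit_point j t u (l + i) = u i" by (simp add: orbit_point_def)
      have "\<forall>\<^sub>F s in nhds (u i). action_rep c f (orbit_point j t (u(i := s))) = f (chart_inv c (u(i := s)))"
        using eventually_upd_in[OF I u, of i] i
        by (auto elim!: eventually_mono simp: action_rep_orbit_point[OF j] t chart_inv_in_points[OF cc])
      then show "partial_deriv (l + i) G (orbit_point j t u) = partial_deriv i (\<lambda>u. f (chart_inv c u)) u"
        unfolding partial_deriv_def G_def upd at by (rule deriv_cong_ev) simp
    qed
    show "\<exists>\<gamma>. continuous_on {0..1} \<gamma> \<and>
        \<gamma> 0 = (\<Sum>i<?d. partial_deriv i (\<lambda>u. f (chart_inv c u)) u * v i) \<and>
        \<gamma> 1 = (\<Sum>i<?d. partial_deriv i (\<lambda>u. f (chart_inv c u)) u * v i) \<and>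
        (\<forall>w. continuous_on {0..1} w \<longrightarrow>
          (\<Sum>i<?d. partial_deriv i (\<lambda>u. avg j w f (chart_inv c u)) u * v i) = integral {0..1} (\<lambda>t. w t * \<gamma> t))"
    proof (intro exI[of _ \<gamma>] conjI allI impI)
      show "continuous_on {0..1} \<gamma>" unfolding \<gamma>_def using cont_i by (intro continuous_intros) auto
      show "\<gamma> 0 = (\<Sum>i<?d. partial_deriv i (\<lambda>u. f (chart_inv c u)) u * v i)"
        "\<gamma> 1 = (\<Sum>i<?d. partial_deriv i (\<lambda>u. f (chart_inv c u)) u * v i)"
        by (rule ends, simp add: \<Psi>_0 \<Psi>_1 j)+
      fix w :: "real \<Rightarrow> real" assume w: "continuous_on {0..1} w"
      have "partial_deriv i (\<lambda>u. avg j w f (chart_inv c u)) u =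
          integral {0..1} (\<lambda>t. w t * partial_deriv (l + i) G (orbit_point j t u))" if i: "i < ?d" for i
      proof -
        have "((\<lambda>s. integral {0..1} (\<lambda>t. w t * G (\<lambda>ia. if ia < l then axis_vec j t ia else (u(i := s)) (ia - l)))) has_real_derivative
          integral {0..1} (\<lambda>t. w t * partial_deriv (l + i) G (\<lambda>i. if i < l then axis_vec j t i else u (i - l)))) (at (u i))"
          by (rule has_partial_integral[OF I W continuous_axis_vec _ w G u i])
            (use orbit_point_in_dom[OF j c] in \<open>simp add: orbit_point_def[abs_def]\<close>)
        then have "((\<lambda>s. integral {0..1} (\<lambda>t. w t * G (orbit_point j t (u(i := s))))) has_real_derivative
          integral {0..1} (\<lambda>t. w t * partial_deriv (l + i) G (orbit_point j t u))) (at (u i))"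
          by (simp only: orbit_point_def[abs_def])
        then have "((\<lambda>s. avg j w f (chart_inv c (u(i := s)))) has_real_derivative
          integral {0..1} (\<lambda>t. w t * partial_deriv (l + i) G (orbit_point j t u))) (at (u i))"
          by (simp only: avg_def G_def action_rep_orbit_point[OF j])
        then show ?thesis unfolding partial_deriv_def[of i "\<lambda>u. avg j w f (chart_inv c u)"] by (rule DERIV_imp_deriv)
      qed
      then have "(\<Sum>i<?d. partial_deriv i (\<lambda>u. avg j w f (chart_inv c u)) u * v i) =
          (\<Sum>i<?d. integral {0..1} (\<lambda>t. w t * partial_deriv (l + i) G (orbit_point j t u) * v i))"
        by (intro sum.cong) auto
      also have "\<dots> = integral {0..1} (\<lambda>t. \<Sum>i<?d. w t * partial_deriv (l + i) G (orbit_point j t u) * v i)"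
        by (rule integral_sum[symmetric]) (auto intro!: integrable_continuous_interval continuous_intros w cont_i)
      also have "\<dots> = integral {0..1} (\<lambda>t. w t * \<gamma> t)"
        by (simp add: \<gamma>_def sum_distrib_left mult.assoc)
      finally show "(\<Sum>i<?d. partial_deriv i (\<lambda>u. avg j w f (chart_inv c u)) u * v i) = integral {0..1} (\<lambda>t. w t * \<gamma> t)" .
    qed
  }
qed

subsection \<open>Joint eigenfunctions\<close>

definition weight :: "nat \<Rightarrow> int \<Rightarrow> ('a \<Rightarrow> complex) \<Rightarrow> bool" where
  "weight j m f \<longleftrightarrow> (\<forall>x\<in>points X. \<forall>t. f (\<Psi> j t x) = cis (2 * pi * of_int m * t) * f x)"

definition W :: "nat \<Rightarrow> ('a \<Rightarrow> complex) set" where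
  "W n = {f. Ck_real k X (\<lambda>x. Re (f x)) \<and> Ck_real k X (\<lambda>x. Im (f x)) \<and> (\<forall>j<n. \<exists>m. weight j m f)}"

text \<open>The \<open>m\<close>-th Fourier coefficient along the orbits of the \<open>j\<close>-th
  circle, that is, the projection onto the functions of weight \<open>m\<close>.\<close>

definition P :: "nat \<Rightarrow> int \<Rightarrow> ('a \<Rightarrow> complex) \<Rightarrow> 'a \<Rightarrow> complex" where
  "P j m f x = integral {0..1} (\<lambda>t. cis (- (2 * pi * of_int m * t)) * f (\<Psi> j t x))"

lemma continuous_orbit_complex:
  assumes f: "f \<in> W n" and j: "j < l" and x: "x \<in> points X"
  shows "continuous_on A (\<lambda>t. f (\<Psi> j t x))"
proof -
  have "continuous_on A (\<lambda>t. complex_of_real (Re (f (\<Psi> j t x))) + \<i> * complex_of_real (Im (f (\<Psi> j t x))))"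
    using f by (intro continuous_intros continuous_orbit[OF _ j x]) (auto simp: W_def)
  then show ?thesis by (simp only: complex_eq[symmetric])
qed

lemma continuous_integrand:
  assumes "f \<in> W n" "j < l" "x \<in> points X"
  shows "continuous_on A (\<lambda>t. cis (- (2 * pi * of_int m * t)) * f (\<Psi> j t x))"
  by (intro continuous_intros continuous_orbit_complex[OF assms])

text \<open>Regularity is defined for real functions, so the complex projection has to be split into
  real averages with cosines and sines as weights.\<close>

lemma P_parts:
  assumes f: "f \<in> W n" and j: "j < l" and x: "x \<in> points X"
  shows "Re (P j m f x) = avg j (\<lambda>t. cos (2 * pi * of_int m * t)) (\<lambda>x. Re (f x)) x +
            avg j (\<lambda>t. sin (2 * pi * of_int m * t)) (\<lambda>x. Im (f x)) x"
    and "Im (P j m f x) = avg j (\<lambda>t. cos (2 * pi * of_int m * t)) (\<lambda>x. Im (f x)) x +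
            avg j (\<lambda>t. - sin (2 * pi * of_int m * t)) (\<lambda>x. Re (f x)) x"
proof -
  have fR: "Ck_real k X (\<lambda>x. Re (f x))" and fI: "Ck_real k X (\<lambda>x. Im (f x))" using f by (auto simp: W_def)
  have I: "((\<lambda>t. cis (- (2 * pi * of_int m * t)) * f (\<Psi> j t x)) has_integral P j m f x) {0..1}"
    unfolding P_def
    by (intro integrable_integral integrable_continuous_interval continuous_integrand[OF f j x])
  have "Re (P j m f x) = integral {0..1} (\<lambda>t. cos (2 * pi * of_int m * t) * Re (f (\<Psi> j t x)) + sin (2 * pi * of_int m * t) * Im (f (\<Psi> j t x)))"
    using integral_unique[OF has_integral_Re[OF I]] by simp
  also have "\<dots> = avg j (\<lambda>t. cos (2 * pi * of_int m * t)) (\<lambda>x. Re (f x)) x + avg j (\<lambda>t. sin (2 * pi * of_int m * t)) (\<lambda>x. Im (f x)) x"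
    unfolding avg_def
    by (intro integral_add integrable_continuous_interval continuous_intros continuous_orbit[OF fR j x] continuous_orbit[OF fI j x])
  finally show "Re (P j m f x) = avg j (\<lambda>t. cos (2 * pi * of_int m * t)) (\<lambda>x. Re (f x)) x +
            avg j (\<lambda>t. sin (2 * pi * of_int m * t)) (\<lambda>x. Im (f x)) x" .
  have "Im (P j m f x) = integral {0..1} (\<lambda>t. cos (2 * pi * of_int m * t) * Im (f (\<Psi> j t x)) + - sin (2 * pi * of_int m * t) * Re (f (\<Psi> j t x)))"
    using integral_unique[OF has_integral_Im[OF I]] by simp
  also have "\<dots> = avg j (\<lambda>t. cos (2 * pi * of_int m * t)) (\<lambda>x. Im (f x)) x + avg j (\<lambda>t. - sin (2 * pi * of_int m * t)) (\<lambda>x. Re (f x)) x"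
    unfolding avg_def
    by (intro integral_add integrable_continuous_interval continuous_intros continuous_orbit[OF fR j x] continuous_orbit[OF fI j x])
  finally show "Im (P j m f x) = avg j (\<lambda>t. cos (2 * pi * of_int m * t)) (\<lambda>x. Im (f x)) x +
            avg j (\<lambda>t. - sin (2 * pi * of_int m * t)) (\<lambda>x. Re (f x)) x" .
qed

text \<open>Shifting the variable in a periodic integral produces the new weight \<open>m\<close>;
  the weights for earlier circles persist because these commute with the \<open>j\<close>-th
  one.\<close>

lemma P_in_W:
  assumes f: "f \<in> W j" and j: "j < l"
  shows "P j m f \<in> W (Suc j)"
  unfolding W_def mem_Collect_eq
proof (intro conjI allI impI)
  have fR: "Ck_real k X (\<lambda>x. Re (f x))" and fI: "Ck_real k X (\<lambda>x. Im (f x))" using f by (auto simp: W_def)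
  have cont: "continuous_on {0..1} (\<lambda>t. cos (2 * pi * of_int m * t))" "continuous_on {0..1} (\<lambda>t. sin (2 * pi * of_int m * t))"
    "continuous_on {0..1} (\<lambda>t. - sin (2 * pi * of_int m * t))" by (intro continuous_intros)+
  show "Ck_real k X (\<lambda>x. Re (P j m f x))"
    by (rule Ck_real_cong[OF ch _ Ck_real_add[OF ch Ck_real_avg[OF fR j cont(1)] Ck_real_avg[OF fI j cont(2)]]])
      (simp only: P_parts[OF f j])
  show "Ck_real k X (\<lambda>x. Im (P j m f x))"
    by (rule Ck_real_cong[OF ch _ Ck_real_add[OF ch Ck_real_avg[OF fI j cont(1)] Ck_real_avg[OF fR j cont(3)]]])
      (simp only: P_parts[OF f j])
  fix i assume i: "i < Suc j"
  show "\<exists>m'. weight i m' (P j m f)"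
  proof (cases "i = j")
    case True
    have "weight j m (P j m f)"
      unfolding weight_def
    proof (intro ballI allI)
      fix x s assume x: "x \<in> points X"
      let ?\<phi> = "\<lambda>t. cis (- (2 * pi * of_int m * t)) * f (\<Psi> j t x)"
      have per: "?\<phi> (t + 1) = ?\<phi> t" for t
      proof -
        have "cis (- (2 * pi * of_int m * (t + 1))) = cis (- (2 * pi * of_int m * t)) * cis (2 * pi * of_int (- m))"
          by (simp add: cis_mult algebra_simps)
        then show ?thesis by (simp only: cis_multiple_2pi[OF Ints_of_int] mult_1_right \<Psi>_periodic[OF x j])
      qed
      have "cis (- (2 * pi * of_int m * t)) * f (\<Psi> j t (\<Psi> j s x)) = cis (2 * pi * of_int m * s) * ?\<phi> (t + s)" for t
        unfolding \<Psi>_add[OF x j, symmetric] mult.assoc[symmetric] cis_mult by (simp add: algebra_simps)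
      then have "P j m f (\<Psi> j s x) = cis (2 * pi * of_int m * s) * integral {0..1} (\<lambda>t. ?\<phi> (t + s))"
        unfolding P_def by (simp only: integral_mult_right)
      also have "integral {0..1} (\<lambda>t. ?\<phi> (t + s)) = P j m f x"
        unfolding P_def by (rule integral_periodic_shift[OF continuous_integrand[OF f j x] per])
      finally show "P j m f (\<Psi> j s x) = cis (2 * pi * of_int m * s) * P j m f x" .
    qed
    then show ?thesis using True by blast
  next
    case False
    then have ij: "i < j" "i < l" using i j by auto
    then obtain m' where m': "weight i m' f" using f by (auto simp: W_def)
    have "weight i m' (P j m f)"
      unfolding weight_def
    proof (intro ballI allI)
      fix x s assume x: "x \<in> points X"
      have "cis (- (2 * pi * of_int m * t)) * f (\<Psi> j t (\<Psi> i s x)) =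
          cis (2 * pi * of_int m' * s) * (cis (- (2 * pi * of_int m * t)) * f (\<Psi> j t x))" for t
        using m' \<Psi>_commute[OF x ij(2) j, of t s] \<Psi>_closed[OF x j] by (simp add: weight_def)
      then show "P j m f (\<Psi> i s x) = cis (2 * pi * of_int m' * s) * P j m f x"
        unfolding P_def by (simp only: integral_mult_right)
    qed
    then show ?thesis by blast
  qed
qed

text \<open>The real parts of the projections to the weights m and -m add up to twice the cosine
  average of the real part of \<open>f\<close>, since the sine terms cancel. As \<open>D\<close>
  vanishes on both, all cosine coefficients of \<gamma> are 0, hence so is \<gamma> 0, the value of
  \<open>D\<close> in question.\<close>

lemma averaging_vanishes:
  assumes D: "averaging j D" and j: "j < l" and zero: "\<And>F. F \<in> W (Suc j) \<Longrightarrow> D (\<lambda>x. Re (F x)) = 0"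
    and f: "f \<in> W j"
  shows "D (\<lambda>x. Re (f x)) = 0"
proof -
  have add: "D (\<lambda>x. g x + h x) = D g + D h" if "Ck_real k X g" "Ck_real k X h" for g h
    using D that unfolding averaging_def by blast
  have cong: "D g = D h" if "\<And>x. x \<in> points X \<Longrightarrow> g x = h x" for g h
    using D that unfolding averaging_def by blast
  have fR: "Ck_real k X (\<lambda>x. Re (f x))" using f by (simp add: W_def)
  have "\<exists>\<gamma>. continuous_on {0..1} \<gamma> \<and> \<gamma> 0 = D (\<lambda>x. Re (f x)) \<and> \<gamma> 1 = D (\<lambda>x. Re (f x)) \<and>
       (\<forall>w. continuous_on {0..1} w \<longrightarrow> D (avg j w (\<lambda>x. Re (f x))) = integral {0..1} (\<lambda>t. w t * \<gamma> t))"
    using D[unfolded averaging_def, THEN conjunct2, THEN conjunct2, rule_format, OF fR] .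
  then obtain \<gamma> where \<gamma>: "continuous_on {0..1} \<gamma>" "\<gamma> 0 = D (\<lambda>x. Re (f x))" "\<gamma> 1 = D (\<lambda>x. Re (f x))"
    and \<gamma>w: "\<forall>w. continuous_on {0..1} w \<longrightarrow> D (avg j w (\<lambda>x. Re (f x))) = integral {0..1} (\<lambda>t. w t * \<gamma> t)"
    by (elim exE conjE)
  have "integral {0..1} (\<lambda>t. cos (2 * pi * of_nat m * t) * \<gamma> t) = 0" for m :: nat
  proof -
    let ?w = "\<lambda>t. cos (2 * pi * of_nat m * t)"
    let ?A = "avg j ?w (\<lambda>x. Re (f x))"
    have w: "continuous_on {0..1} ?w" by (intro continuous_intros)
    have PW: "P j (int m) f \<in> W (Suc j)" "P j (- int m) f \<in> W (Suc j)" by (rule P_in_W[OF f j])+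
    have "?A x + ?A x = Re (P j (int m) f x) + Re (P j (- int m) f x)" if x: "x \<in> points X" for x
      unfolding P_parts[OF f j x] by (simp add: avg_def)
    then have "D (\<lambda>x. ?A x + ?A x) = D (\<lambda>x. Re (P j (int m) f x) + Re (P j (- int m) f x))" by (rule cong)
    also have "\<dots> = D (\<lambda>x. Re (P j (int m) f x)) + D (\<lambda>x. Re (P j (- int m) f x))"
      using PW by (intro add) (auto simp: W_def)
    also have "\<dots> = 0" by (simp add: zero[OF PW(1)] zero[OF PW(2)])
    also have "D (\<lambda>x. ?A x + ?A x) = D ?A + D ?A" by (intro add Ck_real_avg[OF fR j w])
    finally have "D ?A = 0" by simp
    then show ?thesis using \<gamma>w w by simp
  qed
  then have "\<gamma> 0 = 0" by (rule fourier_zero[OF \<gamma>(1)]) (simp add: \<gamma>)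
  then show ?thesis by (simp add: \<gamma>)
qed

definition W_re :: "nat \<Rightarrow> ('a \<Rightarrow> real) set" where
  "W_re n = (\<lambda>f x. Re (f x)) ` W n"

text \<open>One more circle in each step: a functional that vanishes on the functions with weights
  for \<open>n + 1\<close> circles already vanishes on those with weights for \<open>n\<close>. The
  functionals are differences of values at two points and tangent vectors.\<close>

lemma separating_W:
  "n \<le> l \<Longrightarrow> separating X (W_re n)"
proof (induction n)
  case 0
  have "W_re 0 = {f. Ck_real k X f}"
  proof (intro equalityI subsetI)
    fix f assume "f \<in> {f. Ck_real k X f}"
    then have "(\<lambda>x. complex_of_real (f x)) \<in> W 0" by (simp add: W_def Ck_real_const)
    then show "f \<in> W_re 0" unfolding W_re_def by (rule rev_image_eqI) simp
  qed (auto simp: W_re_def W_def)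
  then show ?case using separating_Ck_real[OF X] by simp
next
  case (Suc n)
  then have n: "n < l" and sep: "separating X (W_re n)" by auto
  have test: "\<forall>f\<in>W_re n. D f = 0" if D: "averaging n D" and z: "\<forall>f\<in>W_re (Suc n). D f = 0" for D
  proof -
    have "D (\<lambda>x. Re (F x)) = 0" if "F \<in> W (Suc n)" for F
      using z that by (simp add: W_re_def)
    then have "D (\<lambda>x. Re (F x)) = 0" if "F \<in> W n" for F
      using averaging_vanishes[OF D n _ that] by blast
    then show ?thesis by (simp add: W_re_def)
  qed
  show ?case
    unfolding separating_def
  proof (intro conjI ballI impI)
    fix x y assume x: "x \<in> points X" and y: "y \<in> points X" and eq: "\<forall>f\<in>W_re (Suc n). f x = f y"
    then have "\<forall>f\<in>W_re n. f x - f y = 0" by (intro test[OF averaging_points[OF n x y]]) simp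
    then have "\<forall>f\<in>W_re n. f x = f y" by simp
    then show "x = y" using sep x y unfolding separating_def by blast
  next
    fix c x assume c: "c \<in> mfd_atlas X" and x: "x \<in> chart_dom c"
    have u: "chart_map c x \<in> chart_img c" using x by simp
    have triv: "chart_kernel_trivial c x (W_re n)" using sep c x unfolding separating_def by blast
    show "chart_kernel_trivial c x (W_re (Suc n))"
      unfolding chart_kernel_trivial_def
    proof (rule allI, rule impI)
      fix v assume "\<forall>f\<in>W_re (Suc n). (\<Sum>i<chart_dim c. partial_deriv i (\<lambda>u. f (chart_inv c u)) (chart_map c x) * v i) = 0"
      then have "\<forall>f\<in>W_re n. (\<Sum>i<chart_dim c. partial_deriv i (\<lambda>u. f (chart_inv c u)) (chart_map c x) * v i) = 0"
        by (rule test[OF averaging_tangent[OF n c u]])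
      then show "\<forall>i<chart_dim c. v i = 0"
        by (rule mp[OF spec[OF triv[unfolded chart_kernel_trivial_def]]])
    qed
  qed
qed

text \<open>The vector \<open>h\<close> is reached from 0 by one rotation per axis, each
  contributing the factor of its weight.\<close>

lemma W_eigen:
  assumes f: "f \<in> W l"
  obtains m :: "nat \<Rightarrow> int" where "\<And>h x. h \<in> Euc l \<Longrightarrow> x \<in> points X \<Longrightarrow>
    f (T h x) = cis (2 * pi * (\<Sum>i<l. of_int (m i) * h i)) * f x"
proof -
  have "\<forall>j. \<exists>m. j < l \<longrightarrow> weight j m f" using f by (auto simp: W_def)
  from choice[OF this] obtain m where m: "\<And>j. j < l \<Longrightarrow> weight j (m j) f" by blast
  have "f (T h x) = cis (2 * pi * (\<Sum>i<l. of_int (m i) * h i)) * f x"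
    if h: "h \<in> Euc l" and x: "x \<in> points X" for h x
  proof -
    have left_part_id: "left_part l h = h" using h by (auto simp: left_part_def in_Euc fun_eq_iff)
    have E: "left_part n h \<in> Euc l" for n using h by (auto simp: left_part_def in_Euc)
    have "f (T (left_part n h) x) = cis (2 * pi * (\<Sum>i<n. of_int (m i) * h i)) * f x" if "n \<le> l" for n
      using that
    proof (induction n)
      case 0
      have "left_part 0 h = (\<lambda>_. 0)" by (simp add: left_part_def fun_eq_iff)
      then show ?case by (simp add: T_zero[OF x])
    next
      case (Suc n)
      have "left_part (Suc n) h = (\<lambda>i. axis_vec n (h n) i + left_part n h i)"
        by (auto simp: left_part_def axis_vec_def less_Suc_eq)
      then have "T (left_part (Suc n) h) x = \<Psi> n (h n) (T (left_part n h) x)"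
        using T_add[OF x axis_vec_in_Euc E] Suc.prems by (simp add: \<Psi>_def)
      moreover have "weight n (m n) f" using Suc.prems by (intro m) simp
      then have "f (\<Psi> n (h n) (T (left_part n h) x)) = cis (2 * pi * of_int (m n) * h n) * f (T (left_part n h) x)"
        unfolding weight_def by (elim ballE allE) (use T_closed[OF x E] in blast)+
      ultimately have "f (T (left_part (Suc n) h) x) = cis (2 * pi * of_int (m n) * h n) * f (T (left_part n h) x)"
        by simp
      also have "f (T (left_part n h) x) = cis (2 * pi * (\<Sum>i<n. of_int (m i) * h i)) * f x"
        using Suc.prems by (intro Suc.IH) simp
      finally show ?case by (simp only: sum.lessThan_Suc distrib_left cis_mult[symmetric] mult_ac)
    qed
    from this[OF order_refl] show ?thesis
      by (simp only: left_part_id)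
  qed
  then show ?thesis using that by blast
qed

end

subsection \<open>Linearization of subgroups of torus actions\<close>

text \<open>C^N as R^(2N), all real parts before all imaginary parts, and zero beyond so that the
  values lie in \<open>Euc (2 * N)\<close>.\<close>

definition re_im :: "nat \<Rightarrow> (nat \<Rightarrow> complex) \<Rightarrow> nat \<Rightarrow> real" where
  "re_im N z i = (if i < N then Re (z i) else if i < 2 * N then Im (z (i - N)) else 0)"

lemma re_im_sums:
  assumes "\<And>a. q a sums c a"
  shows "(\<lambda>r. re_im N (\<lambda>a. q a r) i) sums re_im N c i"
  using sums_Re[OF assms] sums_Im[OF assms] by (simp add: re_im_def)

text \<open>Multiplication of the a-th complex coordinate by i \<mu> a, written in the real
  coordinates of \<open>re_im\<close>.\<close>

definition rotation_mat :: "nat \<Rightarrow> (nat \<Rightarrow> real) \<Rightarrow> real mat" where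
  "rotation_mat N \<mu> = Matrix.mat (2 * N) (2 * N)
     (\<lambda>(i, j). if j = i + N then - \<mu> i else if i = j + N then \<mu> j else 0)"

lemma rotation_mat_carrier [simp]: "rotation_mat N \<mu> \<in> carrier_mat (2 * N) (2 * N)"
  by (simp add: rotation_mat_def)

lemma rotation_mat_dim: "dim_row (rotation_mat N \<mu>) = 2 * N" "dim_col (rotation_mat N \<mu>) = 2 * N"
  by (simp_all add: rotation_mat_def)

lemma rotation_mat_mult_vec:
  "rotation_mat N \<mu> *\<^sub>v Matrix.vec (2 * N) (re_im N z) = Matrix.vec (2 * N) (re_im N (\<lambda>a. \<i> * \<mu> a * z a))"
proof (rule eq_vecI)
  fix i assume "i < dim_vec (Matrix.vec (2 * N) (re_im N (\<lambda>a. \<i> * \<mu> a * z a)))"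
  then have i: "i < 2 * N" by simp
  have "(rotation_mat N \<mu> *\<^sub>v Matrix.vec (2 * N) (re_im N z)) $ i =
      (\<Sum>j<2 * N. (if j = i + N then - \<mu> i else if i = j + N then \<mu> j else 0) * re_im N z j)"
    using i by (simp add: rotation_mat_def scalar_prod_def lessThan_atLeast0)
  also have "\<dots> = re_im N (\<lambda>a. \<i> * \<mu> a * z a) i"
  proof (cases "i < N")
    case True
    have "(\<Sum>j<2 * N. (if j = i + N then - \<mu> i else if i = j + N then \<mu> j else 0) * re_im N z j) =
        (\<Sum>j<2 * N. if j = i + N then - \<mu> i * re_im N z j else 0)"
      using True by (intro sum.cong) auto
    then show ?thesis using True by (simp add: re_im_def)
  next
    case False
    have "(\<Sum>j<2 * N. (if j = i + N then - \<mu> i else if i = j + N then \<mu> j else 0) * re_im N z j) =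
        (\<Sum>j<2 * N. if j = i - N then \<mu> j * re_im N z j else 0)"
      using False by (intro sum.cong) auto
    then show ?thesis using False i by (auto simp: re_im_def)
  qed
  finally show "(rotation_mat N \<mu> *\<^sub>v Matrix.vec (2 * N) (re_im N z)) $ i =
      Matrix.vec (2 * N) (re_im N (\<lambda>a. \<i> * \<mu> a * z a)) $ i"
    using i by simp
qed (simp add: rotation_mat_def)

lemma rotation_mat_pow_mult_vec:
  "(rotation_mat N \<mu> ^\<^sub>m r) *\<^sub>v Matrix.vec (2 * N) (re_im N z) =
    Matrix.vec (2 * N) (re_im N (\<lambda>a. (\<i> * \<mu> a) ^ r * z a))"
proof (induction r arbitrary: z)
  case 0
  have "dim_row (rotation_mat N \<mu>) = 2 * N" by (simp add: rotation_mat_def)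
  then show ?case by simp
next
  case (Suc r)
  have "(rotation_mat N \<mu> ^\<^sub>m Suc r) *\<^sub>v Matrix.vec (2 * N) (re_im N z) =
      (rotation_mat N \<mu> ^\<^sub>m r) *\<^sub>v (rotation_mat N \<mu> *\<^sub>v Matrix.vec (2 * N) (re_im N z))"
    unfolding pow_mat.simps
    by (rule assoc_mult_mat_vec[OF pow_carrier_mat[OF rotation_mat_carrier] rotation_mat_carrier]) simp
  then show ?case by (simp only: rotation_mat_mult_vec Suc.IH power_Suc2 mult.assoc)
qed

text \<open>Powers of the generator act as powers of i \<mu> a, so the matrix exponential series
  becomes the complex one in each coordinate.\<close>

lemma mat_exp_rotation_mat:
  "mat_exp (t \<cdot>\<^sub>m rotation_mat N \<mu>) *\<^sub>v Matrix.vec (2 * N) (re_im N z) =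
    Matrix.vec (2 * N) (re_im N (\<lambda>a. cis (\<mu> a * t) * z a))"
proof (rule eq_vecI)
  let ?B = "rotation_mat N \<mu>" and ?v = "re_im N z"
  have dim: "dim_row (mat_exp (t \<cdot>\<^sub>m ?B)) = 2 * N" "dim_col (mat_exp (t \<cdot>\<^sub>m ?B)) = 2 * N"
    by (simp_all add: mat_exp_def rotation_mat_def)
  then show "dim_vec (mat_exp (t \<cdot>\<^sub>m ?B) *\<^sub>v Matrix.vec (2 * N) ?v) =
      dim_vec (Matrix.vec (2 * N) (re_im N (\<lambda>a. cis (\<mu> a * t) * z a)))" by simp
  fix i assume "i < dim_vec (Matrix.vec (2 * N) (re_im N (\<lambda>a. cis (\<mu> a * t) * z a)))"
  then have i: "i < 2 * N" by simp
  have entry: "(\<lambda>r. (?B ^\<^sub>m r) $$ (i, j) / fact r * t ^ r) sums mat_exp (t \<cdot>\<^sub>m ?B) $$ (i, j)" if j: "j < 2 * N" for j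
    unfolding mat_exp_entry[OF rotation_mat_carrier i j]
    by (rule summable_sums[OF summable_mat_exp_entry[OF rotation_mat_carrier i j]])
  have "(\<lambda>r. \<Sum>j<2 * N. (?B ^\<^sub>m r) $$ (i, j) / fact r * t ^ r * ?v j) sums
      (\<Sum>j<2 * N. mat_exp (t \<cdot>\<^sub>m ?B) $$ (i, j) * ?v j)"
    by (intro sums_sum sums_mult2 entry) simp
  also have "(\<lambda>r. \<Sum>j<2 * N. (?B ^\<^sub>m r) $$ (i, j) / fact r * t ^ r * ?v j) =
      (\<lambda>r. re_im N (\<lambda>a. (\<i> * \<mu> a * t) ^ r /\<^sub>R fact r * z a) i)"
  proof
    fix r
    have "(\<Sum>j<2 * N. (?B ^\<^sub>m r) $$ (i, j) * ?v j) = ((?B ^\<^sub>m r) *\<^sub>v Matrix.vec (2 * N) ?v) $ i"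
      using i by (simp add: scalar_prod_def lessThan_atLeast0 carrier_matD[OF pow_carrier_mat[OF rotation_mat_carrier]] rotation_mat_dim)
    also have "\<dots> = re_im N (\<lambda>a. (\<i> * \<mu> a) ^ r * z a) i" using i by (simp add: rotation_mat_pow_mult_vec)
    finally have pow: "(\<Sum>j<2 * N. (?B ^\<^sub>m r) $$ (i, j) * ?v j) = re_im N (\<lambda>a. (\<i> * \<mu> a) ^ r * z a) i" .
    have "(\<Sum>j<2 * N. (?B ^\<^sub>m r) $$ (i, j) / fact r * t ^ r * ?v j) =
        t ^ r / fact r * re_im N (\<lambda>a. (\<i> * \<mu> a) ^ r * z a) i"
      unfolding pow[symmetric] by (simp add: sum_distrib_left mult_ac)
    also have "\<dots> = re_im N (\<lambda>a. of_real (t ^ r / fact r) * ((\<i> * \<mu> a) ^ r * z a)) i"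
      by (simp add: re_im_def del: of_real_power of_real_divide)
    also have "\<dots> = re_im N (\<lambda>a. (\<i> * \<mu> a * t) ^ r /\<^sub>R fact r * z a) i"
      by (simp add: power_mult_distrib scaleR_conv_of_real divide_inverse mult_ac)
    finally show "(\<Sum>j<2 * N. (?B ^\<^sub>m r) $$ (i, j) / fact r * t ^ r * ?v j) =
        re_im N (\<lambda>a. (\<i> * \<mu> a * t) ^ r /\<^sub>R fact r * z a) i" .
  qed
  finally have 1: "(\<lambda>r. re_im N (\<lambda>a. (\<i> * \<mu> a * t) ^ r /\<^sub>R fact r * z a) i) sums
      (\<Sum>j<2 * N. mat_exp (t \<cdot>\<^sub>m ?B) $$ (i, j) * ?v j)" .
  have "(\<lambda>r. (\<i> * \<mu> a * t) ^ r /\<^sub>R fact r * z a) sums (cis (\<mu> a * t) * z a)" for a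
    using sums_mult2[OF exp_converges[of "\<i> * \<mu> a * t"], of "z a"] by (simp add: cis_conv_exp mult_ac)
  then have 2: "(\<lambda>r. re_im N (\<lambda>a. (\<i> * \<mu> a * t) ^ r /\<^sub>R fact r * z a) i) sums
      re_im N (\<lambda>a. cis (\<mu> a * t) * z a) i"
    by (rule re_im_sums)
  show "(mat_exp (t \<cdot>\<^sub>m ?B) *\<^sub>v Matrix.vec (2 * N) ?v) $ i =
      Matrix.vec (2 * N) (re_im N (\<lambda>a. cis (\<mu> a * t) * z a)) $ i"
    using sums_unique2[OF 1 2] i dim by (simp add: scalar_prod_def lessThan_atLeast0)
qed

text \<open>The real parts \<open>g a\<close> of finitely many joint eigenfunctions separate points
  and tangent vectors; the imaginary parts join them because only together do they transform
  linearly under the flow. Being injective and continuous from a compact to a Hausdorff space,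
  \<open>F\<close> is a topological embedding.\<close>

lemma (in Ck_torus_action_on) linearizable:
  assumes cpt: "compact_space (mfd_top X)" and sub: "one_parameter_subgroup \<Phi> l \<Theta>"
  shows "linearizable_by_Ck_embedding k X \<Phi>"
proof -
  obtain \<omega> where \<omega>: "\<omega> \<in> Euc l" and \<Phi>: "\<And>t. \<Phi> t = T (\<lambda>i. \<omega> i * t)"
    using sub by (auto simp: one_parameter_subgroup_def T_def topspace_Euc)
  have W_Ck: "Ck_real k X f" if "f \<in> W_re l" for f using that by (auto simp: W_re_def W_def)
  have "\<exists>G. finite G \<and> G \<subseteq> W_re l \<and> separating X G"
    by (rule finite_separating_family[OF X k cpt _ separating_W[OF order_refl]]) (rule W_Ck)
  then obtain G where G: "finite G" "G \<subseteq> W_re l" "separating X G"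
    by (elim exE conjE)
  obtain N :: nat and g where g: "G = g ` {..<N}"
    using G(1) by (auto simp: finite_conv_nat_seg_image lessThan_def)
  have "\<forall>a. \<exists>f. a < N \<longrightarrow> f \<in> W l \<and> g a = (\<lambda>x. Re (f x))"
    using G(2) unfolding g W_re_def by blast
  from choice[OF this] obtain f where f: "\<And>a. a < N \<Longrightarrow> f a \<in> W l" and gf: "\<And>a. a < N \<Longrightarrow> g a = (\<lambda>x. Re (f a x))"
    by blast
  have "\<exists>\<mu>. \<forall>t. \<forall>x\<in>points X. f a (\<Phi> t x) = cis (\<mu> * t) * f a x" if a: "a < N" for a
  proof -
    obtain m :: "nat \<Rightarrow> int" where m: "\<And>h x. h \<in> Euc l \<Longrightarrow> x \<in> points X \<Longrightarrow>
        f a (T h x) = cis (2 * pi * (\<Sum>i<l. of_int (m i) * h i)) * f a x"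
      by (rule W_eigen[OF f[OF a]]) blast
    have E: "(\<lambda>i. \<omega> i * t) \<in> Euc l" for t using \<omega> by (simp add: in_Euc)
    \<comment> \<open>The frequency is obtained by inserting the direction \<open>\<omega>\<close>
      into the exponent of the character.\<close>
    show ?thesis
      by (rule exI[of _ "2 * pi * (\<Sum>i<l. of_int (m i) * \<omega> i)"])
        (simp add: \<Phi> m[OF E] sum_distrib_left sum_distrib_right mult.assoc)
  qed
  then have "\<forall>a. \<exists>\<mu>. a < N \<longrightarrow> (\<forall>t. \<forall>x\<in>points X. f a (\<Phi> t x) = cis (\<mu> * t) * f a x)" by blast
  from choice[OF this] obtain \<mu> where
    \<mu>: "\<And>a t x. a < N \<Longrightarrow> x \<in> points X \<Longrightarrow> f a (\<Phi> t x) = cis (\<mu> a * t) * f a x"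
    by blast
  define F where "F x = re_im N (\<lambda>a. f a x)" for x
  have F_Re: "F x a = g a x" if "a < N" for a x using that by (simp add: F_def re_im_def gf)
  have F_Euc: "F \<in> points X \<rightarrow> Euc (2 * N)" by (auto simp: F_def re_im_def in_Euc)
  have F_Ck: "Ck_real k X (\<lambda>x. F x i)" if "i < 2 * N" for i
  proof (cases "i < N")
    case True then show ?thesis using f[of i] by (simp add: F_def re_im_def W_def)
  next
    case False then show ?thesis using f[of "i - N"] that by (simp add: F_def re_im_def W_def)
  qed
  have cont: "continuous_map (mfd_top X) (Euclidean_space (2 * N)) F"
    unfolding continuous_map_Euc_iff using F_Euc F_Ck Ck_real_continuous[OF ch] by blast
  have "inj_on F (points X)"
  proof (rule inj_onI)
    fix x y assume x: "x \<in> points X" and y: "y \<in> points X" and eq: "F x = F y"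
    have "\<forall>h\<in>G. h x = h y" unfolding g using F_Re[of _ x] F_Re[of _ y] eq by auto
    then show "x = y" using G(3) x y unfolding separating_def by blast
  qed
  then have emb: "embedding_map (mfd_top X) (Euclidean_space (2 * N)) F"
    by (intro injective_closed_imp_embedding_map cont
        continuous_imp_closed_map_gen[OF cpt Hausdorff_imp_kc_space[OF Hausdorff_Euclidean_space]])
  have "immersive X (2 * N) F"
    unfolding immersive_def
  proof (rule ballI, rule ballI, rule allI, rule impI)
    fix c u w assume c: "c \<in> mfd_atlas X" and u: "u \<in> chart_img c"
      and z: "\<forall>a<2 * N. (\<Sum>i<chart_dim c. partial_deriv i (\<lambda>u. F (chart_inv c u) a) u * w i) = 0"
    note cc = chartedD[OF ch c]
    have "chart_kernel_trivial c (chart_inv c u) G"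
      using G(3) c chart_inv_in_dom[OF u] unfolding separating_def by blast
    moreover have "(\<Sum>i<chart_dim c. partial_deriv i (\<lambda>u. h (chart_inv c u)) u * w i) = 0" if h: "h \<in> G" for h
    proof -
      obtain a where a: "a < N" "h = g a" using h g by blast
      show ?thesis using z[rule_format, of a] a by (simp add: F_Re)
    qed
    ultimately show "\<forall>i<chart_dim c. w i = 0"
      unfolding chart_kernel_trivial_def chart_map_inv[OF u] by simp
  qed
  then have "Ck_embedding k X (Euclidean_mfd (2 * N)) F"
    unfolding Ck_embedding_def Ck_map_Euclidean_iff[OF ch cont] immersion_Euclidean_iff[OF ch F_Euc]
    using F_Ck emb by (simp add: Euclidean_mfd_def)
  moreover have "linearizing X \<Phi> (2 * N) F"
    unfolding linearizing_def topspace_Euc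
  proof (intro conjI bexI[of _ "rotation_mat N \<mu>"] allI ballI F_Euc)
    fix t x assume x: "x \<in> points X"
    have "re_im N (\<lambda>a. f a (\<Phi> t x)) = re_im N (\<lambda>a. cis (\<mu> a * t) * f a x)"
      by (auto simp: re_im_def fun_eq_iff \<mu>[OF _ x])
    then show "Matrix.vec (2 * N) (F (\<Phi> t x)) =
        mat_exp (t \<cdot>\<^sub>m rotation_mat N \<mu>) *\<^sub>v Matrix.vec (2 * N) (F x)"
      by (simp only: F_def mat_exp_rotation_mat)
  qed simp
  ultimately show ?thesis unfolding linearizable_by_Ck_embedding_def by blast
qed

theorem theorem1:
  fixes k :: enat
    and X :: "'a mfd"
    and \<Phi> :: "real \<Rightarrow> 'a \<Rightarrow> 'a"
  assumes "1 \<le> k"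
    and "Ck_manifold k X"
    and "compact_space (mfd_top X)"
    and "Ck_flow k X \<Phi>"
  shows "linearizable_by_Ck_embedding k X \<Phi> \<longleftrightarrow>
    (\<exists>l \<Theta>. Ck_torus_action k l X \<Theta> \<and> one_parameter_subgroup \<Phi> l \<Theta>)"
proof
  assume "linearizable_by_Ck_embedding k X \<Phi>"
  then obtain n F where "Ck_embedding k X (Euclidean_mfd n) F" "linearizing X \<Phi> n F"
    unfolding linearizable_by_Ck_embedding_def by (elim exE conjE)
  then show "\<exists>l \<Theta>. Ck_torus_action k l X \<Theta> \<and> one_parameter_subgroup \<Phi> l \<Theta>"
    using assms(4) by (intro linearizable_imp_torus_action[OF assms(1-3)]) (auto simp: Ck_flow_def)
next
  assume "\<exists>l \<Theta>. Ck_torus_action k l X \<Theta> \<and> one_parameter_subgroup \<Phi> l \<Theta>"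
  then obtain l \<Theta> where "Ck_torus_action k l X \<Theta>" "one_parameter_subgroup \<Phi> l \<Theta>"
    by (elim exE conjE)
  then show "linearizable_by_Ck_embedding k X \<Phi>"
    by (intro Ck_torus_action_on.linearizable[OF _ assms(3)] Ck_torus_action_on.intro assms(1,2))
qed

end
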